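(* Let $k\in\mathbb{N}$, let $G$ be a compact monothetic group with generator $\gamma_0$, and let $(X,T)$, $X=G^k$, be the Milnes type skew product dynamical system with base group $G$. If the dual group $\hat G$ of $G$ has no non-trivial element of finite order, then: (i) for each $x$ in $X$ the points $T^n(x)$ ($n=1,2,3,\ldots$) are uniformly distributed in $X$; in particular $(X,T)$ is minimal; (ii) $(X,T)$ is strictly ergodic.
   Context: A compact monothetic group with generator $\gamma_0$ is a compact Hausdorff topological group $G$ such that the subgroup generated by $\gamma_0\in G$ is dense in $G$ (so $G$ is abelian; it is written additively). Milnes type skew product dynamical system with base group $G$: $X=G^k$ and $T:X\to X$ is the homeomorphism $T(x_1,\ldots,x_k)=(y_1,\ldots,y_k)$, where for $i=1,\ldots,k$ $$y_i=\binom{k}{i}\gamma_0+\sum_{j=1}^{i}\binom{k-j}{i-j}x_j .$$ $\mu$ denotes the normalized Haar measure on the compact group $X=G^k$. The points $T^n(x)$ are uniformly distributed in $X$ if for every $f\in C(X)$ one has $\lim_{N\to\infty}\frac1N\sum_{n=0}^{N-1}f(T^n(x))=\int_X f\,d\mu$. A dynamical system $(X,T)$ ($X$ compact Hausdorff, $T$ a homeomorphism of $X$) is minimal if the orbit $\{T^nx:n\in\mathbb{Z}\}$ of each point $x\in X$ is dense in $X$; it is uniquely ergodic if there is a unique $T$-invariant (regular Borel) probability measure on $X$; it is strictly ergodic if it is minimal and uniquely ergodic. *)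

theory Defs
  imports "HOL-Probability.Probability" "HOL-Algebra.Group"
    "HOL-Computational_Algebra.Group_Closure"
begin

section \<open>Compact monothetic groups and the dual group\<close>

text \<open>The group \<open>G\<close> is a type. A monothetic Hausdorff group is abelian, so the additive class
  \<^class>\<open>topological_ab_group_add\<close> is no restriction.\<close>

definition compact_monothetic :: "'a::{topological_ab_group_add, t2_space} \<Rightarrow> bool" where
  "compact_monothetic \<gamma> \<longleftrightarrow>
     compact (UNIV :: 'a set) \<and> closure (group_closure {\<gamma>}) = (UNIV :: 'a set)"

definition dual_group :: "('a::topological_ab_group_add \<Rightarrow> complex) monoid" where
  "dual_group = \<lparr>
     carrier = {\<phi>. continuous_on UNIV \<phi> \<and> (\<forall>x. norm (\<phi> x) = 1) \<and> (\<forall>x y. \<phi> (x + y) = \<phi> x * \<phi> y)},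
     mult = (\<lambda>\<phi> \<psi> x. \<phi> x * \<psi> x),
     one = (\<lambda>_. 1)\<rparr>"

definition no_nontrivial_finite_order :: "('g, 'm) monoid_scheme \<Rightarrow> bool" where
  "no_nontrivial_finite_order H \<longleftrightarrow>
     (\<forall>h\<in>carrier H. (\<exists>n::nat. n \<ge> 1 \<and> h [^]\<^bsub>H\<^esub> n = \<one>\<^bsub>H\<^esub>) \<longrightarrow> h = \<one>\<^bsub>H\<^esub>)"

section \<open>Measures on topological spaces\<close>

definition regular_borel_prob :: "'b topology \<Rightarrow> 'b measure \<Rightarrow> bool" where
  "regular_borel_prob X \<mu> \<longleftrightarrow>
     prob_space \<mu> \<and> space \<mu> = topspace X \<and>
     sets \<mu> = sigma_sets (topspace X) {U. openin X U} \<and>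
     (\<forall>A\<in>sets \<mu>.
        emeasure \<mu> A = (INF U\<in>{U. openin X U \<and> A \<subseteq> U}. emeasure \<mu> U) \<and>
        emeasure \<mu> A = (SUP K\<in>{K. compactin X K \<and> K \<subseteq> A}. emeasure \<mu> K))"

definition invariant_measure :: "('b \<Rightarrow> 'b) \<Rightarrow> 'b measure \<Rightarrow> bool" where
  "invariant_measure T \<mu> \<longleftrightarrow> T \<in> measurable \<mu> \<mu> \<and> distr \<mu> \<mu> T = \<mu>"

definition normalized_haar :: "'b topology \<Rightarrow> ('b \<Rightarrow> 'b \<Rightarrow> 'b) \<Rightarrow> 'b measure \<Rightarrow> bool" where
  "normalized_haar X add \<mu> \<longleftrightarrow>
     regular_borel_prob X \<mu> \<and> (\<forall>g\<in>topspace X. invariant_measure (add g) \<mu>)"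

definition uniformly_distributed :: "'b topology \<Rightarrow> 'b measure \<Rightarrow> (nat \<Rightarrow> 'b) \<Rightarrow> bool" where
  "uniformly_distributed X \<mu> s \<longleftrightarrow>
     (\<forall>f :: 'b \<Rightarrow> complex. continuous_map X euclidean f \<longrightarrow>
        (\<lambda>N. (\<Sum>n<N. f (s n)) / of_nat N) \<longlonglongrightarrow> (\<integral>x. f x \<partial>\<mu>))"

section \<open>Dynamical systems\<close>

definition dynamical_system :: "'b topology \<Rightarrow> ('b \<Rightarrow> 'b) \<Rightarrow> bool" where
  "dynamical_system X T \<longleftrightarrow> compact_space X \<and> Hausdorff_space X \<and> homeomorphic_map X X T"

text \<open>The two-sided orbit; the inverse of \<open>T\<close> is taken on the space, not on the whole type.\<close>

definition orbit_Z :: "'b topology \<Rightarrow> ('b \<Rightarrow> 'b) \<Rightarrow> 'b \<Rightarrow> 'b set" where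
  "orbit_Z X T x =
     range (\<lambda>n::nat. (T ^^ n) x) \<union> range (\<lambda>n::nat. (inv_into (topspace X) T ^^ n) x)"

definition minimal_system :: "'b topology \<Rightarrow> ('b \<Rightarrow> 'b) \<Rightarrow> bool" where
  "minimal_system X T \<longleftrightarrow>
     dynamical_system X T \<and> (\<forall>x\<in>topspace X. X closure_of (orbit_Z X T x) = topspace X)"

definition uniquely_ergodic :: "'b topology \<Rightarrow> ('b \<Rightarrow> 'b) \<Rightarrow> bool" where
  "uniquely_ergodic X T \<longleftrightarrow>
     dynamical_system X T \<and> (\<exists>!\<mu>. regular_borel_prob X \<mu> \<and> invariant_measure T \<mu>)"

definition strictly_ergodic :: "'b topology \<Rightarrow> ('b \<Rightarrow> 'b) \<Rightarrow> bool" where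
  "strictly_ergodic X T \<longleftrightarrow> minimal_system X T \<and> uniquely_ergodic X T"

section \<open>The Milnes type skew product\<close>

text \<open>A point of \<open>G^k\<close> is a function on \<open>{1..k}\<close>, extended by \<^const>\<open>undefined\<close> elsewhere.\<close>

definition power_space :: "nat \<Rightarrow> (nat \<Rightarrow> 'a::topological_space) topology" where
  "power_space k = product_topology (\<lambda>_. euclidean) {1..k}"

definition power_add :: "nat \<Rightarrow> (nat \<Rightarrow> 'a::plus) \<Rightarrow> (nat \<Rightarrow> 'a) \<Rightarrow> (nat \<Rightarrow> 'a)" where
  "power_add k x y = (\<lambda>i\<in>{1..k}. x i + y i)"

definition haar_power :: "nat \<Rightarrow> (nat \<Rightarrow> 'a::topological_ab_group_add) measure" where
  "haar_power k = (THE \<mu>. normalized_haar (power_space k) (power_add k) \<mu>)"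

definition nat_multiple :: "nat \<Rightarrow> 'a::comm_monoid_add \<Rightarrow> 'a" where
  "nat_multiple n x = (\<Sum>_<n. x)"

definition milnes_map :: "nat \<Rightarrow> 'a::ab_group_add \<Rightarrow> (nat \<Rightarrow> 'a) \<Rightarrow> (nat \<Rightarrow> 'a)" where
  "milnes_map k \<gamma> x =
     (\<lambda>i\<in>{1..k}. nat_multiple (k choose i) \<gamma> +
        (\<Sum>j=1..i. nat_multiple ((k - j) choose (i - j)) (x j)))"

end

theory Submission
  imports Defs "HOL-Real_Asymp.Real_Asymp"
begin

text \<open>By torsion-freeness \<open>\<psi> \<gamma>\<close> is not a root of unity for any non-trivial character \<open>\<psi>\<close>
  of \<open>G\<close>. Along an orbit, a non-trivial character of \<open>G\<^sup>k\<close> is a polynomial phase: iterated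
  multiplicative differences end in a constant power of some \<open>\<psi> \<gamma>\<close>, and van der Corput's inequality
  gives mean \<open>0\<close>. Characters span a dense set of continuous functions, so the orbit averages of every
  continuous function converge to a limit that depends neither on the orbit nor on a translation. This limit is
  a positive invariant functional, whose Riesz measure is the Haar measure; unique ergodicity and minimality
  follow.

  Density needs enough characters on \<open>G\<close>, obtained without Haar measure from almost periodicity:
  for continuous \<open>h\<close> the averages of \<open>h (y + n \<gamma>) w\<^sup>n\<close> over \<open>n\<close> converge uniformly
  in \<open>y\<close> to a multiple of a character. If no character separates \<open>g\<close> from \<open>0\<close>, all of these limits vanish
  for \<open>h y = f y - f (y + g)\<close>, uniformly in \<open>w\<close>; then the autocorrelations of \<open>h (n \<gamma>)\<close> are small
  in mean square, against the recurrence of \<open>n \<gamma>\<close> to \<open>0\<close>.\<close>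

section \<open>Weyl equidistribution\<close>

text \<open>Torsion-freeness is needed for high powers: if \<open>r\<close> is the last non-trivial
  coordinate of a character of \<open>G\<^sup>k\<close>, the differences along an orbit end in
  \<open>\<psi> r \<gamma>\<close> raised to \<open>k * (k - 1) * ... * (k - r + 1)\<close>, which
  is a positive exponent because \<open>r \<le> k\<close>. The lags in van der Corput's inequality
  raise it further. \<open>haar_power\<close> is specified by \<open>THE\<close>, so existence and
  uniqueness of Haar measure both have to be established. Orbit averages and integrals against any
  Haar measure are therefore treated by one convergence argument: both vanish on non-trivial
  characters, hence they share their limit on all continuous functions. Translates are carried along
  in the averages for two reasons. They make the limit functional invariant under the group. They
  also make it strictly positive, since finitely many translates of a non-empty open set cover the
  space; every forward orbit is then dense. This in turn gives surjectivity of the map, so no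
  inverse has to be computed.\<close>

definition mean_tends :: "(nat \<Rightarrow> complex) \<Rightarrow> complex \<Rightarrow> bool" where
  "mean_tends s c \<longleftrightarrow> (\<lambda>N. (\<Sum>n<N. s n) / of_nat N) \<longlonglongrightarrow> c"

lemma mean_tends_const: "mean_tends (\<lambda>_. c) c"
  unfolding mean_tends_def
  by (rule tendsto_eventually, rule eventually_sequentiallyI[of 1]) simp

lemma mean_tends_add: "mean_tends s c \<Longrightarrow> mean_tends t d \<Longrightarrow> mean_tends (\<lambda>n. s n + t n) (c + d)"
  unfolding mean_tends_def by (simp add: sum.distrib add_divide_distrib tendsto_add)

lemma mean_tends_cmult: "mean_tends s c \<Longrightarrow> mean_tends (\<lambda>n. d * s n) (d * c)"
  unfolding mean_tends_def sum_distrib_left[symmetric] times_divide_eq_right[symmetric]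
  by (rule tendsto_mult_left)

lemma mean_tends_sum:
  assumes "\<And>i. i \<in> I \<Longrightarrow> mean_tends (s i) (c i)"
  shows "mean_tends (\<lambda>n. \<Sum>i\<in>I. s i n) (\<Sum>i\<in>I. c i)"
  using assms
proof (induction I rule: infinite_finite_induct)
  case (insert i I)
  then show ?case by (simp add: mean_tends_add)
qed (use mean_tends_const[of 0] in simp_all)

text \<open>Shifting by \<open>m\<close> exchanges \<open>m\<close> terms at one end of the sum for
  \<open>m\<close> at the other, a number independent of \<open>N\<close>.\<close>

lemma mean_shift_diff:
  fixes s :: "nat \<Rightarrow> complex"
  assumes s: "\<And>n. norm (s n) \<le> 1"
  shows "(\<lambda>N. (\<Sum>n<N. s (n + m)) / of_nat N - (\<Sum>n<N. s n) / of_nat N) \<longlonglongrightarrow> 0"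
proof (rule Lim_null_comparison)
  show "\<forall>\<^sub>F N in sequentially. norm ((\<Sum>n<N. s (n + m)) / of_nat N - (\<Sum>n<N. s n) / of_nat N)
      \<le> 2 * real m / real N"
  proof (rule always_eventually, rule allI)
    fix N
    have 1: "(\<Sum>n<N + m. s n) = (\<Sum>n<m. s n) + (\<Sum>n<N. s (n + m))"
      by (induction N) (auto simp: algebra_simps)
    have 2: "(\<Sum>n<N + m. s n) = (\<Sum>n<N. s n) + (\<Sum>n<m. s (n + N))"
      by (induction m) (auto simp: algebra_simps)
    have "(\<Sum>n<N. s (n + m)) - (\<Sum>n<N. s n) = (\<Sum>n<m. s (n + N)) - (\<Sum>n<m. s n)"
      using 1 2 by (simp add: algebra_simps)
    then have "norm ((\<Sum>n<N. s (n + m)) - (\<Sum>n<N. s n)) = norm ((\<Sum>n<m. s (n + N)) - (\<Sum>n<m. s n))"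
      by simp
    also have "\<dots> \<le> norm (\<Sum>n<m. s (n + N)) + norm (\<Sum>n<m. s n)"
      by (rule norm_triangle_ineq4)
    also have "\<dots> \<le> real m + real m"
      using sum_norm_le[of "{..<m}" "\<lambda>n. s (n + N)" "\<lambda>_. 1"] sum_norm_le[of "{..<m}" s "\<lambda>_. 1"] s
      by simp
    finally show "norm ((\<Sum>n<N. s (n + m)) / of_nat N - (\<Sum>n<N. s n) / of_nat N) \<le> 2 * real m / real N"
      by (simp add: diff_divide_distrib[symmetric] norm_divide divide_right_mono)
  qed
  show "(\<lambda>N. 2 * real m / real N) \<longlonglongrightarrow> 0"
    by real_asymp
qed

lemma mean_tends_shift:
  assumes "\<And>n. norm (s n) \<le> 1" "mean_tends s c"
  shows "mean_tends (\<lambda>n. s (n + m)) c"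
  using Lim_transform[OF assms(2)[unfolded mean_tends_def] mean_shift_diff] assms(1)
  unfolding mean_tends_def by blast

lemma mean_tends_cnj: "mean_tends s c \<Longrightarrow> mean_tends (\<lambda>n. cnj (s n)) (cnj c)"
  unfolding mean_tends_def by (drule tendsto_cnj) simp

lemma norm_sum_squared_le:
  fixes a :: "'b \<Rightarrow> complex"
  shows "(norm (\<Sum>i\<in>I. a i))\<^sup>2 \<le> card I * (\<Sum>i\<in>I. (norm (a i))\<^sup>2)"
proof -
  have "(norm (\<Sum>i\<in>I. a i))\<^sup>2 \<le> (\<Sum>i\<in>I. norm (a i))\<^sup>2"
    by (intro power_mono norm_sum) auto
  also have "\<dots> \<le> card I * (\<Sum>i\<in>I. (norm (a i))\<^sup>2)"
    using sum_squared_le_sum_of_squares[of "\<lambda>i. norm (a i)" I] by (simp add: mult.commute)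
  finally show ?thesis .
qed

text \<open>Averaging over windows of length \<open>H\<close> changes nothing in the limit, while
  vanishing correlations leave only the diagonal, so the mean square of a window sum tends to
  \<open>H\<close> instead of \<open>H\<^sup>2\<close>. Cauchy-Schwarz then bounds the averages
  asymptotically by \<open>1 / sqrt H\<close>.\<close>

lemma van_der_Corput:
  assumes s: "\<And>n. norm (s n) = 1"
    and h: "\<And>h. h \<ge> 1 \<Longrightarrow> mean_tends (\<lambda>n. s (n + h) * cnj (s n)) 0"
  shows "mean_tends s 0"
proof -
  have corr: "mean_tends (\<lambda>n. s (n + i) * cnj (s (n + j))) (if i = j then 1 else 0)" for i j
  proof -
    consider "i = j" | "j < i" | "i < j" by linarith
    then show ?thesis
    proof cases
      case 1
      then show ?thesis
        using mean_tends_const[of 1] s by (simp add: complex_norm_square[symmetric])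
    next
      case 2
      then show ?thesis
        using mean_tends_shift[OF _ h[of "i - j"], of j] s
        by (simp add: norm_mult add.commute add.left_commute)
    next
      case 3
      then have "mean_tends (\<lambda>n. s (n + j) * cnj (s (n + i))) 0"
        using mean_tends_shift[OF _ h[of "j - i"], of i] s
        by (simp add: norm_mult add.commute add.left_commute)
      from mean_tends_cnj[OF this] 3 show ?thesis
        by (simp add: mult.commute)
    qed
  qed
  define A where "A N = (\<Sum>n<N. s n) / of_nat N" for N
  define W where "W H n = (\<Sum>i<H. s (n + i))" for H n :: nat
  have W2: "mean_tends (\<lambda>n. of_real ((norm (W H n))\<^sup>2)) (of_nat H)" for H
  proof -
    have eq: "of_real ((norm (W H n))\<^sup>2) = (\<Sum>i<H. \<Sum>j<H. s (n + i) * cnj (s (n + j)))" for n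
      unfolding complex_norm_square W_def by (simp add: sum_product)
    have "mean_tends (\<lambda>n. \<Sum>i<H. \<Sum>j<H. s (n + i) * cnj (s (n + j)))
        (\<Sum>i<H. \<Sum>j<H. if i = j then 1 else 0)"
      by (intro mean_tends_sum corr)
    then show ?thesis unfolding eq by simp
  qed
  have W1: "(\<lambda>N. (\<Sum>n<N. W H n) / of_nat N - of_nat H * A N) \<longlonglongrightarrow> 0" for H
  proof -
    have eq: "(\<Sum>n<N. W H n) / of_nat N - of_nat H * A N
      = (\<Sum>i<H. (\<Sum>n<N. s (n + i)) / of_nat N - (\<Sum>n<N. s n) / of_nat N)" for N
      unfolding W_def A_def
      by (subst sum.swap) (simp add: sum_subtractf sum_divide_distrib)
    show ?thesis
      unfolding eq using s by (intro tendsto_null_sum mean_shift_diff) simp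
  qed
  show ?thesis
    unfolding mean_tends_def A_def[symmetric]
  proof (rule tendstoI, goal_cases)
    case (1 e)
    \<comment> \<open>This size gives \<open>2 * H \<le> (H * e / 2)\<^sup>2\<close>: the mean
      square of the window sums, eventually below \<open>2 * H\<close>, uses up half of the target
      \<open>H * e\<close>; the replacement of \<open>H * A N\<close> by window sums uses the other
      half.\<close>
    obtain H' :: nat where H': "8 / e\<^sup>2 < of_nat H'"
      using reals_Archimedean2 by blast
    define H where "H = Suc H'"
    have H: "8 / e\<^sup>2 < of_nat H" "H \<ge> 1" using H' by (auto simp: H_def)
    have b1: "\<forall>\<^sub>F N in sequentially. norm ((\<Sum>n<N. W H n) / of_nat N - of_nat H * A N) < H * e / 2"
      using W1[of H] 1 H(2) by (auto simp: tendsto_iff dest: spec[of _ "H * e/2"])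
    have "Re ((\<Sum>n<N. of_real ((norm (W H n))\<^sup>2)) / of_nat N) = (\<Sum>n<N. (norm (W H n))\<^sup>2) / of_nat N" for N
      by (simp del: of_real_power add: Re_divide_of_nat)
    then have "(\<lambda>N. (\<Sum>n<N. (norm (W H n))\<^sup>2) / of_nat N) \<longlonglongrightarrow> H"
      using tendsto_Re[OF W2[of H, unfolded mean_tends_def]] by simp
    then have b2: "\<forall>\<^sub>F N in sequentially. (\<Sum>n<N. (norm (W H n))\<^sup>2) / of_nat N < 2 * H"
      by (rule order_tendstoD) (use H in auto)
    show ?case
      using b1 b2 eventually_gt_at_top[of 0]
    proof eventually_elim
      case (elim N)
      have "(norm ((\<Sum>n<N. W H n) / of_nat N))\<^sup>2 = (norm (\<Sum>n<N. W H n))\<^sup>2 / (real N)\<^sup>2"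
        by (simp add: norm_divide power_divide)
      also have "\<dots> \<le> (real N * (\<Sum>n<N. (norm (W H n))\<^sup>2)) / (real N)\<^sup>2"
        by (intro divide_right_mono norm_sum_squared_le[of _ "{..<N}", simplified]) auto
      also have "\<dots> < 2 * H"
        using elim by (simp add: power2_eq_square)
      also have "\<dots> \<le> (H * e / 2)\<^sup>2"
        using H 1 by (simp add: field_simps power2_eq_square)
      finally have "norm ((\<Sum>n<N. W H n) / of_nat N) < H * e / 2"
        by (rule power_less_imp_less_base) (use 1 in auto)
      moreover have "norm (of_nat H * A N)
          \<le> norm ((\<Sum>n<N. W H n) / of_nat N) + norm ((\<Sum>n<N. W H n) / of_nat N - of_nat H * A N)"
        by (rule norm_triangle_sub[of "of_nat H * A N", simplified norm_minus_commute])
      ultimately have "H * norm (A N) < H * e"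
        using elim(1) by (simp add: norm_mult)
      then show ?case using H by (simp add: dist_norm)
    qed
  qed
qed

text \<open>Stands for sequences exp(i p(n)) with \<open>p\<close> a real polynomial of degree at
  most \<open>d\<close>, without naming \<open>p\<close>. If \<open>a\<close> is the coefficient of
  degree \<open>d\<close>, then \<open>w\<close> is exp(i d! a).\<close>

primrec polyphase :: "nat \<Rightarrow> complex \<Rightarrow> (nat \<Rightarrow> complex) \<Rightarrow> bool" where
  "polyphase 0 w s \<longleftrightarrow> norm w = 1 \<and> (\<forall>n. s n = w)"
| "polyphase (Suc d) w s \<longleftrightarrow> (\<forall>n. norm (s n) = 1) \<and> polyphase d w (\<lambda>n. s (Suc n) * cnj (s n))"

lemma polyphase_norm: "polyphase d w s \<Longrightarrow> norm (s n) = 1"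
  by (cases d) auto

lemma polyphase_shift: "polyphase d w s \<Longrightarrow> polyphase d w (\<lambda>n. s (n + m))"
proof (induction d arbitrary: s)
  case (Suc d)
  from Suc.IH[of "\<lambda>n. s (Suc n) * cnj (s n)"] Suc.prems show ?case by simp
qed simp

lemma polyphase_mult:
  "polyphase d w s \<Longrightarrow> polyphase d v t \<Longrightarrow> polyphase d (w * v) (\<lambda>n. s n * t n)"
proof (induction d arbitrary: s t)
  case (Suc d)
  from Suc.IH[of "\<lambda>n. s (Suc n) * cnj (s n)" "\<lambda>n. t (Suc n) * cnj (t n)"] Suc.prems
  show ?case by (simp add: norm_mult mult_ac)
qed (simp add: norm_mult)

lemma polyphase_one: "polyphase d 1 (\<lambda>_. 1)"
  by (induction d) auto

text \<open>The difference at lag \<open>h\<close> telescopes into \<open>h\<close> shifted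
  differences at lag one, each a polynomial phase with the same constant \<open>w\<close>.\<close>

lemma polyphase_diff:
  assumes "polyphase (Suc d) w s"
  shows "polyphase d (w ^ h) (\<lambda>n. s (n + h) * cnj (s n))"
proof (induction h)
  case 0
  have "s n * cnj (s n) = 1" for n
    using polyphase_norm[OF assms] by (simp add: complex_norm_square[symmetric])
  then show ?case by (simp add: polyphase_one)
next
  case (Suc h)
  have "cnj (s (n + h)) * s (n + h) = 1" for n
    using polyphase_norm[OF assms] by (simp add: complex_norm_square[symmetric] mult.commute)
  then have eq: "s (Suc (n + h)) * cnj (s (n + h)) * (s (n + h) * cnj (s n)) = s (n + Suc h) * cnj (s n)" for n
    by (metis (no_types, lifting) add_Suc_right mult.assoc mult.left_neutral)
  have "polyphase d w (\<lambda>n. s (Suc (n + h)) * cnj (s (n + h)))"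
    using polyphase_shift[of d w "\<lambda>n. s (Suc n) * cnj (s n)" h] assms by simp
  from polyphase_mult[OF this Suc.IH] show ?case
    unfolding eq by simp
qed

text \<open>Differencing at lag \<open>h\<close> replaces \<open>w\<close> by \<open>w ^ h\<close>.
  A hypothesis \<open>w \<noteq> 1\<close> would not survive this step; excluding all roots of unity
  does, and the induction ends in a geometric sum.\<close>

lemma Weyl_equidistribution:
  assumes "polyphase (Suc d) w s" "\<And>q. q \<ge> 1 \<Longrightarrow> w ^ q \<noteq> 1"
  shows "mean_tends s 0"
  using assms
proof (induction d arbitrary: w s)
  case 0
  have n: "norm (s n) = 1" for n using 0 by simp
  have "cnj (s n) * s n = 1" for n
    using n by (simp add: complex_norm_square[symmetric] mult.commute)
  then have "s (Suc n) = w * s n" for n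
    using 0 by (metis (no_types, lifting) mult.assoc mult.right_neutral polyphase.simps)
  then have s: "s n = w ^ n * s 0" for n by (induction n) auto
  have sums: "(\<Sum>n<N. s n) = (\<Sum>n<N. w ^ n) * s 0" for N
    unfolding sum_distrib_right by (rule sum.cong) (auto intro: s)
  have w: "norm w = 1" "w \<noteq> 1" using 0(1) 0(2)[of 1] by auto
  have "(\<lambda>N. (w ^ N - 1) / (w - 1) * s 0 / of_nat N) \<longlonglongrightarrow> 0"
  proof (rule Lim_null_comparison)
    show "\<forall>\<^sub>F N in sequentially. norm ((w ^ N - 1) / (w - 1) * s 0 / of_nat N) \<le> 2 / norm (w - 1) / real N"
      by (rule always_eventually)
        (auto simp: norm_mult norm_divide n w norm_power intro!: divide_right_mono order.trans[OF norm_triangle_ineq4])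
    show "(\<lambda>N. 2 / norm (w - 1) / real N) \<longlonglongrightarrow> 0" by real_asymp
  qed
  then show ?case
    unfolding mean_tends_def sums using w by (simp add: geometric_sum)
next
  case (Suc d)
  show ?case
  proof (rule van_der_Corput)
    fix h :: nat assume h: "h \<ge> 1"
    show "mean_tends (\<lambda>n. s (n + h) * cnj (s n)) 0"
    proof (rule Suc.IH)
      show "polyphase (Suc d) (w ^ h) (\<lambda>n. s (n + h) * cnj (s n))"
        by (rule polyphase_diff[OF Suc.prems(1)])
      show "(w ^ h) ^ q \<noteq> 1" if "q \<ge> 1" for q
        using Suc.prems(2)[of "h * q"] that h by (simp add: power_mult)
    qed
  qed (rule polyphase_norm[OF Suc.prems(1)])
qed

section \<open>Regular Borel measures from positive functionals\<close>

lemma Urysohn_function: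
  assumes X: "compact_space X" "Hausdorff_space X"
    and "closedin X K" "openin X U" "K \<subseteq> U"
  obtains f :: "'b \<Rightarrow> real" where "continuous_map X euclideanreal f"
    "\<And>x. x \<in> topspace X \<Longrightarrow> 0 \<le> f x \<and> f x \<le> 1"
    "\<And>x. x \<in> K \<Longrightarrow> f x = 1" "\<And>x. x \<in> topspace X - U \<Longrightarrow> f x = 0"
proof -
  have "normal_space X" "closedin X (topspace X - U)" "disjnt (topspace X - U) K"
    using assms compact_Hausdorff_or_regular_imp_normal_space by (auto simp: disjnt_iff)
  with Urysohn_lemma[of X "topspace X - U" K 0 1] \<open>closedin X K\<close>
  obtain f where f: "continuous_map X (top_of_set {0..1::real}) f"
    "f ` (topspace X - U) \<subseteq> {0}" "f ` K \<subseteq> {1}"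
    by auto
  show thesis
    by (rule that[of f]) (use f in \<open>auto simp: continuous_map_in_subtopology\<close>)
qed

lemma regular_borel_prob_measurable:
  fixes f :: "'b \<Rightarrow> 'c::topological_space"
  assumes \<mu>: "regular_borel_prob X \<mu>" and f: "continuous_map X euclidean f"
  shows "f \<in> borel_measurable \<mu>"
proof (rule borel_measurableI)
  fix S :: "'c set" assume S: "open S"
  have "openin X {x \<in> topspace X. f x \<in> S}"
    by (rule openin_continuous_map_preimage[OF f]) (use S in simp)
  moreover have "f -` S \<inter> space \<mu> = {x \<in> topspace X. f x \<in> S}"
    using \<mu> by (auto simp: regular_borel_prob_def)
  ultimately show "f -` S \<inter> space \<mu> \<in> sets \<mu>"
    using \<mu> by (auto simp: regular_borel_prob_def)
qed

lemma continuous_map_bounded: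
  fixes f :: "'b \<Rightarrow> 'c::real_normed_vector"
  assumes "compact_space X" "continuous_map X euclidean f"
  obtains B where "\<And>x. x \<in> topspace X \<Longrightarrow> norm (f x) \<le> B"
proof -
  have "compact (f ` topspace X)"
    using image_compactin[OF _ assms(2), of "topspace X"] assms(1) by (simp add: compact_space_def)
  then show thesis
    using that compact_imp_bounded by (force simp: bounded_iff)
qed

lemma regular_borel_prob_integrable:
  fixes f :: "'b \<Rightarrow> 'c::{banach, second_countable_topology}"
  assumes X: "compact_space X" and \<mu>: "regular_borel_prob X \<mu>" and f: "continuous_map X euclidean f"
  shows "integrable \<mu> f"
proof -
  interpret prob_space \<mu> using \<mu> by (simp add: regular_borel_prob_def)
  obtain B where "\<And>x. x \<in> topspace X \<Longrightarrow> norm (f x) \<le> B"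
    using continuous_map_bounded[OF X f] by blast
  then show ?thesis
    using \<mu> by (intro integrable_const_bound[of _ B] regular_borel_prob_measurable[OF \<mu> f])
      (auto simp: regular_borel_prob_def)
qed

lemma invariant_measure_integral:
  fixes f :: "'b \<Rightarrow> 'c::{banach, second_countable_topology}"
  assumes "invariant_measure \<phi> \<mu>" "f \<in> borel_measurable \<mu>"
  shows "(\<integral>x. f (\<phi> x) \<partial>\<mu>) = (\<integral>x. f x \<partial>\<mu>)"
  using integral_distr[of \<phi> \<mu> \<mu> f] assms by (simp add: invariant_measure_def)

text \<open>Inner regularity reduces equality to compact sets \<open>K\<close>. Outer regularity
  leaves open sets \<open>U\<close> around \<open>K\<close>, and a Urysohn function between the two
  indicators transfers the equality of integrals. This gives one inequality, and exchanging the
  measures gives the other.\<close>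

lemma regular_borel_prob_eqI:
  assumes X: "compact_space X" "Hausdorff_space X"
    and \<mu>: "regular_borel_prob X \<mu>" and \<nu>: "regular_borel_prob X \<nu>"
    and eq: "\<And>f :: 'b \<Rightarrow> real. continuous_map X euclideanreal f \<Longrightarrow> (\<integral>x. f x \<partial>\<mu>) = (\<integral>x. f x \<partial>\<nu>)"
  shows "\<mu> = \<nu>"
proof -
  have le: "emeasure M K \<le> emeasure N K"
    if M: "regular_borel_prob X M" and N: "regular_borel_prob X N" and K: "compactin X K"
      and eq: "\<And>f :: 'b \<Rightarrow> real. continuous_map X euclideanreal f \<Longrightarrow> (\<integral>x. f x \<partial>M) = (\<integral>x. f x \<partial>N)"
    for M N :: "'b measure" and K
  proof -
    interpret M: prob_space M using M by (simp add: regular_borel_prob_def)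
    interpret N: prob_space N using N by (simp add: regular_borel_prob_def)
    have sp: "space M = topspace X" "space N = topspace X"
      using M N by (auto simp: regular_borel_prob_def)
    have op: "U \<in> sets M" "U \<in> sets N" if "openin X U" for U
      using M N that by (auto simp: regular_borel_prob_def)
    have K': "closedin X K"
      using K X by (simp add: compactin_imp_closedin)
    then have Kc: "openin X (topspace X - K)" "K \<subseteq> topspace X"
      by (auto simp: closedin_def)
    then have "topspace X - (topspace X - K) \<in> sets M" "topspace X - (topspace X - K) \<in> sets N"
      using op[of "topspace X - K"] sp by (metis sets.compl_sets)+
    then have KM: "K \<in> sets M" "K \<in> sets N"
      using Kc(2) by (simp_all add: double_diff)
    have "emeasure N K = (INF U\<in>{U. openin X U \<and> K \<subseteq> U}. emeasure N U)"
      using N KM by (simp add: regular_borel_prob_def)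
    moreover have "emeasure M K \<le> emeasure N U" if U: "openin X U" "K \<subseteq> U" for U
    proof -
      obtain f :: "'b \<Rightarrow> real" where f: "continuous_map X euclideanreal f"
        "\<And>x. x \<in> topspace X \<Longrightarrow> 0 \<le> f x \<and> f x \<le> 1"
        "\<And>x. x \<in> K \<Longrightarrow> f x = 1" "\<And>x. x \<in> topspace X - U \<Longrightarrow> f x = 0"
        using Urysohn_function[OF X K' U] by metis
      have int: "integrable M f" "integrable N f"
        using f(2) regular_borel_prob_measurable[OF M f(1)] regular_borel_prob_measurable[OF N f(1)] sp
        by (auto intro!: M.integrable_const_bound[of _ 1] N.integrable_const_bound[of _ 1])
      have "measure M K = (\<integral>x. indicator K x \<partial>M)"
        using KM Kc sp by (simp add: Int_absorb2)
      also have "\<dots> \<le> (\<integral>x. f x \<partial>M)"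
        using f KM sp int
        by (intro integral_mono integrable_real_indicator)
          (auto simp: indicator_def less_top[symmetric])
      also have "\<dots> = (\<integral>x. f x \<partial>N)"
        by (rule eq[OF f(1)])
      also have "\<dots> \<le> (\<integral>x. indicator U x \<partial>N)"
        using f op[OF U(1)] sp int
        by (intro integral_mono integrable_real_indicator)
          (auto simp: indicator_def less_top[symmetric])
      also have "\<dots> = measure N U"
        using openin_subset[OF U(1)] sp by (simp add: Int_absorb2)
      finally show ?thesis
        by (simp add: M.emeasure_eq_measure N.emeasure_eq_measure)
    qed
    ultimately show ?thesis by (auto intro: INF_greatest)
  qed
  have "emeasure \<mu> K = emeasure \<nu> K" if "compactin X K" for K
    using le[OF \<mu> \<nu> that eq] le[OF \<nu> \<mu> that eq[symmetric]] by (rule antisym)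
  then have eqK: "(SUP K\<in>{K. compactin X K \<and> K \<subseteq> A}. emeasure \<mu> K)
      = (SUP K\<in>{K. compactin X K \<and> K \<subseteq> A}. emeasure \<nu> K)" for A
    by (intro SUP_cong) auto
  show ?thesis
  proof (rule measure_eqI)
    show "sets \<mu> = sets \<nu>"
      using \<mu> \<nu> by (simp add: regular_borel_prob_def)
    then show "emeasure \<mu> A = emeasure \<nu> A" if "A \<in> sets \<mu>" for A
      using that \<mu> \<nu> eqK[of A] unfolding regular_borel_prob_def by metis
  qed
qed

section \<open>Riesz construction: from a positive functional to a regular Borel measure\<close>

locale positive_functional =
  fixes X :: "'b topology" and L :: "('b \<Rightarrow> real) \<Rightarrow> real"
  assumes cpt: "compact_space X" and hausdorff: "Hausdorff_space X"
    and add: "continuous_map X euclideanreal f \<Longrightarrow> continuous_map X euclideanreal g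
      \<Longrightarrow> L (\<lambda>x. f x + g x) = L f + L g"
    and nonneg: "continuous_map X euclideanreal f \<Longrightarrow> (\<And>x. x \<in> topspace X \<Longrightarrow> 0 \<le> f x) \<Longrightarrow> 0 \<le> L f"
    and const: "L (\<lambda>_. c) = c"
begin

lemma mono:
  assumes "continuous_map X euclideanreal f" "continuous_map X euclideanreal g"
    and "\<And>x. x \<in> topspace X \<Longrightarrow> f x \<le> g x"
  shows "L f \<le> L g"
proof -
  have c: "continuous_map X euclideanreal (\<lambda>x. g x - f x)"
    using assms by (intro continuous_intros)
  have "L g = L (\<lambda>x. f x + (g x - f x))"
    by simp
  also have "\<dots> = L f + L (\<lambda>x. g x - f x)"
    using assms(1) c by (rule add)
  finally show ?thesis
    using nonneg[OF c] assms(3) by simp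
qed

text \<open>Vanishing off \<open>U\<close> is asked for instead of support inside \<open>U\<close>;
  it is easier to verify, and \<open>truncate\<close> recovers the support condition up to
  \<open>e\<close>.\<close>

definition subordinate :: "'b set \<Rightarrow> ('b \<Rightarrow> real) set" where
  "subordinate U = {f. continuous_map X euclideanreal f \<and> (\<forall>x\<in>topspace X. 0 \<le> f x \<and> f x \<le> 1)
     \<and> (\<forall>x\<in>topspace X - U. f x = 0)}"

definition open_content :: "'b set \<Rightarrow> ennreal" where
  "open_content U = (SUP f\<in>subordinate U. ennreal (L f))"

text \<open>The measure below is the one of the Riesz representation theorem. That it represents \<open>L\<close> is not
  shown: the invariance inherited from \<open>L\<close> makes it a Haar measure, and Haar integrals are determined by
  their values on characters.\<close>

definition borel_outer :: "'b set \<Rightarrow> ennreal" where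
  "borel_outer A = (INF U\<in>{U. openin X U \<and> A \<subseteq> U}. open_content U)"

lemma subordinateD:
  assumes "f \<in> subordinate U"
  shows "continuous_map X euclideanreal f" "x \<in> topspace X \<Longrightarrow> 0 \<le> f x" "x \<in> topspace X \<Longrightarrow> f x \<le> 1"
    "x \<in> topspace X \<Longrightarrow> x \<notin> U \<Longrightarrow> f x = 0"
  using assms by (auto simp: subordinate_def)

lemma zero_subordinate: "(\<lambda>_. 0) \<in> subordinate U"
  by (simp add: subordinate_def)

lemma L_subordinate: "f \<in> subordinate U \<Longrightarrow> 0 \<le> L f" "f \<in> subordinate U \<Longrightarrow> L f \<le> 1"
  using mono[of "\<lambda>_. 0" f] mono[of f "\<lambda>_. 1"] subordinateD[of f U] by (simp_all add: const)

lemma open_content_upper: "f \<in> subordinate U \<Longrightarrow> ennreal (L f) \<le> open_content U"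
  unfolding open_content_def by (rule SUP_upper)

lemma open_content_least:
  "(\<And>f. f \<in> subordinate U \<Longrightarrow> ennreal (L f) \<le> c) \<Longrightarrow> open_content U \<le> c"
  unfolding open_content_def by (rule SUP_least)

lemma open_content_mono: "U \<subseteq> V \<Longrightarrow> open_content U \<le> open_content V"
  by (rule open_content_least, rule open_content_upper) (auto simp: subordinate_def)

lemma open_content_le_1: "open_content U \<le> 1"
  by (rule open_content_least) (use L_subordinate in auto)

lemma open_content_empty: "open_content {} = 0"
proof -
  have "open_content {} \<le> 0"
  proof (rule open_content_least)
    fix f assume f: "f \<in> subordinate {}"
    then have "L f \<le> L (\<lambda>_. 0)"
      by (intro mono) (auto simp: subordinate_def)
    then show "ennreal (L f) \<le> 0"
      by (simp add: const ennreal_neg)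
  qed
  then show ?thesis by simp
qed

lemma open_content_topspace: "open_content (topspace X) = 1"
  using open_content_upper[of "\<lambda>_. 1" "topspace X"] open_content_le_1[of "topspace X"]
  by (auto simp: subordinate_def const intro: antisym)

text \<open>A subordinate function may be non-zero right up to the boundary of \<open>U\<close>.
  Cutting it at height \<open>e\<close> confines it to the closed set where
  \<open>f \<ge> e\<close>, which lies inside \<open>U\<close>, and lowers the value of
  \<open>L\<close> by at most \<open>e\<close>.\<close>

lemma truncate:
  assumes f: "f \<in> subordinate U" and e: "0 < e"
  obtains g K where "g \<in> subordinate U" "closedin X K" "K \<subseteq> U"
    "\<And>x. x \<in> topspace X - K \<Longrightarrow> g x = 0" "\<And>x. g x \<le> max (f x) 0" "ennreal (L f) \<le> ennreal (L g) + ennreal e"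
proof
  define g where "g x = max (f x - e) 0" for x
  define K where "K = {x \<in> topspace X. f x \<in> {e..}}"
  have fc: "continuous_map X euclideanreal f" using f by (simp add: subordinate_def)
  have gc: "continuous_map X euclideanreal g"
    unfolding g_def by (intro continuous_intros fc)
  show g: "g \<in> subordinate U"
    using f e gc by (auto simp: subordinate_def g_def)
  show "closedin X K"
    unfolding K_def by (rule closedin_continuous_map_preimage[OF fc]) auto
  show "K \<subseteq> U"
    using f e by (force simp: K_def subordinate_def)
  show "g x = 0" if "x \<in> topspace X - K" for x
    using that by (auto simp: K_def g_def)
  show "g x \<le> max (f x) 0" for x using e by (auto simp: g_def)
  have "continuous_map X euclideanreal (\<lambda>x. g x + e)"
    using gc by (intro continuous_intros)
  then have "L f \<le> L (\<lambda>x. g x + e)"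
    by (rule mono[OF fc]) (simp add: g_def)
  also have "\<dots> = L g + e"
    using gc by (simp add: add const)
  finally show "ennreal (L f) \<le> ennreal (L g) + ennreal e"
    using L_subordinate[OF g] e by (simp flip: ennreal_plus)
qed

lemma open_content_Un:
  assumes U: "openin X U" and V: "openin X V"
  shows "open_content (U \<union> V) \<le> open_content U + open_content V"
proof (rule open_content_least, rule ennreal_le_epsilon)
  fix f and e :: real assume f: "f \<in> subordinate (U \<union> V)" and e: "0 < e"
  obtain g K where g: "g \<in> subordinate (U \<union> V)" "closedin X K" "K \<subseteq> U \<union> V"
    "\<And>x. x \<in> topspace X - K \<Longrightarrow> g x = 0" "ennreal (L f) \<le> ennreal (L g) + ennreal e"
    using truncate[OF f e] by metis
  have "closedin X (K - V)" "K - V \<subseteq> U"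
    using g V by (auto simp: closedin_diff)
  then obtain \<phi> :: "'b \<Rightarrow> real" where \<phi>: "continuous_map X euclideanreal \<phi>"
    "\<And>x. x \<in> topspace X \<Longrightarrow> 0 \<le> \<phi> x \<and> \<phi> x \<le> 1"
    "\<And>x. x \<in> K - V \<Longrightarrow> \<phi> x = 1" "\<And>x. x \<in> topspace X - U \<Longrightarrow> \<phi> x = 0"
    using Urysohn_function[OF cpt hausdorff _ U] by metis
  have 1: "(\<lambda>x. g x * \<phi> x) \<in> subordinate U"
    unfolding subordinate_def
    using subordinateD[OF g(1)] \<phi> by (auto intro!: continuous_intros mult_le_one)
  \<comment> \<open>Off \<open>V\<close> a point lies either in \<open>K - V\<close>, where
    \<open>\<phi>\<close> is 1, or outside \<open>K\<close>, where \<open>g\<close> is 0. Hence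
    \<open>\<phi>\<close> splits \<open>g\<close> into a part for \<open>U\<close> and a part for
    \<open>V\<close>.\<close>
  have z: "g x * (1 - \<phi> x) = 0" if "x \<in> topspace X" "x \<notin> V" for x
    using \<phi>(3)[of x] g(4)[of x] that by auto
  have 2: "(\<lambda>x. g x * (1 - \<phi> x)) \<in> subordinate V"
    unfolding subordinate_def
    using subordinateD[OF g(1)] \<phi> z by (auto intro!: continuous_intros mult_le_one)
  have "L g = L (\<lambda>x. g x * \<phi> x + g x * (1 - \<phi> x))"
    by (simp add: algebra_simps)
  also have "\<dots> = L (\<lambda>x. g x * \<phi> x) + L (\<lambda>x. g x * (1 - \<phi> x))"
    by (rule add[OF subordinateD(1)[OF 1] subordinateD(1)[OF 2]])
  finally have "ennreal (L g) \<le> open_content U + open_content V"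
    using open_content_upper[OF 1] open_content_upper[OF 2] L_subordinate[OF 1] L_subordinate[OF 2]
    by (simp add: add_mono)
  with g(5) show "ennreal (L f) \<le> open_content U + open_content V + ennreal e"
    by (meson add_right_mono order.trans)
qed

lemma open_content_finite_UN:
  fixes U :: "nat \<Rightarrow> 'b set"
  shows "(\<And>i. i < n \<Longrightarrow> openin X (U i)) \<Longrightarrow> open_content (\<Union>i<n. U i) \<le> (\<Sum>i<n. open_content (U i))"
proof (induction n)
  case (Suc n)
  have "open_content (\<Union>i<Suc n. U i) = open_content ((\<Union>i<n. U i) \<union> U n)"
    by (simp add: lessThan_Suc Un_commute)
  also have "\<dots> \<le> open_content (\<Union>i<n. U i) + open_content (U n)"
    using Suc.prems by (intro open_content_Un openin_Union) auto
  also have "\<dots> \<le> (\<Sum>i<Suc n. open_content (U i))"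
    using Suc by (simp add: add_right_mono)
  finally show ?case .
qed (simp add: open_content_empty)

text \<open>A truncated function lives on a compact set, which finitely many of the
  \<open>U i\<close> cover; this turns finite into countable subadditivity.\<close>

lemma open_content_UN:
  fixes U :: "nat \<Rightarrow> 'b set"
  assumes U: "\<And>i. openin X (U i)"
  shows "open_content (\<Union>i. U i) \<le> (\<Sum>i. open_content (U i))"
proof (rule open_content_least, rule ennreal_le_epsilon)
  fix f and e :: real assume f: "f \<in> subordinate (\<Union>i. U i)" and e: "0 < e"
  obtain g K where g: "g \<in> subordinate (\<Union>i. U i)" "closedin X K" "K \<subseteq> (\<Union>i. U i)"
    "\<And>x. x \<in> topspace X - K \<Longrightarrow> g x = 0" "ennreal (L f) \<le> ennreal (L g) + ennreal e"
    using truncate[OF f e] by metis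
  have "compactin X K"
    using g(2) cpt by (simp add: closedin_compact_space)
  then obtain F where F: "finite F" "F \<subseteq> range U" "K \<subseteq> \<Union>F"
    using g(3) U by (auto simp: compactin_def) (metis (no_types, lifting) imageE)
  then obtain I where I: "finite I" "F = U ` I"
    by (meson finite_subset_image)
  obtain n where n: "I \<subseteq> {..<n}"
    using finite_nat_bounded[OF I(1)] by auto
  have "K \<subseteq> (\<Union>i<n. U i)" using F(3) I n by blast
  then have "g \<in> subordinate (\<Union>i<n. U i)"
    using g(1,4) by (force simp: subordinate_def)
  then have "ennreal (L g) \<le> (\<Sum>i<n. open_content (U i))"
    using open_content_finite_UN[of n U] U open_content_upper by (meson order.trans)
  also have "\<dots> \<le> (\<Sum>i. open_content (U i))"
    by (rule sum_le_suminf) auto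
  finally show "ennreal (L f) \<le> (\<Sum>i. open_content (U i)) + ennreal e"
    using g(5) by (meson add_right_mono order.trans)
qed

lemma borel_outer_open: "openin X U \<Longrightarrow> borel_outer U = open_content U"
  unfolding borel_outer_def
  by (rule antisym) (auto intro: INF_lower INF_greatest open_content_mono)

lemma borel_outer_lower: "openin X U \<Longrightarrow> A \<subseteq> U \<Longrightarrow> borel_outer A \<le> open_content U"
  unfolding borel_outer_def by (auto intro: INF_lower)

lemma borel_outer_mono: "A \<subseteq> B \<Longrightarrow> borel_outer A \<le> borel_outer B"
  unfolding borel_outer_def by (rule INF_superset_mono) auto

lemma borel_outer_le_1: "A \<subseteq> topspace X \<Longrightarrow> borel_outer A \<le> 1"
  using borel_outer_lower[of "topspace X" A] open_content_topspace by simp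

lemma outer_measure_space_borel_outer: "outer_measure_space (Pow (topspace X)) borel_outer"
  unfolding outer_measure_space_def
proof (intro conjI)
  show "positive (Pow (topspace X)) borel_outer"
    by (simp add: positive_def borel_outer_open open_content_empty)
  show "increasing (Pow (topspace X)) borel_outer"
    by (simp add: increasing_def borel_outer_mono)
  show "countably_subadditive (Pow (topspace X)) borel_outer"
    unfolding countably_subadditive_def
  proof (intro allI impI, rule ennreal_le_epsilon)
    fix A :: "nat \<Rightarrow> 'b set" and e :: real
    assume A: "range A \<subseteq> Pow (topspace X)" and e: "0 < e"
    have "\<exists>U. openin X U \<and> A n \<subseteq> U \<and> open_content U < borel_outer (A n) + ennreal (e * (1/2) ^ Suc n)" for n
    proof -
      have "A n \<subseteq> topspace X" using A by auto
      then have "borel_outer (A n) \<noteq> \<infinity>"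
        using borel_outer_le_1[of "A n"] by (auto simp: top_unique)
      from INF_approx_ennreal[OF _ borel_outer_def this, where e = "e * (1/2) ^ Suc n"] e
      show ?thesis by auto
    qed
    then obtain U where U: "\<And>n. openin X (U n)" "\<And>n. A n \<subseteq> U n"
      "\<And>n. open_content (U n) < borel_outer (A n) + ennreal (e * (1/2) ^ Suc n)"
      by metis
    have "borel_outer (\<Union>i. A i) \<le> open_content (\<Union>i. U i)"
      using U by (intro borel_outer_lower openin_Union) auto
    also have "\<dots> \<le> (\<Sum>i. open_content (U i))"
      by (rule open_content_UN[OF U(1)])
    also have "\<dots> \<le> (\<Sum>n. borel_outer (A n) + ennreal (e * (1/2) ^ Suc n))"
      using U(3) by (intro suminf_le) (auto intro: less_imp_le)
    also have "\<dots> = (\<Sum>n. borel_outer (A n)) + (\<Sum>n. ennreal e * ennreal ((1/2) ^ Suc n))"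
      using \<open>0 < e\<close> by (subst suminf_add[symmetric])
                       (auto simp del: ennreal_suminf_cmult simp add: ennreal_mult[symmetric])
    also have "\<dots> = (\<Sum>n. borel_outer (A n)) + ennreal e"
      unfolding ennreal_suminf_cmult
      by (subst suminf_ennreal_eq[OF zero_le_power power_half_series]) auto
    finally show "borel_outer (\<Union>i. A i) \<le> (\<Sum>n. borel_outer (A n)) + ennreal e" .
  qed
qed

text \<open>Half of Caratheodory's condition for \<open>U\<close>, tested on open \<open>W\<close>.
  After truncation \<open>g\<close> lives on a closed \<open>K \<subseteq> U \<inter> W\<close>. A
  function subordinate to \<open>W - K\<close> can be added to it without exceeding 1, because the
  two are never non-zero at the same point of the space.\<close>

lemma open_content_split:
  assumes U: "openin X U" and W: "openin X W"
  shows "open_content (U \<inter> W) + borel_outer (W - U) \<le> open_content W"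
proof -
  have fin: "open_content W \<noteq> \<infinity>" "borel_outer (W - U) \<noteq> \<infinity>"
    using open_content_le_1[of W] borel_outer_le_1[OF order.trans[OF Diff_subset openin_subset[OF W]], of U]
    by (auto simp: top_unique)
  have "ennreal (L f) + borel_outer (W - U) \<le> open_content W" if f: "f \<in> subordinate (U \<inter> W)" for f
  proof (rule ennreal_le_epsilon)
    fix e :: real assume e: "0 < e"
    obtain g K where g: "g \<in> subordinate (U \<inter> W)" "closedin X K" "K \<subseteq> U \<inter> W"
      "\<And>x. x \<in> topspace X - K \<Longrightarrow> g x = 0" "ennreal (L f) \<le> ennreal (L g) + ennreal e"
      using truncate[OF f e] by metis
    have WK: "openin X (W - K)" "W - U \<subseteq> W - K"
      using g W by auto
    have "ennreal (L g) + open_content (W - K) \<le> open_content W"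
    proof -
      have "ennreal (L g) + ennreal (L h) \<le> open_content W" if h: "h \<in> subordinate (W - K)" for h
      proof -
        have "(\<lambda>x. g x + h x) \<in> subordinate W"
          unfolding subordinate_def
        proof (intro CollectI conjI ballI)
          show "continuous_map X euclideanreal (\<lambda>x. g x + h x)"
            using subordinateD(1)[OF g(1)] subordinateD(1)[OF h] by (intro continuous_intros)
          fix x assume x: "x \<in> topspace X"
          show "0 \<le> g x + h x"
            using subordinateD(2)[OF g(1) x] subordinateD(2)[OF h x] by simp
          show "g x + h x \<le> 1"
            using subordinateD(3)[OF g(1) x] subordinateD(3)[OF h x] subordinateD(4)[OF h x] g(4)[of x] x
            by (cases "x \<in> K") auto
        next
          fix x assume "x \<in> topspace X - W"
          then show "g x + h x = 0"
            using subordinateD(4)[OF g(1), of x] subordinateD(4)[OF h, of x] by auto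
        qed
        from open_content_upper[OF this] show ?thesis
          using L_subordinate[OF g(1)] L_subordinate[OF h] subordinateD(1)[OF g(1)] subordinateD(1)[OF h]
          by (simp add: add)
      qed
      then have "(SUP h\<in>subordinate (W - K). ennreal (L g) + ennreal (L h)) \<le> open_content W"
        by (rule SUP_least)
      moreover have "subordinate (W - K) \<noteq> {}"
        using zero_subordinate by auto
      ultimately show ?thesis
        unfolding open_content_def[of "W - K"] by (simp add: ennreal_SUP_add_right)
    qed
    moreover have "borel_outer (W - U) \<le> open_content (W - K)"
      using WK by (rule borel_outer_lower)
    ultimately have "ennreal (L g) + borel_outer (W - U) \<le> open_content W"
      by (meson add_left_mono order.trans)
    have "ennreal (L f) + borel_outer (W - U) \<le> (ennreal (L g) + ennreal e) + borel_outer (W - U)"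
      by (intro add_right_mono g)
    also have "\<dots> = (ennreal (L g) + borel_outer (W - U)) + ennreal e"
      by (simp add: ac_simps)
    also have "\<dots> \<le> open_content W + ennreal e"
      by (intro add_right_mono) fact
    finally show "ennreal (L f) + borel_outer (W - U) \<le> open_content W + ennreal e" .
  qed
  then have "(SUP f\<in>subordinate (U \<inter> W). ennreal (L f) + borel_outer (W - U)) \<le> open_content W"
    by (rule SUP_least)
  moreover have "subordinate (U \<inter> W) \<noteq> {}"
    using zero_subordinate by auto
  ultimately show ?thesis
    unfolding open_content_def[of "U \<inter> W"] by (subst ennreal_SUP_add_left[symmetric]) auto
qed

text \<open>Arbitrary test sets \<open>A\<close> reduce to open ones: \<open>borel_outer A\<close>
  is an infimum over open supersets, and both parts of the split are monotone in the test
  set.\<close>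

lemma open_in_lambda_system:
  assumes U: "openin X U"
  shows "U \<in> lambda_system (topspace X) (Pow (topspace X)) borel_outer"
proof -
  interpret sigma_algebra "topspace X" "Pow (topspace X)"
    by (rule sigma_algebra_Pow)
  have "borel_outer (U \<inter> A) + borel_outer ((topspace X - U) \<inter> A) = borel_outer A"
    if A: "A \<subseteq> topspace X" for A
  proof (rule antisym)
    show "borel_outer (U \<inter> A) + borel_outer ((topspace X - U) \<inter> A) \<le> borel_outer A"
      unfolding borel_outer_def[of A]
    proof (rule INF_greatest)
      fix W assume "W \<in> {U. openin X U \<and> A \<subseteq> U}"
      then have W: "openin X W" "A \<subseteq> W" by auto
      have "borel_outer (U \<inter> A) + borel_outer ((topspace X - U) \<inter> A)
          \<le> open_content (U \<inter> W) + borel_outer (W - U)"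
        using W U by (intro add_mono borel_outer_lower borel_outer_mono) auto
      also have "\<dots> \<le> open_content W"
        by (rule open_content_split[OF U W(1)])
      finally show "borel_outer (U \<inter> A) + borel_outer ((topspace X - U) \<inter> A) \<le> open_content W" .
    qed
    have "subadditive (Pow (topspace X)) borel_outer"
      using outer_measure_space_borel_outer countably_subadditive_subadditive
      by (auto simp: outer_measure_space_def)
    then have "borel_outer (U \<inter> A \<union> (topspace X - U) \<inter> A)
        \<le> borel_outer (U \<inter> A) + borel_outer ((topspace X - U) \<inter> A)"
      using A by (intro subadditiveD) auto
    moreover have "U \<inter> A \<union> (topspace X - U) \<inter> A = A"
      using A by auto
    ultimately show "borel_outer A \<le> borel_outer (U \<inter> A) + borel_outer ((topspace X - U) \<inter> A)"
      by simp
  qed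
  then show ?thesis
    using openin_subset[OF U] by (auto simp: lambda_system_def)
qed

definition functional_measure :: "'b measure" where
  "functional_measure = measure_of (topspace X) {U. openin X U} borel_outer"

lemma borel_Pow: "{U. openin X U} \<subseteq> Pow (topspace X)"
  using openin_subset by blast

lemma space_functional_measure: "space functional_measure = topspace X"
  unfolding functional_measure_def using borel_Pow by (rule space_measure_of)

lemma sets_functional_measure: "sets functional_measure = sigma_sets (topspace X) {U. openin X U}"
  unfolding functional_measure_def using borel_Pow by (rule sets_measure_of)

text \<open>The Caratheodory measurable sets form a sigma-algebra containing the open sets. So
  \<open>borel_outer\<close> is countably additive on the Borel sets, which is what
  \<open>measure_of\<close> requires in order to return it.\<close>

lemma emeasure_functional_measure:
  assumes "A \<in> sets functional_measure"
  shows "emeasure functional_measure A = borel_outer A"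
proof -
  interpret sigma_algebra "topspace X" "Pow (topspace X)"
    by (rule sigma_algebra_Pow)
  let ?\<Lambda> = "lambda_system (topspace X) (Pow (topspace X)) borel_outer"
  have ms: "measure_space (topspace X) ?\<Lambda> borel_outer"
    by (rule caratheodory_lemma[OF outer_measure_space_borel_outer])
  have sub: "sigma_sets (topspace X) {U. openin X U} \<subseteq> ?\<Lambda>"
    using ms open_in_lambda_system
    by (intro sigma_algebra.sigma_sets_subset) (auto simp: measure_space_def)
  have "positive (sets functional_measure) borel_outer"
    "countably_additive (sets functional_measure) borel_outer"
    using ms sub unfolding sets_functional_measure measure_space_def
    by (auto simp: positive_def countably_additive_def)
  with assms show ?thesis
    by (intro emeasure_measure_of[OF functional_measure_def borel_Pow])
qed

lemma open_functional_measure: "openin X U \<Longrightarrow> U \<in> sets functional_measure"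
  by (simp add: sets_functional_measure)

lemma prob_space_functional_measure: "prob_space functional_measure"
  by (rule prob_spaceI)
    (simp add: space_functional_measure emeasure_functional_measure open_functional_measure
      borel_outer_open open_content_topspace)

text \<open>Outer regularity is built into \<open>borel_outer\<close>. Inner regularity is outer
  regularity of the complement: an open superset of it has a closed complement, which is compact
  because the space is.\<close>

theorem regular_borel_prob_functional_measure: "regular_borel_prob X functional_measure"
proof -
  interpret prob_space functional_measure
    by (rule prob_space_functional_measure)
  have outer: "emeasure functional_measure A = (INF U\<in>{U. openin X U \<and> A \<subseteq> U}. emeasure functional_measure U)"
    if A: "A \<in> sets functional_measure" for A
    unfolding emeasure_functional_measure[OF A] borel_outer_def
    by (rule INF_cong) (auto simp: emeasure_functional_measure open_functional_measure borel_outer_open)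
  have "emeasure functional_measure A = (SUP K\<in>{K. compactin X K \<and> K \<subseteq> A}. emeasure functional_measure K)"
    if A: "A \<in> sets functional_measure" for A
  proof (rule antisym)
    have AX: "A \<subseteq> topspace X"
      using sets.sets_into_space[OF A] by (simp add: space_functional_measure)
    let ?B = "topspace X - A"
    have B: "?B \<in> sets functional_measure"
      using sets.compl_sets[OF A] by (simp add: space_functional_measure)
    show "emeasure functional_measure A \<le> (SUP K\<in>{K. compactin X K \<and> K \<subseteq> A}. emeasure functional_measure K)"
    proof (rule ennreal_le_epsilon)
      fix e :: real assume e: "0 < e"
      obtain U where U: "openin X U" "?B \<subseteq> U"
        "emeasure functional_measure U < emeasure functional_measure ?B + ennreal e"
        using INF_approx_ennreal[OF _ outer[OF B], where e = e] e by (auto simp: emeasure_eq_measure)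
      let ?K = "topspace X - U"
      have K: "closedin X ?K" "?K \<subseteq> A"
        using U by auto
      have "prob ?K = 1 - prob U" "prob ?B = 1 - prob A"
        using prob_compl[OF open_functional_measure[OF U(1)]] prob_compl[OF A]
        by (simp_all add: space_functional_measure)
      moreover have "prob U < prob ?B + e"
        using U(3) e ennreal_plus[of "prob ?B" e]
        by (metis emeasure_eq_measure ennreal_less_iff measure_nonneg less_imp_le)
      ultimately have "prob A \<le> prob ?K + e"
        by simp
      then have "emeasure functional_measure A \<le> emeasure functional_measure ?K + ennreal e"
        using e by (simp add: emeasure_eq_measure flip: ennreal_plus)
      also have "\<dots> \<le> (SUP K\<in>{K. compactin X K \<and> K \<subseteq> A}. emeasure functional_measure K) + ennreal e"
        using K cpt by (intro add_right_mono SUP_upper) (auto intro: closedin_compact_space)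
      finally show "emeasure functional_measure A
        \<le> (SUP K\<in>{K. compactin X K \<and> K \<subseteq> A}. emeasure functional_measure K) + ennreal e" .
    qed
    show "(SUP K\<in>{K. compactin X K \<and> K \<subseteq> A}. emeasure functional_measure K) \<le> emeasure functional_measure A"
      using A by (auto intro!: SUP_least emeasure_mono)
  qed
  with outer show ?thesis
    unfolding regular_borel_prob_def
    using prob_space_functional_measure space_functional_measure sets_functional_measure by blast
qed

text \<open>A function subordinate to the preimage of \<open>U\<close> under \<open>\<phi>\<close>
  becomes subordinate to \<open>U\<close> after composition with the inverse \<open>\<psi>\<close>,
  which is why the hypothesis on \<open>L\<close> concerns \<open>\<psi>\<close>. Only one
  inequality comes out; in a probability space, complements give the other.\<close>

lemma invariant_functional_measure:
  assumes hom: "homeomorphic_maps X X \<phi> \<psi>"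
    and L: "\<And>f. continuous_map X euclideanreal f \<Longrightarrow> L (\<lambda>x. f (\<psi> x)) = L f"
  shows "invariant_measure \<phi> functional_measure"
proof -
  interpret prob_space functional_measure
    by (rule prob_space_functional_measure)
  have \<phi>: "continuous_map X X \<phi>" and \<psi>: "continuous_map X X \<psi>"
    and inv: "\<And>x. x \<in> topspace X \<Longrightarrow> \<psi> (\<phi> x) = x" "\<And>x. x \<in> topspace X \<Longrightarrow> \<phi> (\<psi> x) = x"
    using hom by (auto simp: homeomorphic_maps_def)
  have in_X: "\<phi> x \<in> topspace X" "\<psi> x \<in> topspace X" if "x \<in> topspace X" for x
    using that \<phi> \<psi> continuous_map_image_subset_topspace by blast+
  define pre where "pre A = {x \<in> topspace X. \<phi> x \<in> A}" for A
  have pre_open: "openin X (pre U)" if "openin X U" for U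
    unfolding pre_def by (rule openin_continuous_map_preimage[OF \<phi> that])
  have meas: "\<phi> \<in> measurable functional_measure functional_measure"
  proof (rule measurable_sigma_sets[OF sets_functional_measure borel_Pow])
    show "\<phi> \<in> space functional_measure \<rightarrow> topspace X"
      using in_X by (simp add: space_functional_measure)
    show "\<phi> -` U \<inter> space functional_measure \<in> sets functional_measure" if "U \<in> {U. openin X U}" for U
    proof -
      have "\<phi> -` U \<inter> space functional_measure = pre U"
        by (auto simp: pre_def space_functional_measure)
      then show ?thesis using that pre_open open_functional_measure by simp
    qed
  qed
  have pre_sets: "pre A \<in> sets functional_measure" if "A \<in> sets functional_measure" for A
  proof -
    have "\<phi> -` A \<inter> space functional_measure = pre A"
      by (auto simp: pre_def space_functional_measure)
    then show ?thesis using measurable_sets[OF meas that] by simp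
  qed
  have le_open: "open_content (pre U) \<le> open_content U" for U
  proof (rule open_content_least)
    fix f assume f: "f \<in> subordinate (pre U)"
    have "(\<lambda>x. f (\<psi> x)) \<in> subordinate U"
      using f continuous_map_compose[OF \<psi>, of euclideanreal f] in_X inv
      by (auto simp: subordinate_def pre_def o_def)
    then show "ennreal (L f) \<le> open_content U"
      using open_content_upper L[OF subordinateD(1)[OF f]] by metis
  qed
  have le: "borel_outer (pre A) \<le> borel_outer A" for A
    unfolding borel_outer_def[of A]
  proof (rule INF_greatest)
    fix U assume "U \<in> {U. openin X U \<and> A \<subseteq> U}"
    then have "borel_outer (pre A) \<le> open_content (pre U)"
      by (intro borel_outer_lower pre_open) (auto simp: pre_def)
    also have "\<dots> \<le> open_content U" by (rule le_open)
    finally show "borel_outer (pre A) \<le> open_content U" .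
  qed
  have prob_le: "prob (pre A) \<le> prob A" if "A \<in> sets functional_measure" for A
    using le[of A] emeasure_functional_measure[OF that] emeasure_functional_measure[OF pre_sets[OF that]]
    by (metis emeasure_eq_measure ennreal_le_iff measure_nonneg)
  have prob_eq: "prob (pre A) = prob A" if A: "A \<in> sets functional_measure" for A
  proof -
    have "pre (topspace X - A) = topspace X - pre A"
      using in_X by (auto simp: pre_def)
    then have "1 - prob (pre A) \<le> 1 - prob A"
      using prob_le[OF sets.compl_sets[OF A]] prob_compl[OF A] prob_compl[OF pre_sets[OF A]]
      by (simp add: space_functional_measure)
    with prob_le[OF A] show ?thesis by simp
  qed
  have "distr functional_measure functional_measure \<phi> = functional_measure"
  proof (rule measure_eqI)
    fix A assume "A \<in> sets (distr functional_measure functional_measure \<phi>)"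
    then have A: "A \<in> sets functional_measure" by simp
    have "\<phi> -` A \<inter> space functional_measure = pre A"
      by (auto simp: pre_def space_functional_measure)
    then show "emeasure (distr functional_measure functional_measure \<phi>) A = emeasure functional_measure A"
      using A meas prob_eq[OF A] by (simp add: emeasure_distr emeasure_eq_measure)
  qed simp
  with meas show ?thesis
    by (simp add: invariant_measure_def)
qed

end

section \<open>Characters of compact monothetic groups\<close>

lemma nat_multiple_0 [simp]: "nat_multiple 0 x = 0"
  by (simp add: nat_multiple_def)

lemma nat_multiple_Suc: "nat_multiple (Suc n) x = nat_multiple n x + x"
  by (simp add: nat_multiple_def add.commute)

lemma nat_multiple_1 [simp]: "nat_multiple (Suc 0) x = x"
  by (simp add: nat_multiple_Suc)

lemma nat_multiple_add: "nat_multiple (m + n) x = nat_multiple m x + nat_multiple n x"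
  by (induction n) (simp_all add: nat_multiple_Suc add.assoc)

section \<open>Uniform convergence of rotated averages\<close>

definition rotated_sum :: "'a::comm_monoid_add \<Rightarrow> ('a \<Rightarrow> complex) \<Rightarrow> complex \<Rightarrow> nat \<Rightarrow> 'a \<Rightarrow> complex" where
  "rotated_sum \<gamma> h w N y = (\<Sum>n<N. h (y + nat_multiple n \<gamma>) * w ^ n)"

lemma rotated_sum_add:
  "rotated_sum \<gamma> h w (M + N) y = rotated_sum \<gamma> h w M y + w ^ M * rotated_sum \<gamma> h w N (y + nat_multiple M \<gamma>)"
  by (induction N)
    (simp_all add: rotated_sum_def algebra_simps power_add nat_multiple_add)

lemma rotated_sum_bound:
  assumes "\<And>y. norm (h y) \<le> C" "norm w = 1"
  shows "norm (rotated_sum \<gamma> h w N y) \<le> C * N"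
proof -
  have "norm (rotated_sum \<gamma> h w N y) \<le> (\<Sum>n<N. C)"
    unfolding rotated_sum_def using assms by (intro sum_norm_le) (simp add: norm_mult norm_power)
  then show ?thesis by (simp add: mult.commute)
qed

text \<open>The functions \<open>\<lambda>y. h (y + p) * z\<close>, with \<open>p\<close> in the
  group and \<open>z\<close> on the unit circle, vary continuously in the uniform norm with
  \<open>(p, z)\<close>, and the space of parameters is compact. A finite cover by small cells
  yields the finitely many representatives.\<close>

lemma orbit_totally_bounded:
  fixes h :: "'a::topological_ab_group_add \<Rightarrow> complex"
  assumes cpt: "compact (UNIV :: 'a set)" and h: "continuous_on UNIV h"
    and w: "norm w = 1" and e: "0 < e"
  obtains E :: "nat set" where "finite E"
    "\<And>n. \<exists>m\<in>E. \<forall>y. norm (h (y + nat_multiple n \<gamma>) * w ^ n - h (y + nat_multiple m \<gamma>) * w ^ m) \<le> e"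
proof -
  define P where "P = (UNIV :: 'a set) \<times> sphere (0::complex) 1"
  define H :: "('a \<times> complex) \<times> 'a \<Rightarrow> complex" where "H = (\<lambda>q. h (snd q + fst (fst q)) * snd (fst q))"
  have P: "compact P"
    unfolding P_def by (intro compact_Times cpt compact_sphere)
  have H: "continuous_on (P \<times> UNIV) H"
    unfolding H_def
    by (intro continuous_intros continuous_on_compose2[OF h]) auto
  have "\<exists>V. p \<in> V \<and> open V \<and> (\<forall>q\<in>V \<inter> P. \<forall>y. dist (H (q, y)) (H (p, y)) \<le> e / 2)" if "p \<in> P" for p
    using continuous_on_prod_compactE[OF H cpt that, of "e / 2"] e by (metis half_gt_zero UNIV_I)
  then obtain V where V: "\<And>p. p \<in> P \<Longrightarrow> p \<in> V p" "\<And>p. p \<in> P \<Longrightarrow> open (V p)"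
    "\<And>p q y. p \<in> P \<Longrightarrow> q \<in> V p \<Longrightarrow> q \<in> P \<Longrightarrow> dist (H (q, y)) (H (p, y)) \<le> e / 2"
    by (metis IntI)
  have "P \<subseteq> (\<Union>p\<in>P. V p)" using V(1) by blast
  then obtain D where D: "D \<subseteq> P" "finite D" "P \<subseteq> (\<Union>p\<in>D. V p)"
    using compactE_image[OF P, of P V] V(2) by metis
  define z where "z n = (nat_multiple n \<gamma>, w ^ n)" for n
  have z: "z n \<in> P" for n
    using w by (simp add: z_def P_def norm_power)
  \<comment> \<open>A cell met by no \<open>z n\<close> receives an arbitrary number; this at most
    enlarges the finite set \<open>E\<close> by one element per cell.\<close>
  define r where "r p = (SOME n. z n \<in> V p)" for p
  show thesis
  proof (rule that)
    show "finite (r ` D)" using D by simp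
    fix n
    obtain p where p: "p \<in> D" "z n \<in> V p"
      using D(3) z[of n] by blast
    then have r: "z (r p) \<in> V p"
      unfolding r_def using someI[of "\<lambda>n. z n \<in> V p", OF p(2)] by simp
    have "norm (h (y + nat_multiple n \<gamma>) * w ^ n - h (y + nat_multiple (r p) \<gamma>) * w ^ r p) \<le> e" for y
    proof -
      have "dist (H (z n, y)) (H (p, y)) \<le> e / 2" "dist (H (z (r p), y)) (H (p, y)) \<le> e / 2"
        using V(3)[OF _ p(2) z] V(3)[OF _ r z] p(1) D(1) by auto
      then have "dist (H (z n, y)) (H (z (r p), y)) \<le> e"
        using dist_triangle2[of "H (z n, y)" "H (z (r p), y)" "H (p, y)"] by linarith
      then show ?thesis
        by (simp add: H_def z_def dist_norm)
    qed
    with p show "\<exists>m\<in>r ` D. \<forall>y. norm (h (y + nat_multiple n \<gamma>) * w ^ n - h (y + nat_multiple m \<gamma>) * w ^ m) \<le> e"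
      by blast
  qed
qed

text \<open>The translate by \<open>n\<close> is term by term within \<open>e\<close> of a translate
  by some \<open>m\<close> from a finite set, and translating by a bounded \<open>m\<close> alters
  only boundary terms. Hence \<open>B\<close> depends on none of \<open>n\<close>, \<open>N\<close>
  and \<open>y\<close>.\<close>

lemma rotated_sum_almost_invariant:
  fixes h :: "'a::topological_ab_group_add \<Rightarrow> complex"
  assumes cpt: "compact (UNIV :: 'a set)" and h: "continuous_on UNIV h"
    and C: "\<And>y. norm (h y) \<le> C" and w: "norm w = 1" and e: "0 < e"
  obtains B where "\<And>n N y. norm (w ^ n * rotated_sum \<gamma> h w N (y + nat_multiple n \<gamma>) - rotated_sum \<gamma> h w N y)
    \<le> e * real N + B" "0 \<le> B"
proof -
  obtain E where E: "finite E"
    "\<And>n. \<exists>m\<in>E. \<forall>y. norm (h (y + nat_multiple n \<gamma>) * w ^ n - h (y + nat_multiple m \<gamma>) * w ^ m) \<le> e"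
    using orbit_totally_bounded[OF cpt h w e] by metis
  obtain l where l: "E \<subseteq> {..<l}"
    using finite_nat_bounded[OF E(1)] by auto
  have C0: "0 \<le> C" using C[of 0] norm_ge_zero order.trans by blast
  show thesis
  proof (rule that[of "2 * C * l"])
    fix n N y
    obtain m where m: "m \<in> E"
      "\<And>y. norm (h (y + nat_multiple n \<gamma>) * w ^ n - h (y + nat_multiple m \<gamma>) * w ^ m) \<le> e"
      using E(2)[of n] by auto
    have shift: "w ^ k * rotated_sum \<gamma> h w N (y + nat_multiple k \<gamma>)
        = (\<Sum>j<N. w ^ j * (h (y + nat_multiple j \<gamma> + nat_multiple k \<gamma>) * w ^ k))" for k
      by (simp add: rotated_sum_def sum_distrib_left algebra_simps)
    have "norm (w ^ n * rotated_sum \<gamma> h w N (y + nat_multiple n \<gamma>)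
        - w ^ m * rotated_sum \<gamma> h w N (y + nat_multiple m \<gamma>)) \<le> (\<Sum>j<N. e)"
      unfolding shift sum_subtractf[symmetric] right_diff_distrib[symmetric]
      by (rule sum_norm_le) (use m(2) w in \<open>simp add: norm_mult norm_power\<close>)
    moreover have "norm (w ^ m * rotated_sum \<gamma> h w N (y + nat_multiple m \<gamma>) - rotated_sum \<gamma> h w N y)
        \<le> 2 * C * l"
    proof -
      have "w ^ m * rotated_sum \<gamma> h w N (y + nat_multiple m \<gamma>) - rotated_sum \<gamma> h w N y
          = w ^ N * rotated_sum \<gamma> h w m (y + nat_multiple N \<gamma>) - rotated_sum \<gamma> h w m y"
        using rotated_sum_add[of \<gamma> h w m N y] rotated_sum_add[of \<gamma> h w N m y]
        by (simp add: algebra_simps)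
      also have "norm \<dots> \<le> norm (w ^ N * rotated_sum \<gamma> h w m (y + nat_multiple N \<gamma>)) + norm (rotated_sum \<gamma> h w m y)"
        by (rule norm_triangle_ineq4)
      also have "\<dots> \<le> C * m + C * m"
        using rotated_sum_bound[of h C w \<gamma> m] C w by (intro add_mono) (simp_all add: norm_mult norm_power)
      also have "\<dots> \<le> 2 * C * l"
        using m(1) l C0 by (auto intro!: mult_left_mono simp: mult.assoc)
      finally show ?thesis .
    qed
    ultimately show "norm (w ^ n * rotated_sum \<gamma> h w N (y + nat_multiple n \<gamma>) - rotated_sum \<gamma> h w N y)
      \<le> e * real N + 2 * C * l"
      using norm_triangle_ineq[of "w ^ n * rotated_sum \<gamma> h w N (y + nat_multiple n \<gamma>)
        - w ^ m * rotated_sum \<gamma> h w N (y + nat_multiple m \<gamma>)"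
        "w ^ m * rotated_sum \<gamma> h w N (y + nat_multiple m \<gamma>) - rotated_sum \<gamma> h w N y"]
      by (simp add: mult.commute)
  qed (use C0 in simp)
qed

text \<open>A sum of length \<open>q * N\<close> is nearly \<open>q\<close> times the sum of length
  \<open>N\<close>, since each of its blocks is nearly the first one. Cutting \<open>m * n\<close>
  terms into blocks of length \<open>m\<close> and into blocks of length \<open>n\<close> compares
  the two averages.\<close>

lemma rotated_mean_Cauchy:
  fixes h :: "'a::topological_ab_group_add \<Rightarrow> complex"
  assumes cpt: "compact (UNIV :: 'a set)" and h: "continuous_on UNIV h" and w: "norm w = 1"
  shows "uniformly_Cauchy_on UNIV (\<lambda>N y. rotated_sum \<gamma> h w N y / of_nat N)"
  unfolding uniformly_Cauchy_on_def
proof (intro allI impI)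
  fix e :: real assume e: "0 < e"
  have "bounded (range h)"
    using compact_continuous_image[OF h cpt] compact_imp_bounded by blast
  then obtain C where C: "\<And>y. norm (h y) \<le> C"
    unfolding bounded_iff by auto
  obtain B where B: "\<And>n N y. norm (w ^ n * rotated_sum \<gamma> h w N (y + nat_multiple n \<gamma>) - rotated_sum \<gamma> h w N y)
    \<le> e / 8 * real N + B" "0 \<le> B"
    using rotated_sum_almost_invariant[OF cpt h C w, of "e / 8" \<gamma>] e by auto
  have mult: "norm (rotated_sum \<gamma> h w (q * N) y - of_nat q * rotated_sum \<gamma> h w N y) \<le> q * (e / 8 * real N + B)" for q N y
  proof (induction q)
    case (Suc q)
    have "rotated_sum \<gamma> h w (Suc q * N) y - of_nat (Suc q) * rotated_sum \<gamma> h w N y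
      = (rotated_sum \<gamma> h w (q * N) y - of_nat q * rotated_sum \<gamma> h w N y)
        + (w ^ (q * N) * rotated_sum \<gamma> h w N (y + nat_multiple (q * N) \<gamma>) - rotated_sum \<gamma> h w N y)"
      using rotated_sum_add[of \<gamma> h w "q * N" N y] by (simp add: algebra_simps)
    also have "norm \<dots> \<le> q * (e / 8 * real N + B) + (e / 8 * real N + B)"
      by (rule order.trans[OF norm_triangle_ineq add_mono[OF Suc B(1)]])
    finally show ?case by (simp add: algebra_simps add_divide_distrib)
  qed (simp add: rotated_sum_def)
  \<comment> \<open>From this length on, \<open>B\<close> is at most \<open>e / 8\<close> times the
    length; four contributions of \<open>e / 8\<close> then add up to \<open>e / 2\<close>.\<close>
  obtain M0 :: nat where M0: "8 * B / e < M0"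
    using reals_Archimedean2 by blast
  define M where "M = Suc M0"
  show "\<exists>M. \<forall>y\<in>UNIV. \<forall>m\<ge>M. \<forall>n\<ge>M. dist (rotated_sum \<gamma> h w m y / of_nat m) (rotated_sum \<gamma> h w n y / of_nat n) < e"
  proof (intro exI ballI allI impI)
    fix y m n assume mn: "M \<le> m" "M \<le> n"
    let ?A = "\<lambda>N. rotated_sum \<gamma> h w N y"
    have pos: "0 < real m" "0 < real n" using mn by (auto simp: M_def)
    have "e * M0 \<le> e * m" "e * M0 \<le> e * n"
      using e mn by (auto simp: M_def)
    moreover have "B \<le> e / 8 * M0"
      using M0 e by (simp add: field_simps)
    ultimately have Bm: "B \<le> e / 8 * m" "B \<le> e / 8 * n"
      by auto
    have "norm (?A m / m - ?A n / n) = norm (n * ?A m - m * ?A n) / (m * n)"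
      using pos by (simp add: diff_frac_eq norm_divide norm_mult mult.commute)
    also have "n * ?A m - m * ?A n = (?A (m * n) - m * ?A n) - (?A (n * m) - n * ?A m)"
      by (simp add: mult.commute)
    also have "norm \<dots> \<le> m * (e / 8 * real n + B) + n * (e / 8 * real m + B)"
      by (rule order.trans[OF norm_triangle_ineq4 add_mono[OF mult mult]])
    also have "\<dots> \<le> m * (e / 8 * real n + e / 8 * n) + n * (e / 8 * real m + e / 8 * m)"
      using Bm e by (intro add_mono mult_left_mono) auto
    also have "\<dots> = e / 2 * (m * n)"
      by (simp add: algebra_simps)
    finally have "norm (?A m / m - ?A n / n) \<le> e / 2"
      using pos by (simp add: divide_right_mono field_simps)
    then show "dist (?A m / m) (?A n / n) < e"
      using e by (simp add: dist_norm)
  qed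
qed

text \<open>Moving \<open>y\<close> by \<open>\<gamma>\<close> shifts the summation index by one: up
  to a factor \<open>w\<close> only two boundary terms change, and in the limit this becomes the
  equation of an eigenfunction.\<close>

lemma rotated_mean:
  fixes h :: "'a::topological_ab_group_add \<Rightarrow> complex"
  assumes cpt: "compact (UNIV :: 'a set)" and h: "continuous_on UNIV h" and w: "norm w = 1"
  obtains F where "continuous_on UNIV F"
    "uniform_limit UNIV (\<lambda>N y. rotated_sum \<gamma> h w N y / of_nat N) F sequentially"
    "\<And>y. F (y + \<gamma>) * w = F y"
proof -
  obtain F where F: "uniform_limit UNIV (\<lambda>N y. rotated_sum \<gamma> h w N y / of_nat N) F sequentially"
    using Cauchy_uniformly_convergent[OF rotated_mean_Cauchy[OF cpt h w]]
    unfolding uniformly_convergent_on_def by blast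
  have cont: "continuous_on UNIV (\<lambda>y. rotated_sum \<gamma> h w N y / of_nat N)" for N
    unfolding rotated_sum_def divide_inverse
    by (intro continuous_intros continuous_on_compose2[OF h]) auto
  have "continuous_on UNIV F"
    by (rule uniform_limit_theorem[OF always_eventually[OF allI[OF cont]] F]) simp
  moreover have "F (y + \<gamma>) * w = F y" for y
  proof -
    have "bounded (range h)"
      using compact_continuous_image[OF h cpt] compact_imp_bounded by blast
    then obtain C where C: "\<And>y. norm (h y) \<le> C"
      unfolding bounded_iff by auto
    have "(\<lambda>N. rotated_sum \<gamma> h w N (y + \<gamma>) / of_nat N * w - rotated_sum \<gamma> h w N y / of_nat N) \<longlonglongrightarrow> F (y + \<gamma>) * w - F y"
      using F by (intro tendsto_intros tendsto_uniform_limitI) auto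
    moreover have "(\<lambda>N. rotated_sum \<gamma> h w N (y + \<gamma>) / of_nat N * w - rotated_sum \<gamma> h w N y / of_nat N) \<longlonglongrightarrow> 0"
    proof (rule Lim_null_comparison)
      show "\<forall>\<^sub>F N in sequentially. norm (rotated_sum \<gamma> h w N (y + \<gamma>) / of_nat N * w - rotated_sum \<gamma> h w N y / of_nat N) \<le> 2 * C / N"
      proof (rule always_eventually, rule allI)
        fix N
        have "w * rotated_sum \<gamma> h w N (y + \<gamma>) - rotated_sum \<gamma> h w N y = h (y + nat_multiple N \<gamma>) * w ^ N - h y"
          using rotated_sum_add[of \<gamma> h w 1 N y] rotated_sum_add[of \<gamma> h w N 1 y]
          by (simp add: rotated_sum_def algebra_simps)
        moreover have "norm (h (y + nat_multiple N \<gamma>) * w ^ N - h y) \<le> C + C"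
          by (rule order.trans[OF norm_triangle_ineq4 add_mono]) (use C w in \<open>auto simp: norm_mult norm_power\<close>)
        ultimately have "norm (w * rotated_sum \<gamma> h w N (y + \<gamma>) - rotated_sum \<gamma> h w N y) \<le> 2 * C"
          by simp
        then have "norm ((w * rotated_sum \<gamma> h w N (y + \<gamma>) - rotated_sum \<gamma> h w N y) / of_nat N) \<le> 2 * C / N"
          by (simp add: norm_divide divide_right_mono)
        then show "norm (rotated_sum \<gamma> h w N (y + \<gamma>) / of_nat N * w - rotated_sum \<gamma> h w N y / of_nat N) \<le> 2 * C / N"
          by (simp add: diff_divide_distrib mult.commute)
      qed
      show "(\<lambda>N. 2 * C / real N) \<longlonglongrightarrow> 0" by real_asymp
    qed
    ultimately show ?thesis
      using LIMSEQ_unique by fastforce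
  qed
  ultimately show thesis using F that by blast
qed

section \<open>Eigenfunctions of the rotation and characters\<close>

lemma dense_subgroup_induct:
  fixes \<gamma> :: "'a::{topological_ab_group_add, t2_space}"
  assumes "closure (group_closure {\<gamma>}) = UNIV" "closed S" "0 \<in> S" "\<gamma> \<in> S"
    and "\<And>y z. y \<in> S \<Longrightarrow> z \<in> S \<Longrightarrow> y - z \<in> S"
  shows "x \<in> S"
proof -
  have "y \<in> S" if "y \<in> group_closure {\<gamma>}" for y
    using that by induction (use assms in auto)
  then have "closure (group_closure {\<gamma>}) \<subseteq> S"
    using assms(2) by (intro closure_minimal) auto
  then show ?thesis using assms(1) by auto
qed

text \<open>Constancy of the modulus and multiplicativity hold at \<open>\<gamma>\<close> by the
  eigenfunction equation and spread to the whole group by density. The intersection over all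
  \<open>x\<close> makes the set of good \<open>y\<close> closed under differences, since the
  relations are used at points shifted by \<open>- z\<close>.\<close>

lemma eigenfunction_character:
  fixes \<gamma> :: "'a::{topological_ab_group_add, t2_space}"
  assumes dense: "closure (group_closure {\<gamma>}) = UNIV" and F: "continuous_on UNIV F"
    and w: "norm w = 1" and eig: "\<And>y. F (y + \<gamma>) * w = F y" and nz: "F z \<noteq> 0"
  obtains \<psi> where "\<psi> \<in> carrier dual_group" "\<And>y. F y = F 0 * \<psi> y"
proof -
  have w0: "w \<noteq> 0" using w by auto
  have comp: "continuous_on UNIV (\<lambda>y. F (x + y))" for x
    by (intro continuous_on_compose2[OF F] continuous_intros) auto
  have S1: "y \<in> (\<Inter>x. {y. norm (F (x + y)) = norm (F x)})" for y
  proof (rule dense_subgroup_induct[OF dense])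
    show "closed (\<Inter>x. {y. norm (F (x + y)) = norm (F x)})"
      by (intro closed_INT ballI closed_Collect_eq continuous_intros comp)
    have "norm (F (x + \<gamma>)) = norm (F x)" for x
      using arg_cong[OF eig[of x], of norm] w by (simp add: norm_mult)
    then show "\<gamma> \<in> (\<Inter>x. {y. norm (F (x + y)) = norm (F x)})" by simp
  next
    fix y z assume *: "y \<in> (\<Inter>x. {y. norm (F (x + y)) = norm (F x)})" "z \<in> (\<Inter>x. {y. norm (F (x + y)) = norm (F x)})"
    have "norm (F (x + (y - z))) = norm (F x)" for x
    proof -
      have "norm (F ((x - z) + y)) = norm (F (x - z))" "norm (F ((x - z) + z)) = norm (F (x - z))"
        using * by blast+
      then show ?thesis by (simp add: algebra_simps)
    qed
    then show "y - z \<in> (\<Inter>x. {y. norm (F (x + y)) = norm (F x)})" by auto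
  qed simp
  have nF: "norm (F y) = norm (F 0)" for y
    using S1[of y] by (auto dest: spec[of _ 0])
  then have F0: "F 0 \<noteq> 0" "F y \<noteq> 0" for y
    using nz by (metis norm_eq_zero)+
  have S2: "y \<in> (\<Inter>x. {y. F (x + y) * F 0 = F x * F y})" for y
  proof (rule dense_subgroup_induct[OF dense])
    show "closed (\<Inter>x. {y. F (x + y) * F 0 = F x * F y})"
      by (intro closed_INT ballI closed_Collect_eq continuous_intros comp F)
    have "F (x + \<gamma>) * F 0 = F x * F \<gamma>" for x
      using eig[of x] eig[of 0] w0 by (metis add_0 mult.assoc mult.commute mult_right_cancel)
    then show "\<gamma> \<in> (\<Inter>x. {y. F (x + y) * F 0 = F x * F y})" by simp
  next
    fix y z assume *: "y \<in> (\<Inter>x. {y. F (x + y) * F 0 = F x * F y})" "z \<in> (\<Inter>x. {y. F (x + y) * F 0 = F x * F y})"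
    have y: "F (x + y) * F 0 = F x * F y" and z: "F x * F 0 = F (x - z) * F z" for x
      using * by (auto dest: spec[of _ "x - z"] spec[of _ x])
    have yz: "F (x + (y - z)) * F z = F x * F y" for x
      using z[of "x + y"] y[of x] by (simp add: algebra_simps)
    have "(F (x + (y - z)) * F 0) * F z = (F x * F (y - z)) * F z" for x
      using yz[of x] yz[of 0] by (simp add: mult_ac)
    then show "y - z \<in> (\<Inter>x. {y. F (x + y) * F 0 = F x * F y})"
      using F0 by simp
  qed simp
  show thesis
  proof (rule that[of "\<lambda>y. F y / F 0"])
    have "F (x + y) / F 0 = (F x / F 0) * (F y / F 0)" for x y
      using S2[of y] F0 by (simp add: field_simps)
    then show "(\<lambda>y. F y / F 0) \<in> carrier dual_group"
      using F0 nF[symmetric] by (auto simp: dual_group_def norm_divide intro!: continuous_intros F)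
    show "F y = F 0 * (F y / F 0)" for y using F0 by simp
  qed
qed

text \<open>The limit for \<open>f\<close> is a multiple of a character or zero, so translation by
  \<open>g\<close> does not change it, and it cancels against the limit for the translate of
  \<open>f\<close>.\<close>

lemma rotated_mean_zero:
  fixes \<gamma> :: "'a::{topological_ab_group_add, t2_space}"
  assumes \<gamma>: "compact_monothetic \<gamma>" and f: "continuous_on UNIV f" and w: "norm w = 1"
    and inv: "\<And>\<psi>. \<psi> \<in> carrier (dual_group :: ('a \<Rightarrow> complex) monoid) \<Longrightarrow> \<psi> g = 1"
  shows "uniform_limit UNIV (\<lambda>N y. rotated_sum \<gamma> (\<lambda>y. f y - f (y + g)) w N y / of_nat N) (\<lambda>_. 0) sequentially"
proof -
  have cpt: "compact (UNIV :: 'a set)" and dense: "closure (group_closure {\<gamma>}) = UNIV"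
    using \<gamma> by (auto simp: compact_monothetic_def)
  obtain F where F: "continuous_on UNIV F"
    "uniform_limit UNIV (\<lambda>N y. rotated_sum \<gamma> f w N y / of_nat N) F sequentially"
    "\<And>y. F (y + \<gamma>) * w = F y"
    using rotated_mean[OF cpt f w] by metis
  have Fg: "F (y + g) = F y" for y
  proof (cases "\<exists>z. F z \<noteq> 0")
    case True
    then obtain \<psi> where \<psi>: "\<psi> \<in> carrier dual_group" "\<And>y. F y = F 0 * \<psi> y"
      using eigenfunction_character[OF dense F(1) w F(3)] by metis
    have "\<psi> (y + g) = \<psi> y"
      using \<psi>(1) inv[OF \<psi>(1)] by (simp add: dual_group_def)
    then show ?thesis using \<psi>(2) by metis
  qed auto
  have shift: "uniform_limit UNIV (\<lambda>N y. rotated_sum \<gamma> f w N (y + g) / of_nat N) (\<lambda>y. F (y + g)) sequentially"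
    using F(2) unfolding uniform_limit_iff by (auto elim!: eventually_mono)
  have "rotated_sum \<gamma> (\<lambda>y. f y - f (y + g)) w N y / of_nat N
      = rotated_sum \<gamma> f w N y / of_nat N - rotated_sum \<gamma> f w N (y + g) / of_nat N" for N y
    by (simp add: rotated_sum_def sum_subtractf diff_divide_distrib algebra_simps)
  then show ?thesis
    using uniform_limit_minus[OF F(2) shift] by (simp add: Fg)
qed

text \<open>For each \<open>w\<close> the average is small at some length \<open>M\<close>; by
  continuity it stays small at this one length for nearby rotations, and long sums inherit the bound
  when cut into blocks of length \<open>M\<close>. Compactness of the circle leaves finitely many
  lengths.\<close>

lemma rotated_sum_uniformly_small:
  fixes h :: "'a::topological_ab_group_add \<Rightarrow> complex"
  assumes cpt: "compact (UNIV :: 'a set)" and h: "continuous_on UNIV h"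
    and C: "\<And>y. norm (h y) \<le> C" and e: "0 < e"
    and lim: "\<And>w. norm w = 1 \<Longrightarrow>
      uniform_limit UNIV (\<lambda>N y. rotated_sum \<gamma> h w N y / of_nat N) (\<lambda>_. 0) sequentially"
  obtains N0 where "\<And>N w y. N \<ge> N0 \<Longrightarrow> norm w = 1 \<Longrightarrow> norm (rotated_sum \<gamma> h w N y) \<le> e * real N"
proof -
  let ?S = "sphere (0::complex) 1"
  have C0: "0 \<le> C" using C[of 0] norm_ge_zero order.trans by blast
  have "\<exists>V M. w \<in> V \<and> open V \<and> M \<ge> 1 \<and> (\<forall>v\<in>V \<inter> ?S. \<forall>y. norm (rotated_sum \<gamma> h v M y) \<le> e / 2 * real M)"
    if w: "w \<in> ?S" for w
  proof -
    have "\<forall>\<^sub>F N in sequentially. \<forall>y\<in>UNIV. dist (rotated_sum \<gamma> h w N y / of_nat N) 0 < e / 4"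
      using uniform_limitD[OF lim[of w], of "e / 4"] w e by simp
    then obtain M where M: "M \<ge> 1" "\<And>y. norm (rotated_sum \<gamma> h w M y / of_nat M) < e / 4"
      unfolding eventually_sequentially by (metis UNIV_I dist_norm diff_zero linorder_le_cases order_refl)
    have cont: "continuous_on (?S \<times> UNIV) (\<lambda>q. rotated_sum \<gamma> h (fst q) M (snd q))"
      unfolding rotated_sum_def
      by (intro continuous_intros continuous_on_compose2[OF h]) auto
    obtain V where V: "w \<in> V" "open V"
      "\<forall>v\<in>V \<inter> ?S. \<forall>y\<in>UNIV. dist (rotated_sum \<gamma> h v M y) (rotated_sum \<gamma> h w M y) \<le> e / 4"
      using continuous_on_prod_compactE[OF cont cpt w, of "e / 4"] e by auto
    have "norm (rotated_sum \<gamma> h v M y) \<le> e / 2 * real M" if v: "v \<in> V \<inter> ?S" for v y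
    proof -
      have "norm (rotated_sum \<gamma> h v M y) \<le> norm (rotated_sum \<gamma> h w M y) + dist (rotated_sum \<gamma> h v M y) (rotated_sum \<gamma> h w M y)"
        unfolding dist_norm by (rule norm_triangle_sub)
      also have "\<dots> \<le> e / 4 * M + e / 4"
        using M(1) M(2)[of y] V(3) v
        by (intro add_mono) (auto simp: norm_divide divide_less_eq)
      also have "\<dots> \<le> e / 2 * M" using M(1) e by (simp add: field_simps)
      finally show ?thesis .
    qed
    with V M show ?thesis by blast
  qed
  then obtain V M where VM: "\<And>w. w \<in> ?S \<Longrightarrow> w \<in> V w" "\<And>w. w \<in> ?S \<Longrightarrow> open (V w)" "\<And>w. w \<in> ?S \<Longrightarrow> M w \<ge> (1::nat)"
    "\<And>w v y. w \<in> ?S \<Longrightarrow> v \<in> V w \<inter> ?S \<Longrightarrow> norm (rotated_sum \<gamma> h v (M w) y) \<le> e / 2 * real (M w)"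
    by metis
  have "?S \<subseteq> (\<Union>w\<in>?S. V w)" using VM(1) by blast
  then obtain D where D: "D \<subseteq> ?S" "finite D" "?S \<subseteq> (\<Union>w\<in>D. V w)"
    using compactE_image[OF compact_sphere, of ?S V] VM(2) by metis
  obtain m where m: "M ` D \<subseteq> {..<m}"
    using finite_nat_bounded D(2) by (metis finite_imageI)
  \<comment> \<open>The incomplete last block contributes at most \<open>C * m\<close>; from
    \<open>N0\<close> on this is at most half of the allowed \<open>e * N\<close>.\<close>
  obtain N0 where N0: "2 * C * m / e < real N0"
    using reals_Archimedean2 by blast
  show thesis
  proof (rule that[of N0])
    fix N w y assume N: "N0 \<le> N" and w: "norm (w::complex) = 1"
    obtain v where v: "v \<in> D" "w \<in> V v" using D(3) w by force
    let ?M = "M v"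
    have small: "norm (rotated_sum \<gamma> h w ?M y) \<le> e / 2 * real ?M" for y
      using VM(4)[of v w] v w D(1) by auto
    have blocks: "norm (rotated_sum \<gamma> h w (q * ?M) y) \<le> e / 2 * real (q * ?M)" for q
    proof (induction q)
      case (Suc q)
      have "norm (rotated_sum \<gamma> h w (q * ?M + ?M) y) \<le> e / 2 * real (q * ?M) + e / 2 * real ?M"
        unfolding rotated_sum_add
        by (rule order.trans[OF norm_triangle_ineq add_mono[OF Suc]]) (use small in \<open>simp add: norm_mult norm_power w\<close>)
      then show ?case by (simp add: algebra_simps)
    qed (simp add: rotated_sum_def)
    have "N = (N div ?M) * ?M + N mod ?M" by simp
    then have "norm (rotated_sum \<gamma> h w N y)
      \<le> norm (rotated_sum \<gamma> h w (N div ?M * ?M) y)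
        + norm (w ^ (N div ?M * ?M) * rotated_sum \<gamma> h w (N mod ?M) (y + nat_multiple (N div ?M * ?M) \<gamma>))"
      by (metis rotated_sum_add norm_triangle_ineq)
    also have "\<dots> \<le> e / 2 * real (N div ?M * ?M) + C * (N mod ?M)"
      using blocks rotated_sum_bound[OF C w] by (intro add_mono) (simp_all add: norm_mult norm_power w)
    also have "\<dots> \<le> e / 2 * N + C * m"
    proof (intro add_mono mult_left_mono)
      have "N mod ?M < ?M" using VM(3)[of v] v(1) D(1) by (intro mod_less_divisor) force
      then show "real (N mod ?M) \<le> m" using m v(1) by force
      show "real (N div ?M * ?M) \<le> N"
        by (metis div_times_less_eq_dividend of_nat_mono)
    qed (use e C0 in auto)
    also have "C * m \<le> e / 2 * N"
    proof -
      have "2 * C * m < e * N0" using N0 e by (simp add: field_simps)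
      also have "\<dots> \<le> e * N" using N e by simp
      finally show ?thesis by simp
    qed
    finally show "norm (rotated_sum \<gamma> h w N y) \<le> e * real N" by simp
  qed
qed

section \<open>Parseval's identity on roots of unity, and autocorrelations\<close>

lemma roots_of_unity_orthogonal:
  assumes "n < P" "m < P"
  shows "(\<Sum>\<xi><P. cis (2 * pi * real \<xi> / real P) ^ n * cnj (cis (2 * pi * real \<xi> / real P) ^ m)) = (if n = m then of_nat P else 0)"
proof -
  have P: "0 < P" using assms by simp
  define u where "u = cis (2 * pi * (real n - real m) / P)"
  have "cis (2 * pi * real \<xi> / real P) ^ n * cnj (cis (2 * pi * real \<xi> / real P) ^ m) = u ^ \<xi>" for \<xi> :: nat
    by (simp add: u_def Complex.DeMoivre cis_cnj cis_mult field_simps diff_divide_distrib)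
  then have eq: "(\<Sum>\<xi><P. cis (2 * pi * real \<xi> / real P) ^ n * cnj (cis (2 * pi * real \<xi> / real P) ^ m)) = (\<Sum>\<xi><P. u ^ \<xi>)"
    by simp
  show ?thesis
  proof (cases "n = m")
    case True
    then show ?thesis unfolding eq by (simp add: u_def)
  next
    case False
    have "u ^ P = cis (2 * pi * (real n - real m))"
      using P by (simp add: u_def Complex.DeMoivre)
    also have "\<dots> = 1"
      by (intro cis_multiple_2pi) auto
    finally have "u ^ P = 1" .
    moreover have "u \<noteq> 1"
    proof
      assume "u = 1"
      then have "cos (2 * pi * (real n - real m) / P) = 1"
        by (metis u_def cis.sel(1) one_complex.sel(1))
      then obtain j :: int where j: "2 * pi * (real n - real m) / P = of_int j * 2 * pi"
        by (auto simp: cos_one_2pi_int)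
      then have "2 * pi * (real n - real m) = 2 * pi * (of_int j * P)"
        using P by (simp add: field_simps)
      then have "real n - real m = of_int j * P"
        by simp
      then have "real_of_int (int n - int m) = real_of_int (j * int P)"
        by simp
      then have "int n - int m = j * int P"
        by (simp only: of_int_eq_iff)
      then have "int P dvd int n - int m" by simp
      then have "int n mod int P = int m mod int P"
        by (simp add: mod_eq_dvd_iff)
      then show False using assms False by simp
    qed
    ultimately show ?thesis
      unfolding eq using False by (simp add: geometric_sum)
  qed
qed

text \<open>Replaces the mean square over the unit circle by a finite sum: sampling at the
  \<open>P\<close>-th roots of unity is exact for polynomials of degree less than
  \<open>P\<close>.\<close>

lemma Parseval_roots_of_unity:
  fixes c :: "nat \<Rightarrow> complex"
  shows "(\<Sum>\<xi><P. (norm (\<Sum>n<P. c n * cis (2 * pi * real \<xi> / real P) ^ n))\<^sup>2) = P * (\<Sum>n<P. (norm (c n))\<^sup>2)"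
proof -
  let ?z = "\<lambda>\<xi>::nat. cis (2 * pi * real \<xi> / real P)"
  have "complex_of_real (\<Sum>\<xi><P. (norm (\<Sum>n<P. c n * ?z \<xi> ^ n))\<^sup>2)
      = (\<Sum>\<xi><P. (\<Sum>n<P. c n * ?z \<xi> ^ n) * cnj (\<Sum>n<P. c n * ?z \<xi> ^ n))"
    unfolding of_real_sum complex_norm_square ..
  also have "\<dots> = (\<Sum>\<xi><P. \<Sum>n<P. \<Sum>m<P. c n * cnj (c m) * (?z \<xi> ^ n * cnj (?z \<xi> ^ m)))"
    unfolding cnj_sum sum_product by (simp add: mult_ac)
  also have "\<dots> = (\<Sum>n<P. \<Sum>\<xi><P. \<Sum>m<P. c n * cnj (c m) * (?z \<xi> ^ n * cnj (?z \<xi> ^ m)))"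
    by (rule sum.swap)
  also have "\<dots> = (\<Sum>n<P. \<Sum>m<P. \<Sum>\<xi><P. c n * cnj (c m) * (?z \<xi> ^ n * cnj (?z \<xi> ^ m)))"
    by (intro sum.cong refl sum.swap)
  also have "\<dots> = (\<Sum>n<P. \<Sum>m<P. c n * cnj (c m) * (if n = m then of_nat P else 0))"
    unfolding sum_distrib_left[symmetric]
    by (intro sum.cong refl) (simp only: roots_of_unity_orthogonal lessThan_iff)
  also have "\<dots> = (\<Sum>n<P. c n * cnj (c n) * of_nat P)"
    by (intro sum.cong refl) (simp add: if_distrib sum.delta cong: if_cong)
  also have "\<dots> = (\<Sum>n<P. complex_of_real ((norm (c n))\<^sup>2) * of_nat P)"
    unfolding complex_norm_square ..
  also have "\<dots> = complex_of_real (P * (\<Sum>n<P. (norm (c n))\<^sup>2))"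
    by (simp add: sum_distrib_left mult.commute)
  finally show ?thesis
    unfolding of_real_eq_iff .
qed

text \<open>The autocorrelations of \<open>a\<close> are coefficients of the product of the polynomials with coefficients
  \<open>a\<close> and \<open>c\<close>, where \<open>c\<close> is the reversed conjugate of \<open>a\<close>.\<close>
lemma autocorrelation_bound:
  fixes a :: "nat \<Rightarrow> complex"
  assumes B: "\<And>w. norm w = 1 \<Longrightarrow> norm (\<Sum>n<N. a n * w ^ n) \<le> B" and N: "0 < N"
  shows "(\<Sum>m<N. (norm (\<Sum>j<N - m. a (j + m) * cnj (a j)))\<^sup>2) \<le> B\<^sup>2 * (\<Sum>n<N. (norm (a n))\<^sup>2)"
proof -
  define a' where "a' n = (if n < N then a n else 0)" for n
  define c where "c n = (if n < N then cnj (a (N - 1 - n)) else 0)" for n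
  define p where "p n = (\<Sum>k\<le>n. a' k * c (n - k))" for n
  \<comment> \<open>The product polynomial has degree at most \<open>2 * N - 2\<close>, so this many
    roots of unity see its coefficients without aliasing.\<close>
  define P where "P = 2 * N"
  define z where "z \<xi> = cis (2 * pi * real \<xi> / real P)" for \<xi> :: nat
  have z: "norm (z \<xi>) = 1" for \<xi> by (simp add: z_def)
  have N1: "{..N - 1} = {..<N}" "{..N - 1 + (N - 1)} \<subseteq> {..<P}" using N by (auto simp: P_def)
  have prod: "(\<Sum>i<N. a' i * x ^ i) * (\<Sum>j<N. c j * x ^ j) = (\<Sum>n<P. p n * x ^ n)" for x
  proof -
    have "(\<Sum>i<N. a' i * x ^ i) * (\<Sum>j<N. c j * x ^ j) = (\<Sum>n\<le>N - 1 + (N - 1). p n * x ^ n)"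
      unfolding p_def N1(1)[symmetric]
      by (rule polynomial_product) (auto simp: a'_def c_def)
    also have "\<dots> = (\<Sum>n<P. p n * x ^ n)"
    proof (rule sum.mono_neutral_left)
      show "\<forall>n\<in>{..<P} - {..N - 1 + (N - 1)}. p n * x ^ n = 0"
        by (auto simp: p_def a'_def c_def intro!: sum.neutral)
    qed (use N1 in auto)
    finally show ?thesis .
  qed
  \<comment> \<open>The reversal in \<open>c\<close> puts lag 0 at degree \<open>N - 1\<close>,
    hence lag \<open>m\<close> at degree \<open>N - 1 + m\<close>.\<close>
  have coeff: "p (N - 1 + m) = (\<Sum>j<N - m. a (j + m) * cnj (a j))" if "m < N" for m
  proof -
    have "p (N - 1 + m) = (\<Sum>k\<in>{m..<N}. a' k * c (N - 1 + m - k))"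
      unfolding p_def using that
      by (intro sum.mono_neutral_right) (auto simp: a'_def c_def)
    also have "\<dots> = (\<Sum>k\<in>{m..<N}. a k * cnj (a (k - m)))"
      using that by (intro sum.cong) (auto simp: a'_def c_def)
    also have "\<dots> = (\<Sum>j<N - m. a (j + m) * cnj (a j))"
      by (rule sum.reindex_bij_witness[of _ "\<lambda>j. j + m" "\<lambda>k. k - m"]) auto
    finally show ?thesis .
  qed
  have c_norm: "(\<Sum>n<P. (norm (c n))\<^sup>2) = (\<Sum>n<N. (norm (a n))\<^sup>2)"
  proof -
    have "(\<Sum>n<P. (norm (c n))\<^sup>2) = (\<Sum>n<N. (norm (a (N - 1 - n)))\<^sup>2)"
      by (rule sum.mono_neutral_cong_right) (auto simp: c_def P_def)
    also have "\<dots> = (\<Sum>n<N. (norm (a n))\<^sup>2)"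
      by (rule sum.reindex_bij_witness[of _ "\<lambda>n. N - 1 - n" "\<lambda>n. N - 1 - n"]) auto
    finally show ?thesis .
  qed
  have cP: "(\<Sum>j<N. c j * x ^ j) = (\<Sum>j<P. c j * x ^ j)" for x
    by (rule sum.mono_neutral_left) (auto simp: c_def P_def)
  have "(\<Sum>m<N. (norm (\<Sum>j<N - m. a (j + m) * cnj (a j)))\<^sup>2) = (\<Sum>m<N. (norm (p (N - 1 + m)))\<^sup>2)"
    by (rule sum.cong) (simp_all only: coeff lessThan_iff)
  also have "\<dots> = (\<Sum>n\<in>(\<lambda>m. N - 1 + m) ` {..<N}. (norm (p n))\<^sup>2)"
    by (subst sum.reindex) (use N in \<open>auto simp: inj_on_def\<close>)
  also have "\<dots> \<le> (\<Sum>n<P. (norm (p n))\<^sup>2)"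
    by (rule sum_mono2) (auto simp: P_def)
  finally have le: "(\<Sum>m<N. (norm (\<Sum>j<N - m. a (j + m) * cnj (a j)))\<^sup>2) \<le> (\<Sum>n<P. (norm (p n))\<^sup>2)" .
  have "P * (\<Sum>n<P. (norm (p n))\<^sup>2) = (\<Sum>\<xi><P. (norm (\<Sum>n<P. p n * z \<xi> ^ n))\<^sup>2)"
    unfolding z_def by (rule Parseval_roots_of_unity[symmetric])
  also have "\<dots> = (\<Sum>\<xi><P. (norm (\<Sum>i<N. a i * z \<xi> ^ i))\<^sup>2 * (norm (\<Sum>j<P. c j * z \<xi> ^ j))\<^sup>2)"
    unfolding prod[symmetric] cP norm_mult power_mult_distrib by (simp add: a'_def)
  \<comment> \<open>The uniform bound \<open>B\<close> is spent on the factor with coefficients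
    \<open>a\<close>, and Parseval's identity on the factor with coefficients
    \<open>c\<close>.\<close>
  also have "\<dots> \<le> (\<Sum>\<xi><P. B\<^sup>2 * (norm (\<Sum>j<P. c j * z \<xi> ^ j))\<^sup>2)"
    by (intro sum_mono mult_right_mono power_mono B z) auto
  also have "\<dots> = B\<^sup>2 * (P * (\<Sum>n<P. (norm (c n))\<^sup>2))"
    unfolding sum_distrib_left[symmetric] z_def Parseval_roots_of_unity ..
  also have "\<dots> = P * (B\<^sup>2 * (\<Sum>n<N. (norm (a n))\<^sup>2))"
    by (simp add: c_norm)
  finally have "(\<Sum>n<P. (norm (p n))\<^sup>2) \<le> B\<^sup>2 * (\<Sum>n<N. (norm (a n))\<^sup>2)"
    using N by (simp add: P_def)
  with le show ?thesis by (rule order.trans)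
qed

section \<open>Recurrence of the generator\<close>

definition almost_periods :: "'a::comm_monoid_add \<Rightarrow> ('a \<Rightarrow> complex) \<Rightarrow> real \<Rightarrow> nat set" where
  "almost_periods \<gamma> h \<delta> = {m. \<forall>y. norm (h (y + nat_multiple m \<gamma>) - h y) \<le> \<delta>}"

text \<open>Indices fall into finitely many classes, in each of which the translates of
  \<open>h\<close> differ by at most \<open>\<delta>\<close>, so differences within a class are
  almost periods. Subtracting the least element maps a class below \<open>K\<close> injectively into
  the almost periods below \<open>K\<close>; \<open>q\<close> counts the classes.\<close>

lemma almost_periods_density:
  fixes h :: "'a::topological_ab_group_add \<Rightarrow> complex"
  assumes cpt: "compact (UNIV :: 'a set)" and h: "continuous_on UNIV h" and \<delta>: "0 < \<delta>"
  obtains q :: nat where "0 < q" "\<And>K. K \<le> q * card (almost_periods \<gamma> h \<delta> \<inter> {..<K})"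
proof -
  obtain E :: "nat set" where E: "finite E"
    "\<And>n. \<exists>m\<in>E. \<forall>y. norm (h (y + nat_multiple n \<gamma>) - h (y + nat_multiple m \<gamma>)) \<le> \<delta> / 2"
    using orbit_totally_bounded[OF cpt h, of 1 "\<delta> / 2" \<gamma>] \<delta> by auto
  then obtain r where r: "\<And>n. r n \<in> E"
    "\<And>n y. norm (h (y + nat_multiple n \<gamma>) - h (y + nat_multiple (r n) \<gamma>)) \<le> \<delta> / 2"
    by metis
  have fibre: "card {n\<in>{..<K}. r n = m} \<le> card (almost_periods \<gamma> h \<delta> \<inter> {..<K})" (is "card ?F \<le> _") for K m
  proof (cases "?F = {}")
    case False
    define n' where "n' = Min ?F"
    have fin: "finite ?F" by simp
    have n': "n' \<in> ?F" "\<And>n. n \<in> ?F \<Longrightarrow> n' \<le> n"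
      using Min_in[OF fin False] Min_le[OF fin] by (auto simp: n'_def)
    have "n - n' \<in> almost_periods \<gamma> h \<delta>" if n: "n \<in> ?F" for n
    proof -
      have "norm (h (y + nat_multiple (n - n') \<gamma>) - h y) \<le> \<delta>" for y
      proof -
        let ?y = "y - nat_multiple n' \<gamma>"
        have "norm (h (?y + nat_multiple n \<gamma>) - h (?y + nat_multiple m \<gamma>)) \<le> \<delta> / 2"
          "norm (h (?y + nat_multiple n' \<gamma>) - h (?y + nat_multiple m \<gamma>)) \<le> \<delta> / 2"
          using r(2)[of ?y n] r(2)[of ?y n'] n n'(1) by auto
        then have "norm (h (?y + nat_multiple n \<gamma>) - h (?y + nat_multiple n' \<gamma>)) \<le> \<delta>"
          using dist_triangle2[of "h (?y + nat_multiple n \<gamma>)" "h (?y + nat_multiple n' \<gamma>)" "h (?y + nat_multiple m \<gamma>)"]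
          by (simp add: dist_norm)
        moreover have "nat_multiple n \<gamma> = nat_multiple (n - n') \<gamma> + nat_multiple n' \<gamma>"
          using n'(2)[OF n] by (simp flip: nat_multiple_add)
        ultimately show ?thesis by (simp add: algebra_simps)
      qed
      then show ?thesis by (simp add: almost_periods_def)
    qed
    moreover have "inj_on (\<lambda>n. n - n') ?F"
      using n'(2) by (auto simp: inj_on_def) (metis le_add_diff_inverse)
    ultimately show ?thesis
      by (intro card_inj_on_le[of "\<lambda>n. n - n'"]) auto
  next
    case True
    then show ?thesis by (simp only: card.empty)
  qed
  show thesis
  proof (rule that[of "card E"])
    show "0 < card E" using E r(1) by (auto simp: card_gt_0_iff)
    fix K
    have cover: "{..<K} = (\<Union>m\<in>E. {n\<in>{..<K}. r n = m})" using r(1) by auto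
    have "K = card {..<K}" by simp
    also have "\<dots> = card (\<Union>m\<in>E. {n\<in>{..<K}. r n = m})"
      by (rule arg_cong[OF cover])
    also have "\<dots> \<le> (\<Sum>m\<in>E. card {n\<in>{..<K}. r n = m})"
      by (rule card_UN_le[OF E(1)])
    also have "\<dots> \<le> (\<Sum>m\<in>E. card (almost_periods \<gamma> h \<delta> \<inter> {..<K}))"
      by (intro sum_mono fibre)
    finally show "K \<le> card E * card (almost_periods \<gamma> h \<delta> \<inter> {..<K})" by simp
  qed
qed

text \<open>At an almost period \<open>j\<close> the value
  \<open>h (nat_multiple j \<gamma>)\<close> has norm at least half of \<open>norm (h 0)\<close>,
  and a proportion of at least \<open>1 / q\<close> of all indices are almost periods.\<close>

lemma square_mean_bound:
  fixes h :: "'a::topological_ab_group_add \<Rightarrow> complex"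
  assumes cpt: "compact (UNIV :: 'a set)" and h: "continuous_on UNIV h" and h0: "h 0 \<noteq> 0"
  obtains c where "0 < c" "\<And>K. c * real K \<le> (\<Sum>j<K. (norm (h (nat_multiple j \<gamma>)))\<^sup>2)"
proof -
  define \<delta> where "\<delta> = norm (h 0) / 2"
  have \<delta>: "0 < \<delta>" using h0 by (simp add: \<delta>_def)
  obtain q where q: "0 < q" "\<And>K. K \<le> q * card (almost_periods \<gamma> h \<delta> \<inter> {..<K})"
    using almost_periods_density[OF cpt h \<delta>] by metis
  show thesis
  proof (rule that[of "\<delta>\<^sup>2 / q"])
    show "0 < \<delta>\<^sup>2 / q" using \<delta> q by simp
    fix K
    have "\<delta>\<^sup>2 / q * real K \<le> \<delta>\<^sup>2 / q * (q * card (almost_periods \<gamma> h \<delta> \<inter> {..<K}))"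
      using q(2)[of K] by (intro mult_left_mono) (simp_all flip: of_nat_mult)
    also have "\<dots> = (\<Sum>j\<in>almost_periods \<gamma> h \<delta> \<inter> {..<K}. \<delta>\<^sup>2)"
      using q(1) by simp
    also have "\<dots> \<le> (\<Sum>j\<in>almost_periods \<gamma> h \<delta> \<inter> {..<K}. (norm (h (nat_multiple j \<gamma>)))\<^sup>2)"
    proof (intro sum_mono power_mono)
      fix j assume "j \<in> almost_periods \<gamma> h \<delta> \<inter> {..<K}"
      then have "norm (h (0 + nat_multiple j \<gamma>) - h 0) \<le> \<delta>"
        unfolding almost_periods_def by blast
      then show "\<delta> \<le> norm (h (nat_multiple j \<gamma>))"
        using norm_triangle_sub[of "h 0" "h (nat_multiple j \<gamma>)"] by (simp add: \<delta>_def norm_minus_commute)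
    qed (use \<delta> in simp)
    also have "\<dots> \<le> (\<Sum>j<K. (norm (h (nat_multiple j \<gamma>)))\<^sup>2)"
      by (rule sum_mono2) auto
    finally show "\<delta>\<^sup>2 / q * real K \<le> (\<Sum>j<K. (norm (h (nat_multiple j \<gamma>)))\<^sup>2)" .
  qed
qed

text \<open>Each almost period \<open>m < K\<close> has an autocorrelation of norm at least
  \<open>c * K / 2\<close>, and there are at least \<open>K / q\<close> of them, so the squares sum
  to at least \<open>c\<^sup>2 * K ^ 3 / (4 * q)\<close>. Vanishing means bound the same sum from
  above, and \<open>e\<close> is chosen so that this bound is half as large.\<close>

lemma rotated_means_not_all_zero:
  fixes h :: "'a::topological_ab_group_add \<Rightarrow> complex"
  assumes cpt: "compact (UNIV :: 'a set)" and h: "continuous_on UNIV h" and h0: "h 0 \<noteq> 0"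
    and lim: "\<And>w. norm w = 1 \<Longrightarrow>
      uniform_limit UNIV (\<lambda>N y. rotated_sum \<gamma> h w N y / of_nat N) (\<lambda>_. 0) sequentially"
  shows False
proof -
  have "bounded (range h)"
    using compact_continuous_image[OF h cpt] compact_imp_bounded by blast
  then obtain C where C: "\<And>y. norm (h y) \<le> C" and C0: "0 < C"
    unfolding bounded_pos by auto
  obtain c where c: "0 < c" "\<And>K. c * real K \<le> (\<Sum>j<K. (norm (h (nat_multiple j \<gamma>)))\<^sup>2)"
    using square_mean_bound[OF cpt h h0] by metis
  \<comment> \<open>Replacing \<open>a (j + m)\<close> by \<open>a j\<close> in an autocorrelation
    costs at most \<open>N * \<delta> * C\<close>; with \<open>N = 2 * K\<close> this is
    \<open>c * K / 2\<close>, half of the main term.\<close>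
  define \<delta> where "\<delta> = c / (4 * C)"
  have \<delta>: "0 < \<delta>" using c C0 by (simp add: \<delta>_def)
  obtain q where q: "0 < q" "\<And>K. K \<le> q * card (almost_periods \<gamma> h \<delta> \<inter> {..<K})"
    using almost_periods_density[OF cpt h \<delta>] by metis
  define e where "e = c / (8 * C * sqrt q)"
  have e: "0 < e" using c C0 q by (simp add: e_def)
  obtain N0 where N0: "\<And>N w y. N \<ge> N0 \<Longrightarrow> norm w = 1 \<Longrightarrow> norm (rotated_sum \<gamma> h w N y) \<le> e * real N"
    using rotated_sum_uniformly_small[OF cpt h C e lim] by metis
  define a where "a n = h (nat_multiple n \<gamma>)" for n
  define K where "K = Suc N0"
  \<comment> \<open>The factor 2 leaves at least \<open>K\<close> summands in \<open>corr m\<close>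
    for every lag \<open>m < K\<close>.\<close>
  define N where "N = 2 * K"
  have K: "0 < K" "N0 \<le> N" by (auto simp: K_def N_def)
  define corr where "corr m = (\<Sum>j<N - m. a (j + m) * cnj (a j))" for m
  have "(\<Sum>m<N. (norm (corr m))\<^sup>2) \<le> (e * N)\<^sup>2 * (\<Sum>n<N. (norm (a n))\<^sup>2)"
    unfolding corr_def
  proof (rule autocorrelation_bound)
    show "norm (\<Sum>n<N. a n * w ^ n) \<le> e * N" if "norm w = 1" for w
      using N0[OF K(2) that, of 0] by (simp add: rotated_sum_def a_def)
  qed (use K in \<open>simp add: N_def\<close>)
  also have "\<dots> \<le> (e * N)\<^sup>2 * (\<Sum>n<N. C\<^sup>2)"
    by (intro mult_left_mono sum_mono power_mono) (auto simp: a_def C)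
  finally have upper: "(\<Sum>m<N. (norm (corr m))\<^sup>2) \<le> 8 * e\<^sup>2 * C\<^sup>2 * real K ^ 3"
    by (simp add: N_def power2_eq_square power3_eq_cube mult_ac)
  have corr_large: "c * K / 2 \<le> norm (corr m)" if m: "m \<in> almost_periods \<gamma> h \<delta> \<inter> {..<K}" for m
  proof -
    have sq: "(\<Sum>j<N - m. a j * cnj (a j)) = of_real (\<Sum>j<N - m. (norm (a j))\<^sup>2)"
      unfolding of_real_sum complex_norm_square ..
    have "c * K \<le> (\<Sum>j<K. (norm (a j))\<^sup>2)" using c(2)[of K] by (simp add: a_def)
    also have "\<dots> \<le> (\<Sum>j<N - m. (norm (a j))\<^sup>2)"
      using m by (intro sum_mono2) (auto simp: N_def)
    also have "\<dots> \<le> norm (\<Sum>j<N - m. a j * cnj (a j))"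
      unfolding sq norm_of_real by (rule abs_ge_self)
    also have "\<dots> \<le> norm (corr m) + norm ((\<Sum>j<N - m. a j * cnj (a j)) - corr m)"
      by (rule norm_triangle_sub)
    also have "norm ((\<Sum>j<N - m. a j * cnj (a j)) - corr m) \<le> (\<Sum>j<N - m. \<delta> * C)"
      unfolding corr_def sum_subtractf[symmetric] left_diff_distrib[symmetric]
    proof (rule sum_norm_le)
      fix j
      have "norm (h (nat_multiple j \<gamma> + nat_multiple m \<gamma>) - h (nat_multiple j \<gamma>)) \<le> \<delta>"
        using m by (auto simp: almost_periods_def)
      then show "norm ((a j - a (j + m)) * cnj (a j)) \<le> \<delta> * C"
        using C \<delta> by (auto simp: norm_mult a_def nat_multiple_add norm_minus_commute intro!: mult_mono)
    qed
    also have "\<dots> \<le> N * (\<delta> * C)"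
      using \<delta> C0 by (simp add: mult_right_mono)
    also have "\<dots> = c * K / 2"
      using C0 by (simp add: \<delta>_def N_def)
    finally show ?thesis by simp
  qed
  have "real K * (c * K / 2)\<^sup>2 \<le> q * card (almost_periods \<gamma> h \<delta> \<inter> {..<K}) * (c * K / 2)\<^sup>2"
    using q(2)[of K] by (intro mult_right_mono) (simp_all flip: of_nat_mult)
  also have "\<dots> = q * (\<Sum>m\<in>almost_periods \<gamma> h \<delta> \<inter> {..<K}. (c * K / 2)\<^sup>2)"
    by simp
  also have "\<dots> \<le> q * (\<Sum>m\<in>almost_periods \<gamma> h \<delta> \<inter> {..<K}. (norm (corr m))\<^sup>2)"
    using c by (intro mult_left_mono sum_mono power_mono corr_large) auto
  also have "\<dots> \<le> q * (\<Sum>m<N. (norm (corr m))\<^sup>2)"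
    by (intro mult_left_mono sum_mono2) (auto simp: N_def)
  also have "\<dots> \<le> q * (8 * e\<^sup>2 * C\<^sup>2 * real K ^ 3)"
    by (intro mult_left_mono upper) auto
  also have "\<dots> = c\<^sup>2 / 8 * real K ^ 3"
    using C0 q by (simp add: e_def power_divide power_mult_distrib)
  finally have "c\<^sup>2 * real K ^ 3 / 4 \<le> c\<^sup>2 * real K ^ 3 / 8"
    by (simp add: power_divide power_mult_distrib power2_eq_square power3_eq_cube mult_ac)
  moreover have "0 < c\<^sup>2 * real K ^ 3" using c K by simp
  ultimately show False by simp
qed

lemma Hausdorff_space_t2: "Hausdorff_space (euclidean :: 'a::t2_space topology)"
  by (simp add: Hausdorff_space_def disjnt_def) (metis hausdorff)

theorem characters_separate_points:
  fixes \<gamma> :: "'a::{topological_ab_group_add, t2_space}"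
  assumes \<gamma>: "compact_monothetic \<gamma>" and g: "g \<noteq> 0"
  obtains \<psi> where "\<psi> \<in> carrier (dual_group :: ('a \<Rightarrow> complex) monoid)" "\<psi> g \<noteq> 1"
proof (rule ccontr)
  assume "\<not> thesis"
  then have inv: "\<psi> g = 1" if "\<psi> \<in> carrier (dual_group :: ('a \<Rightarrow> complex) monoid)" for \<psi>
    using that \<open>\<And>\<psi>. \<psi> \<in> carrier dual_group \<Longrightarrow> \<psi> g \<noteq> 1 \<Longrightarrow> thesis\<close> by blast
  have cpt: "compact (UNIV :: 'a set)"
    using \<gamma> by (simp add: compact_monothetic_def)
  then have "compact_space (euclidean :: 'a topology)"
    by (simp add: compact_space_def)
  moreover have "closedin euclidean {g}" "openin euclidean (- {0} :: 'a set)" "{g} \<subseteq> - {0}"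
    using g by (simp_all add: open_Compl)
  ultimately obtain f :: "'a \<Rightarrow> real" where f: "continuous_map euclidean euclideanreal f"
    "\<And>x. 0 \<le> f x \<and> f x \<le> 1" "f g = 1" "f 0 = 0"
    using Urysohn_function[of "euclidean :: 'a topology" "{g}" "- {0}", OF _ Hausdorff_space_t2]
    by (metis ComplD Diff_iff UNIV_I singletonI topspace_euclidean)
  define F where "F y = complex_of_real (f y)" for y
  have F: "continuous_on UNIV F"
    using f(1) unfolding F_def by (intro continuous_intros) simp
  show False
  proof (rule rotated_means_not_all_zero[OF cpt])
    show "continuous_on UNIV (\<lambda>y. F y - F (y + g))"
      by (intro continuous_intros F continuous_on_compose2[OF F]) auto
    show "F 0 - F (0 + g) \<noteq> 0"
      using f(3,4) by (simp add: F_def)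
    show "uniform_limit UNIV (\<lambda>N y. rotated_sum \<gamma> (\<lambda>y. F y - F (y + g)) w N y / of_nat N) (\<lambda>_. 0) sequentially"
      if "norm w = 1" for w
      by (rule rotated_mean_zero[OF \<gamma> F that inv])
  qed
qed

section \<open>Trigonometric polynomials on the power space\<close>

text \<open>The library version of the Stone--Weierstrass theorem wants a Hausdorff type, and the type of
  functions cannot be one: the arity would clash with its metric instance.\<close>

typedef 'a sequence = "UNIV :: (nat \<Rightarrow> 'a) set"
  morphisms sequence_nth Sequence ..

instantiation sequence :: (topological_space) topological_space
begin

definition open_sequence :: "'a sequence set \<Rightarrow> bool" where
  "open_sequence U \<longleftrightarrow> open (Sequence -` U)"

instance
  by standard (auto simp: open_sequence_def vimage_Union)

end

lemma continuous_on_Sequence: "continuous_on A Sequence"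
  by (rule continuous_on_subset[of UNIV]) (auto simp: continuous_on_open_vimage open_sequence_def)

lemma continuous_on_sequence_nth: "continuous_on A sequence_nth"
  by (rule continuous_on_subset[of UNIV])
    (auto simp: continuous_on_open_vimage open_sequence_def vimage_def Sequence_inverse)

instance sequence :: (t2_space) t2_space
proof
  fix f g :: "'a sequence"
  assume "f \<noteq> g"
  then obtain i where "sequence_nth f i \<noteq> sequence_nth g i"
    by (metis ext sequence_nth_inject)
  then obtain U V where UV: "open U" "open V" "sequence_nth f i \<in> U" "sequence_nth g i \<in> V" "U \<inter> V = {}"
    by (meson hausdorff)
  have "continuous_on UNIV (\<lambda>h :: 'a sequence. sequence_nth h i)"
    by (rule continuous_on_compose2[OF continuous_on_product_coordinates continuous_on_sequence_nth]) auto
  then have "open ((\<lambda>h. sequence_nth h i) -` U)" "open ((\<lambda>h. sequence_nth h i) -` V)"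
    using UV by (auto intro!: open_vimage)
  with UV show "\<exists>U V. open U \<and> open V \<and> f \<in> U \<and> g \<in> V \<and> U \<inter> V = {}"
    by (intro exI[of _ "(\<lambda>h. sequence_nth h i) -` U"] exI[of _ "(\<lambda>h. sequence_nth h i) -` V"]) auto
qed

lemma topspace_power_space: "topspace (power_space k) = (\<Pi>\<^sub>E i\<in>{1..k}. UNIV)"
  by (simp add: power_space_def)

text \<open>Points of the product are \<open>undefined\<close> off \<open>{1..k}\<close>, so the
  additional coordinates of the function type are constant on it and contribute nothing to the
  topology. The subspace form gives access to \<open>continuous_on\<close> and to compactness of
  sets.\<close>

lemma power_space_eq_top_of_set: "power_space k = top_of_set (\<Pi>\<^sub>E i\<in>{1..k}. (UNIV :: 'a::topological_space set))"
proof -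
  let ?S = "\<Pi>\<^sub>E i\<in>{1..k}. (UNIV :: 'a set)"
  have "continuous_map (power_space k) (top_of_set ?S) id"
    unfolding continuous_map_in_subtopology
  proof
    have "continuous_map (power_space k) euclidean (\<lambda>x :: nat \<Rightarrow> 'a. x i)" for i
    proof (cases "i \<in> {1..k}")
      case True
      then show ?thesis unfolding power_space_def by (rule continuous_map_product_projection)
    next
      case False
      have "continuous_map (power_space k) euclidean (\<lambda>_ :: nat \<Rightarrow> 'a. undefined :: 'a)"
        by simp
      then show ?thesis
        by (rule continuous_map_eq) (use False in \<open>auto simp: topspace_power_space PiE_def extensional_def\<close>)
    qed
    then show "continuous_map (power_space k) euclidean (id :: (nat \<Rightarrow> 'a) \<Rightarrow> _)"
      unfolding euclidean_product_topology[symmetric] continuous_map_componentwise_UNIV by simp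
  qed (auto simp: topspace_power_space)
  moreover have "continuous_map (top_of_set ?S) (power_space k) id"
    unfolding power_space_def continuous_map_componentwise
    by (auto simp: PiE_def intro!: continuous_on_subset[OF continuous_on_product_coordinates])
  ultimately have "homeomorphic_maps (power_space k) (top_of_set ?S) id id"
    by (simp add: homeomorphic_maps_def)
  then show ?thesis
    by (metis homeomorphic_map_id homeomorphic_maps_map)
qed

lemma continuous_map_power_space:
  "continuous_map (power_space k) euclidean f \<longleftrightarrow> continuous_on (\<Pi>\<^sub>E i\<in>{1..k}. UNIV) f"
  by (simp add: power_space_eq_top_of_set)

lemma compact_space_power_space:
  "compact (UNIV :: 'a::topological_space set) \<Longrightarrow> compact_space (power_space k :: (nat \<Rightarrow> 'a) topology)"
  by (simp add: power_space_def compact_space_product_topology) (simp add: compact_space_def)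

lemma Hausdorff_space_power_space: "Hausdorff_space (power_space k :: (nat \<Rightarrow> 'a::t2_space) topology)"
  by (simp add: power_space_def Hausdorff_space_product_topology Hausdorff_space_t2)

lemma dual_groupD:
  assumes "\<psi> \<in> carrier dual_group"
  shows "continuous_on UNIV \<psi>" "norm (\<psi> x) = 1" "\<psi> (x + y) = \<psi> x * \<psi> y" "\<psi> 0 = 1" "\<psi> (- x) = cnj (\<psi> x)"
    "\<psi> (nat_multiple n x) = \<psi> x ^ n"
proof -
  show c: "continuous_on UNIV \<psi>" and n: "norm (\<psi> x) = 1" and h: "\<psi> (x + y) = \<psi> x * \<psi> y" for x y
    using assms by (auto simp: dual_group_def)
  have nz: "\<psi> x \<noteq> 0" for x using n[of x] by auto
  show 0: "\<psi> 0 = 1" using h[of 0 0] nz by simp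
  have "\<psi> x * cnj (\<psi> x) = 1" using n[of x] by (simp add: complex_norm_square[symmetric])
  moreover have "\<psi> x * \<psi> (- x) = 1" using h[of x "- x"] 0 by simp
  ultimately show "\<psi> (- x) = cnj (\<psi> x)" using nz by (metis mult_left_cancel)
  show "\<psi> (nat_multiple n x) = \<psi> x ^ n"
    by (induction n) (simp_all add: 0 h nat_multiple_Suc)
qed

lemma dual_group_sum:
  assumes "\<psi> \<in> carrier dual_group"
  shows "\<psi> (\<Sum>i\<in>I. x i) = (\<Prod>i\<in>I. \<psi> (x i))"
  by (induction I rule: infinite_finite_induct) (simp_all add: dual_groupD[OF assms])

lemma dual_group_one: "(\<lambda>_. 1) \<in> carrier dual_group"
  by (simp add: dual_group_def)

lemma dual_group_one_eq: "\<one>\<^bsub>dual_group\<^esub> = (\<lambda>_. 1)"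
  by (simp add: dual_group_def)

lemma dual_group_mult:
  "\<psi> \<in> carrier dual_group \<Longrightarrow> \<phi> \<in> carrier dual_group \<Longrightarrow> (\<lambda>x. \<psi> x * \<phi> x) \<in> carrier dual_group"
  by (auto simp: dual_group_def norm_mult intro!: continuous_on_mult)

lemma dual_group_power: "\<psi> \<in> carrier dual_group \<Longrightarrow> (\<lambda>x. \<psi> x ^ n) \<in> carrier dual_group"
  by (induction n) (simp_all add: dual_group_one dual_group_mult)

lemma dual_group_prod:
  "(\<And>i. i \<in> I \<Longrightarrow> \<psi> i \<in> carrier dual_group) \<Longrightarrow> (\<lambda>x. \<Prod>i\<in>I. \<psi> i x) \<in> carrier dual_group"
  by (induction I rule: infinite_finite_induct) (simp_all add: dual_group_one dual_group_mult)

lemma dual_group_cnj: "\<psi> \<in> carrier dual_group \<Longrightarrow> (\<lambda>x. cnj (\<psi> x)) \<in> carrier dual_group"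
  by (auto simp: dual_group_def intro!: continuous_on_cnj)

lemma dual_group_nat_pow: "\<psi> [^]\<^bsub>dual_group\<^esub> (n::nat) = (\<lambda>x. \<psi> x ^ n)"
proof (induction n)
  case 0
  then show ?case by (simp add: nat_pow_def dual_group_def)
next
  case (Suc n)
  have "\<psi> [^]\<^bsub>dual_group\<^esub> Suc n = (\<lambda>x. (\<psi> [^]\<^bsub>dual_group\<^esub> n) x * \<psi> x)"
    by (simp add: nat_pow_def dual_group_def)
  then show ?case unfolding Suc by (simp only: power_Suc2)
qed

definition power_character :: "nat \<Rightarrow> (nat \<Rightarrow> 'a \<Rightarrow> complex) \<Rightarrow> (nat \<Rightarrow> 'a) \<Rightarrow> complex" where
  "power_character k \<psi> x = (\<Prod>i=1..k. \<psi> i (x i))"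

lemma power_character_mult:
  "power_character k (\<lambda>i x. \<psi> i x * \<phi> i x) x = power_character k \<psi> x * power_character k \<phi> x"
  by (simp add: power_character_def prod.distrib)

lemma power_character_add:
  assumes "\<And>i. i \<in> {1..k} \<Longrightarrow> \<psi> i \<in> carrier dual_group"
  shows "power_character k \<psi> (power_add k x y) = power_character k \<psi> x * power_character k \<psi> y"
  unfolding power_character_def power_add_def prod.distrib[symmetric]
  by (rule prod.cong) (simp_all add: dual_groupD(3)[OF assms])

lemma continuous_map_power_character:
  assumes "\<And>i. i \<in> {1..k} \<Longrightarrow> \<psi> i \<in> carrier dual_group"
  shows "continuous_map (power_space k) euclidean (power_character k \<psi>)"
  unfolding continuous_map_power_space power_character_def
proof (rule continuous_on_prod)
  fix i assume "i \<in> {1..k}"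
  then have "continuous_on UNIV (\<psi> i)" by (intro dual_groupD(1) assms)
  then show "continuous_on (\<Pi>\<^sub>E i\<in>{1..k}. UNIV) (\<lambda>x. \<psi> i (x i))"
    by (rule continuous_on_compose2[OF _ continuous_on_subset[OF continuous_on_product_coordinates]]) simp_all
qed

text \<open>Means are linear but not multiplicative, so inductions for convergence can only have
  characters and sums as cases. Closure under products, which Stone-Weierstrass asks for, is
  derived.\<close>

inductive trig_poly :: "nat \<Rightarrow> ((nat \<Rightarrow> 'a::topological_ab_group_add) \<Rightarrow> complex) \<Rightarrow> bool" for k where
  character: "(\<And>i. i \<in> {1..k} \<Longrightarrow> \<psi> i \<in> carrier dual_group) \<Longrightarrow> trig_poly k (\<lambda>x. c * power_character k \<psi> x)"
| add: "trig_poly k p \<Longrightarrow> trig_poly k q \<Longrightarrow> trig_poly k (\<lambda>x. p x + q x)"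

lemma trig_poly_const: "trig_poly k (\<lambda>_. c)"
  using trig_poly.character[of k "\<lambda>_ _. 1" c] by (simp add: dual_group_one power_character_def)

lemma trig_poly_mult:
  assumes p: "trig_poly k p" and q: "trig_poly k q"
  shows "trig_poly k (\<lambda>x. p x * q x)"
  using p
proof induction
  case (character \<psi> c)
  show ?case
    using q
  proof induction
    case (character \<phi> d)
    have "trig_poly k (\<lambda>x. (c * d) * power_character k (\<lambda>i x. \<psi> i x * \<phi> i x) x)"
      by (rule trig_poly.character) (use character \<open>\<And>i. i \<in> {1..k} \<Longrightarrow> \<psi> i \<in> _\<close> in \<open>simp add: dual_group_mult\<close>)
    then show ?case by (simp add: power_character_mult mult_ac)
  next
    case (add p q)
    then show ?case using trig_poly.add by (fastforce simp: distrib_left)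
  qed
next
  case (add p q)
  then show ?case using trig_poly.add by (fastforce simp: distrib_right)
qed

lemma trig_poly_cnj: "trig_poly k p \<Longrightarrow> trig_poly k (\<lambda>x. cnj (p x))"
proof (induction rule: trig_poly.induct)
  case (character \<psi> c)
  have "trig_poly k (\<lambda>x. cnj c * power_character k (\<lambda>i x. cnj (\<psi> i x)) x)"
    by (rule trig_poly.character) (simp add: dual_group_cnj character)
  then show ?case by (simp add: power_character_def)
next
  case (add p q)
  then show ?case using trig_poly.add by fastforce
qed

lemma trig_poly_Re_Im:
  assumes "trig_poly k p"
  shows "trig_poly k (\<lambda>x. complex_of_real (Re (p x)))" "trig_poly k (\<lambda>x. complex_of_real (Im (p x)))"
proof -
  have Re: "trig_poly k (\<lambda>x. complex_of_real (Re (q x)))" if "trig_poly k q" for q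
  proof -
    have "trig_poly k (\<lambda>x. 1 / 2 * (q x + cnj (q x)))"
      by (intro trig_poly_mult trig_poly_const trig_poly.add trig_poly_cnj that)
    then show ?thesis by (simp add: complex_add_cnj)
  qed
  from Re[OF assms] Re[OF trig_poly_mult[OF trig_poly_const[of k "- \<i>"] assms]]
  show "trig_poly k (\<lambda>x. complex_of_real (Re (p x)))" "trig_poly k (\<lambda>x. complex_of_real (Im (p x)))"
    by simp_all
qed

lemma continuous_map_trig_poly:
  assumes "trig_poly k p"
  shows "continuous_map (power_space k) euclidean p"
  using assms
proof induction
  case (character \<psi> c)
  then show ?case
    using continuous_map_power_character[of k \<psi>]
    unfolding continuous_map_power_space by (intro continuous_on_mult continuous_on_const) blast
next
  case (add p q)
  then show ?case
    unfolding continuous_map_power_space by (intro continuous_on_add)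
qed

text \<open>Stone-Weierstrass is used in its real form, for the real functions that are
  trigonometric polynomials when read as complex ones. Two points are separated by the real or the
  imaginary part of a character of a single coordinate. The real and imaginary parts of
  \<open>f\<close> are approximated within \<open>e / 2\<close> each.\<close>

lemma trig_poly_dense:
  fixes \<gamma> :: "'a::{topological_ab_group_add, t2_space}" and f :: "(nat \<Rightarrow> 'a) \<Rightarrow> complex"
  assumes \<gamma>: "compact_monothetic \<gamma>" and f: "continuous_map (power_space k) euclidean f" and e: "0 < e"
  obtains p where "trig_poly k p" "\<And>x. x \<in> topspace (power_space k) \<Longrightarrow> norm (f x - p x) < e"
proof -
  let ?S = "topspace (power_space k) :: (nat \<Rightarrow> 'a) set"
  have "compact (UNIV :: 'a set)"
    using \<gamma> by (simp add: compact_monothetic_def)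
  then have "compact_space (top_of_set ?S)"
    unfolding topspace_power_space power_space_eq_top_of_set[symmetric] by (rule compact_space_power_space)
  then have "compactin euclidean ?S"
    by (intro compactin_subspace[THEN iffD2] conjI) (simp_all only: topspace_euclidean subset_UNIV)
  then have S: "compact ?S"
    by (rule compactin_euclidean_iff[THEN iffD1])
  have separate: "\<exists>h. trig_poly k (\<lambda>x. complex_of_real (h x)) \<and> h x \<noteq> h y"
    if xy: "x \<in> ?S" "y \<in> ?S" "x \<noteq> y" for x y
  proof -
      obtain i where i: "i \<in> {1..k}" "x i \<noteq> y i"
        using PiE_ext[of x "{1..k}" "\<lambda>_. UNIV" y] xy unfolding topspace_power_space by blast
      then obtain \<psi> :: "'a \<Rightarrow> complex" where \<psi>: "\<psi> \<in> carrier dual_group" "\<psi> (x i - y i) \<noteq> 1"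
        using characters_separate_points[OF \<gamma>, of "x i - y i"] by auto
      define \<Psi> where "\<Psi> j = (if j = i then \<psi> else (\<lambda>_. 1))" for j
      have eq: "power_character k \<Psi> z = \<psi> (z i)" for z
      proof -
        have "power_character k \<Psi> z = (\<Prod>j=1..k. if j = i then \<psi> (z j) else 1)"
          unfolding power_character_def by (rule prod.cong) (auto simp: \<Psi>_def)
        then show ?thesis using i(1) by (simp add: prod.delta)
      qed
      have p: "trig_poly k (\<lambda>x. 1 * power_character k \<Psi> x)"
        by (rule trig_poly.character) (simp add: \<Psi>_def \<psi>(1) dual_group_one)
      have "\<psi> (x i) \<noteq> \<psi> (y i)"
      proof
        assume "\<psi> (x i) = \<psi> (y i)"
        moreover have "\<psi> (x i) = \<psi> (x i - y i) * \<psi> (y i)"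
          using dual_groupD(3)[OF \<psi>(1), of "x i - y i" "y i"] by simp
        moreover have "\<psi> (y i) \<noteq> 0"
          using dual_groupD(2)[OF \<psi>(1), of "y i"] by auto
        ultimately show False using \<psi>(2) by simp
      qed
      then have "Re (power_character k \<Psi> x) \<noteq> Re (power_character k \<Psi> y)
          \<or> Im (power_character k \<Psi> x) \<noteq> Im (power_character k \<Psi> y)"
        by (simp add: eq complex_eq_iff)
      then show ?thesis
        using trig_poly_Re_Im[OF p, unfolded mult_1_left]
        by (elim disjE) (rule exI[of _ "\<lambda>x. Re (power_character k \<Psi> x)"] exI[of _ "\<lambda>x. Im (power_character k \<Psi> x)"], blast)+
  qed
  have real: "\<exists>p. trig_poly k (\<lambda>x. complex_of_real (p x)) \<and> (\<forall>x\<in>?S. \<bar>g x - p x\<bar> < e / 2)"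
    if g: "continuous_on ?S g" for g
  proof -
    let ?P = "\<lambda>h. trig_poly k (\<lambda>x. complex_of_real (h (Sequence x)))"
    have seq: "continuous_on (Sequence ` ?S) (\<lambda>x. h (sequence_nth x))" if "continuous_on ?S h" for h :: "_ \<Rightarrow> real"
      by (rule continuous_on_compose2[OF that continuous_on_sequence_nth]) (auto simp: Sequence_inverse)
    have "\<exists>p. ?P p \<and> (\<forall>x\<in>Sequence ` ?S. \<bar>g (sequence_nth x) - p x\<bar> < e / 2)"
    proof (rule Stone_Weierstrass_HOL)
      show "compact (Sequence ` ?S)"
        by (rule compact_continuous_image[OF continuous_on_Sequence S])
      show "continuous_on (Sequence ` ?S) h" if "?P h" for h
      proof -
        have "continuous_on ?S (\<lambda>x. complex_of_real (h (Sequence x)))"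
          using continuous_map_trig_poly[OF that]
          by (simp add: continuous_map_power_space topspace_power_space)
        from continuous_on_Re[OF this] have "continuous_on ?S (\<lambda>x. h (Sequence x))"
          by simp
        from seq[OF this] show ?thesis by (simp add: sequence_nth_inverse)
      qed
      show "\<exists>h. ?P h \<and> h x \<noteq> h y" if xy: "x \<in> Sequence ` ?S \<and> y \<in> Sequence ` ?S \<and> x \<noteq> y" for x y
      proof -
        have "sequence_nth x \<in> ?S" "sequence_nth y \<in> ?S" "sequence_nth x \<noteq> sequence_nth y"
          using xy by (auto simp: Sequence_inverse)
        from separate[OF this] obtain h
          where "trig_poly k (\<lambda>x. complex_of_real (h x))" "h (sequence_nth x) \<noteq> h (sequence_nth y)"
          by auto
        then show ?thesis
          by (intro exI[of _ "\<lambda>x. h (sequence_nth x)"]) (simp add: Sequence_inverse)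
      qed
      show "?P (\<lambda>x. f x + g x)" if "?P f \<and> ?P g" for f g
        using that trig_poly.add by fastforce
      show "?P (\<lambda>x. f x * g x)" if "?P f \<and> ?P g" for f g
        using that trig_poly_mult by fastforce
    qed (use e seq[OF g] trig_poly_const in auto)
    then show ?thesis by (auto simp: Sequence_inverse)
  qed
  have "continuous_on ?S f"
    using f by (simp add: continuous_map_power_space topspace_power_space)
  then have Re: "continuous_on ?S (\<lambda>x. Re (f x))" and Im: "continuous_on ?S (\<lambda>x. Im (f x))"
    by (rule continuous_on_Re continuous_on_Im)+
  from real[OF Re] obtain p where
    p: "trig_poly k (\<lambda>x. complex_of_real (p x))" "\<And>x. x \<in> ?S \<Longrightarrow> \<bar>Re (f x) - p x\<bar> < e / 2"
    by blast
  from real[OF Im] obtain q where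
    q: "trig_poly k (\<lambda>x. complex_of_real (q x))" "\<And>x. x \<in> ?S \<Longrightarrow> \<bar>Im (f x) - q x\<bar> < e / 2"
    by blast
  show thesis
  proof (rule that)
    show "trig_poly k (\<lambda>x. complex_of_real (p x) + \<i> * complex_of_real (q x))"
      by (intro trig_poly.add trig_poly_mult trig_poly_const p q)
    fix x assume x: "x \<in> ?S"
    have "norm (f x - (complex_of_real (p x) + \<i> * complex_of_real (q x)))
        \<le> \<bar>Re (f x) - p x\<bar> + \<bar>Im (f x) - q x\<bar>"
      by (rule order.trans[OF cmod_le]) simp
    also have "\<dots> < e" using p(2)[OF x] q(2)[OF x] by simp
    finally show "norm (f x - (complex_of_real (p x) + \<i> * complex_of_real (q x))) < e" .
  qed
qed

section \<open>Orbit averages\<close>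

lemma milnes_map_in_topspace: "milnes_map k \<gamma> x \<in> topspace (power_space k)"
  by (simp add: milnes_map_def topspace_power_space)

lemma milnes_iterate_in_topspace:
  "x \<in> topspace (power_space k) \<Longrightarrow> (milnes_map k \<gamma> ^^ n) x \<in> topspace (power_space k)"
  by (cases n) (simp_all add: milnes_map_in_topspace)

text \<open>One step of the map multiplies a character of \<open>G\<^sup>r\<close> by a character of \<open>G\<^bsup>r - 1\<^esup>\<close>, so that its
  values along an orbit form a polynomial phase whose rotation is a power of \<open>\<psi> r \<gamma>\<close>.\<close>
lemma milnes_polyphase:
  assumes "r < k" and "\<And>i. i \<in> {1..Suc r} \<Longrightarrow> \<psi> i \<in> carrier dual_group" and "norm c = 1"
  shows "\<exists>m\<ge>1. polyphase (Suc r) (\<psi> (Suc r) \<gamma> ^ m)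
    (\<lambda>n. c * (\<Prod>i=1..Suc r. \<psi> i ((milnes_map k \<gamma> ^^ n) x i)))"
  using assms
proof (induction r arbitrary: \<psi> c)
  case 0
  define z where "z n = (milnes_map k \<gamma> ^^ n) x (Suc 0)" for n
  have \<psi>: "\<psi> (Suc 0) \<in> carrier dual_group" using 0 by simp
  have z: "z (Suc n) = nat_multiple k \<gamma> + z n" for n
    using 0(1) by (simp add: z_def milnes_map_def)
  have nz: "u * cnj u = 1" if "norm u = 1" for u :: complex
    using that by (simp add: complex_norm_square[symmetric])
  have "c * \<psi> (Suc 0) (z (Suc n)) * cnj (c * \<psi> (Suc 0) (z n)) = \<psi> (Suc 0) \<gamma> ^ k" for n
  proof -
    have "c * \<psi> (Suc 0) (z (Suc n)) * cnj (c * \<psi> (Suc 0) (z n))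
        = \<psi> (Suc 0) \<gamma> ^ k * (c * cnj c) * (\<psi> (Suc 0) (z n) * cnj (\<psi> (Suc 0) (z n)))"
      by (simp add: z dual_groupD[OF \<psi>] mult_ac)
    then show ?thesis using nz[OF 0(3)] nz[OF dual_groupD(2)[OF \<psi>]] by simp
  qed
  moreover have "norm (c * \<psi> (Suc 0) (z n)) = 1" "norm (\<psi> (Suc 0) \<gamma> ^ k) = 1" for n
    unfolding norm_mult norm_power dual_groupD(2)[OF \<psi>] 0(3) by simp_all
  ultimately have "polyphase (Suc 0) (\<psi> (Suc 0) \<gamma> ^ k) (\<lambda>n. c * \<psi> (Suc 0) (z n))"
    unfolding polyphase.simps by blast
  then show ?case
    using 0(1) by (intro exI[of _ k]) (simp add: z_def)
next
  case (Suc r)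
  let ?z = "\<lambda>n. (milnes_map k \<gamma> ^^ n) x"
  let ?R = "Suc (Suc r)"
  define \<phi> where "\<phi> j u = (\<Prod>i\<in>{j<..?R}. \<psi> i u ^ ((k - j) choose (i - j)))" for j u
  define d where "d = (\<Prod>i=1..?R. \<psi> i \<gamma> ^ (k choose i))"
  have \<psi>: "\<psi> i \<in> carrier dual_group" if "i \<in> {1..?R}" for i using Suc.prems that by blast
  have nz: "u * cnj u = 1" if "norm u = 1" for u :: complex
    using that by (simp add: complex_norm_square[symmetric])
  have step: "\<psi> i (?z (Suc n) i) * cnj (\<psi> i (?z n i))
      = \<psi> i \<gamma> ^ (k choose i) * (\<Prod>j\<in>{1..<i}. \<psi> i (?z n j) ^ ((k - j) choose (i - j)))"
    if i: "i \<in> {1..?R}" for i n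
  proof -
    have "?z (Suc n) i = nat_multiple (k choose i) \<gamma>
        + (\<Sum>j=1..i. nat_multiple ((k - j) choose (i - j)) (?z n j))"
      using i Suc.prems(1) by (simp add: milnes_map_def)
    moreover have "{1..i} = insert i {1..<i}" using i by auto
    ultimately have "\<psi> i (?z (Suc n) i) = \<psi> i \<gamma> ^ (k choose i)
        * (\<psi> i (?z n i) * (\<Prod>j\<in>{1..<i}. \<psi> i (?z n j) ^ ((k - j) choose (i - j))))"
      by (simp add: dual_groupD[OF \<psi>[OF i]] dual_group_sum[OF \<psi>[OF i]])
    then have "\<psi> i (?z (Suc n) i) * cnj (\<psi> i (?z n i)) = (\<psi> i (?z n i) * cnj (\<psi> i (?z n i)))
        * (\<psi> i \<gamma> ^ (k choose i) * (\<Prod>j\<in>{1..<i}. \<psi> i (?z n j) ^ ((k - j) choose (i - j))))"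
      by (simp add: mult_ac)
    then show ?thesis using nz[OF dual_groupD(2)[OF \<psi>[OF i]]] by simp
  qed
  have diff: "c * (\<Prod>i=1..?R. \<psi> i (?z (Suc n) i)) * cnj (c * (\<Prod>i=1..?R. \<psi> i (?z n i)))
      = d * (\<Prod>j=1..Suc r. \<phi> j (?z n j))" for n
  proof -
    have "c * (\<Prod>i=1..?R. \<psi> i (?z (Suc n) i)) * cnj (c * (\<Prod>i=1..?R. \<psi> i (?z n i)))
        = (c * cnj c) * (\<Prod>i=1..?R. \<psi> i (?z (Suc n) i) * cnj (\<psi> i (?z n i)))"
      unfolding prod.distrib by (simp add: mult_ac del: prod.cl_ivl_Suc)
    also have "\<dots> = (\<Prod>i=1..?R. \<psi> i \<gamma> ^ (k choose i)
        * (\<Prod>j\<in>{1..<i}. \<psi> i (?z n j) ^ ((k - j) choose (i - j))))"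
      using nz[OF Suc.prems(3)] step by (simp del: prod.cl_ivl_Suc funpow.simps)
    also have "\<dots> = d * (\<Prod>i=1..?R. \<Prod>j\<in>{1..<i}. \<psi> i (?z n j) ^ ((k - j) choose (i - j)))"
      unfolding prod.distrib d_def ..
    also have "(\<Prod>i=1..?R. \<Prod>j\<in>{1..<i}. \<psi> i (?z n j) ^ ((k - j) choose (i - j)))
        = (\<Prod>i=1..?R. \<Prod>j | j \<in> {1..Suc r} \<and> j < i. \<psi> i (?z n j) ^ ((k - j) choose (i - j)))"
      by (intro prod.cong refl) auto
    also have "\<dots> = (\<Prod>j=1..Suc r. \<Prod>i | i \<in> {1..?R} \<and> j < i. \<psi> i (?z n j) ^ ((k - j) choose (i - j)))"
      by (rule prod.swap_restrict) auto
    also have "\<dots> = (\<Prod>j=1..Suc r. \<phi> j (?z n j))"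
      unfolding \<phi>_def by (intro prod.cong refl) auto
    finally show ?thesis .
  qed
  have \<phi>: "\<phi> j \<in> carrier dual_group" if "j \<in> {1..Suc r}" for j
    unfolding \<phi>_def[abs_def] by (intro dual_group_prod dual_group_power \<psi>) auto
  have d: "norm d = 1"
    unfolding d_def prod_norm[symmetric] norm_power
    by (intro prod.neutral ballI) (simp add: dual_groupD(2)[OF \<psi>])
  obtain m where m: "m \<ge> 1"
    "polyphase (Suc r) (\<phi> (Suc r) \<gamma> ^ m) (\<lambda>n. d * (\<Prod>j=1..Suc r. \<phi> j (?z n j)))"
    using Suc.IH[of \<phi> d] \<phi> d Suc.prems(1) by auto
  \<comment> \<open>Only \<open>i = ?R\<close> reaches coordinate \<open>Suc r\<close>, with
    exponent \<open>(k - Suc r) choose 1\<close>, which is positive because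
    \<open>Suc r < k\<close>. Over the whole induction these exponents multiply to a falling
    factorial of \<open>k\<close>.\<close>
  have "{Suc r<..?R} = {?R}" by auto
  then have \<phi>\<gamma>: "\<phi> (Suc r) \<gamma> ^ m = \<psi> ?R \<gamma> ^ ((k - Suc r) * m)"
    by (simp add: \<phi>_def power_mult)
  have "norm (c * (\<Prod>i=1..?R. \<psi> i (?z n i))) = 1" for n
    unfolding norm_mult prod_norm[symmetric] using Suc.prems(3)
    by (simp add: dual_groupD(2)[OF \<psi>] del: prod.cl_ivl_Suc)
  with m(2) have "polyphase ?R (\<psi> ?R \<gamma> ^ ((k - Suc r) * m)) (\<lambda>n. c * (\<Prod>i=1..?R. \<psi> i (?z n i)))"
    unfolding polyphase.simps(2)[of "Suc r"] diff \<phi>\<gamma> by blast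
  moreover have "(k - Suc r) * m \<ge> 1" using m(1) Suc.prems(1) by simp
  ultimately show ?case by blast
qed

lemma character_eq_one:
  fixes \<gamma> :: "'a::{topological_ab_group_add, t2_space}"
  assumes \<gamma>: "compact_monothetic \<gamma>" and \<psi>: "\<psi> \<in> carrier (dual_group :: ('a \<Rightarrow> complex) monoid)" and "\<psi> \<gamma> = 1"
  shows "\<psi> = (\<lambda>_. 1)"
proof
  fix x
  have "x \<in> {x. \<psi> x = 1}"
  proof (rule dense_subgroup_induct[of \<gamma>])
    show "closed {x. \<psi> x = 1}"
      by (intro closed_Collect_eq dual_groupD(1)[OF \<psi>] continuous_on_const)
    show "y - z \<in> {x. \<psi> x = 1}" if "y \<in> {x. \<psi> x = 1}" "z \<in> {x. \<psi> x = 1}" for y z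
      using that dual_groupD(3)[OF \<psi>, of y "- z"] dual_groupD(5)[OF \<psi>, of z] by simp
  qed (use assms dual_groupD(4)[OF \<psi>] in \<open>simp_all add: compact_monothetic_def\<close>)
  then show "\<psi> x = 1" by simp
qed

text \<open>The last non-trivial coordinate \<open>r\<close> carries the rotation. If a power of
  \<open>\<psi> r \<gamma>\<close> with positive exponent were 1, the same power of
  \<open>\<psi> r\<close> would be trivial on a dense subgroup, hence everywhere, and
  \<open>\<psi> r\<close> would have finite order.\<close>

lemma milnes_character_mean:
  fixes \<gamma> :: "'a::{topological_ab_group_add, t2_space}"
  assumes \<gamma>: "compact_monothetic \<gamma>"
    and tf: "no_nontrivial_finite_order (dual_group :: ('a \<Rightarrow> complex) monoid)"
    and \<psi>: "\<And>i. i \<in> {1..k} \<Longrightarrow> \<psi> i \<in> carrier dual_group"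
    and nt: "\<exists>i\<in>{1..k}. \<psi> i \<noteq> (\<lambda>_. 1)"
  shows "mean_tends (\<lambda>n. power_character k \<psi> ((milnes_map k \<gamma> ^^ n) x)) 0"
proof -
  let ?I = "{i \<in> {1..k}. \<psi> i \<noteq> (\<lambda>_. 1)}"
  define r where "r = Max ?I"
  have fin: "finite ?I" "?I \<noteq> {}" using nt by auto
  have r: "r \<in> {1..k}" "\<psi> r \<noteq> (\<lambda>_. 1)"
    using Max_in[OF fin] unfolding r_def[symmetric] by auto
  have max: "\<psi> i = (\<lambda>_. 1)" if "i \<in> {1..k}" "r < i" for i
    using Max_ge[OF fin(1), of i] that unfolding r_def[symmetric] by fastforce
  obtain d where d: "r = Suc d" using r(1) by (cases r) auto
  have eq: "power_character k \<psi> z = 1 * (\<Prod>i=1..Suc d. \<psi> i (z i))" for z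
    unfolding power_character_def mult_1_left
    using r(1) max by (intro prod.mono_neutral_right) (auto simp: d)
  obtain m where m: "m \<ge> 1"
    "polyphase (Suc d) (\<psi> r \<gamma> ^ m) (\<lambda>n. power_character k \<psi> ((milnes_map k \<gamma> ^^ n) x))"
    using milnes_polyphase[of d k \<psi> 1 \<gamma> x] r(1) \<psi> unfolding eq d by auto
  show ?thesis
  proof (rule Weyl_equidistribution[OF m(2)])
    fix q :: nat assume q: "1 \<le> q"
    show "(\<psi> r \<gamma> ^ m) ^ q \<noteq> 1"
    proof
      assume "(\<psi> r \<gamma> ^ m) ^ q = 1"
      then have "(\<lambda>x. \<psi> r x ^ (m * q)) = (\<lambda>_. 1)"
        using \<psi>[OF r(1)] by (intro character_eq_one[OF \<gamma>] dual_group_power) (simp_all add: power_mult)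
      then have "\<psi> r [^]\<^bsub>dual_group\<^esub> (m * q) = \<one>\<^bsub>dual_group\<^esub>"
        by (simp only: dual_group_nat_pow dual_group_one_eq)
      moreover have "m * q \<ge> 1" using m(1) q by simp
      ultimately have "\<psi> r = \<one>\<^bsub>dual_group\<^esub>"
        using tf \<psi>[OF r(1)] unfolding no_nontrivial_finite_order_def by blast
      then show False using r(2) by (simp only: dual_group_one_eq)
    qed
  qed
qed

text \<open>For given \<open>e\<close> the approximate value is chosen before the functional, so the
  limits over all of \<open>I\<close> lie within \<open>e\<close> of one number, for every
  \<open>e\<close>, and coincide. Admitting a set of sequences of functionals lets averages of
  different kinds share one limit.\<close>

lemma common_limit_of_dense:
  fixes I :: "(nat \<Rightarrow> ('b \<Rightarrow> complex) \<Rightarrow> complex) set"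
  assumes diff: "\<And>\<Lambda> N f g. \<Lambda> \<in> I \<Longrightarrow> continuous_map X euclidean f \<Longrightarrow> continuous_map X euclidean g
      \<Longrightarrow> \<Lambda> N (\<lambda>x. f x - g x) = \<Lambda> N f - \<Lambda> N g"
    and bound: "\<And>\<Lambda> N f e. \<Lambda> \<in> I \<Longrightarrow> continuous_map X euclidean f
      \<Longrightarrow> (\<And>x. x \<in> topspace X \<Longrightarrow> norm (f x) \<le> e) \<Longrightarrow> 0 \<le> e \<Longrightarrow> norm (\<Lambda> N f) \<le> e"
    and f: "continuous_map X euclidean f"
    and dense: "\<And>e. 0 < e \<Longrightarrow> \<exists>p. continuous_map X euclidean p \<and> (\<forall>x\<in>topspace X. norm (f x - p x) < e)
      \<and> (\<exists>c. \<forall>\<Lambda>\<in>I. (\<lambda>N. \<Lambda> N p) \<longlonglongrightarrow> c)"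
  shows "\<exists>c. \<forall>\<Lambda>\<in>I. (\<lambda>N. \<Lambda> N f) \<longlonglongrightarrow> c"
proof -
  have "\<exists>c. \<forall>\<Lambda>\<in>I. \<forall>\<^sub>F N in sequentially. norm (\<Lambda> N f - c) \<le> e" if e: "0 < e" for e
  proof -
    obtain p c where p: "continuous_map X euclidean p" "\<And>x. x \<in> topspace X \<Longrightarrow> norm (f x - p x) < e / 2"
      and c: "\<And>\<Lambda>. \<Lambda> \<in> I \<Longrightarrow> (\<lambda>N. \<Lambda> N p) \<longlonglongrightarrow> c"
      using dense[of "e / 2"] e by auto
    have "\<forall>\<^sub>F N in sequentially. norm (\<Lambda> N f - c) \<le> e" if \<Lambda>: "\<Lambda> \<in> I" for \<Lambda>
    proof -
      have "\<forall>\<^sub>F N in sequentially. dist (\<Lambda> N p) c < e / 2"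
        using c[OF \<Lambda>] e by (intro tendstoD) auto
      then show ?thesis
      proof eventually_elim
        case (elim N)
        have "continuous_map X euclidean (\<lambda>x. f x - p x)"
          using f p(1) by (intro continuous_intros)
        then have "norm (\<Lambda> N f - \<Lambda> N p) \<le> e / 2"
          unfolding diff[OF \<Lambda> f p(1), symmetric]
          using p(2) e by (intro bound[OF \<Lambda>]) (auto intro: less_imp_le)
        then show ?case
          using elim norm_triangle_ineq[of "\<Lambda> N f - \<Lambda> N p" "\<Lambda> N p - c"] by (simp add: dist_norm)
      qed
    qed
    then show ?thesis by blast
  qed
  then obtain c where c: "\<And>e \<Lambda>. 0 < e \<Longrightarrow> \<Lambda> \<in> I \<Longrightarrow> \<forall>\<^sub>F N in sequentially. norm (\<Lambda> N f - c e) \<le> e"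
    by metis
  have conv: "\<exists>l. (\<lambda>N. \<Lambda> N f) \<longlonglongrightarrow> l \<and> (\<forall>e>0. norm (l - c e) \<le> e)" if \<Lambda>: "\<Lambda> \<in> I" for \<Lambda>
  proof -
    have "Cauchy (\<lambda>N. \<Lambda> N f)"
    proof (rule metric_CauchyI)
      fix e :: real assume e: "0 < e"
      have "\<forall>\<^sub>F N in sequentially. norm (\<Lambda> N f - c (e / 4)) \<le> e / 4"
        by (rule c) (use e \<Lambda> in auto)
      then obtain N0 where N0: "\<And>N. N \<ge> N0 \<Longrightarrow> norm (\<Lambda> N f - c (e / 4)) \<le> e / 4"
        unfolding eventually_sequentially by blast
      show "\<exists>M. \<forall>m\<ge>M. \<forall>n\<ge>M. dist (\<Lambda> m f) (\<Lambda> n f) < e"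
      proof (intro exI allI impI)
        fix m n assume "N0 \<le> m" "N0 \<le> n"
        then show "dist (\<Lambda> m f) (\<Lambda> n f) < e"
          using N0[of m] N0[of n] dist_triangle2[of "\<Lambda> m f" "\<Lambda> n f" "c (e / 4)"] e by (simp add: dist_norm)
      qed
    qed
    then obtain l where l: "(\<lambda>N. \<Lambda> N f) \<longlonglongrightarrow> l"
      using Cauchy_convergent convergent_def by blast
    have "norm (l - c e) \<le> e" if "0 < e" for e
      by (rule tendsto_upperbound[OF tendsto_norm[OF tendsto_diff[OF l tendsto_const]] c[OF that \<Lambda>]]) simp
    with l show ?thesis by blast
  qed
  have unique: "l = l'" if "\<forall>e>0. norm (l - c e) \<le> e" "\<forall>e>0. norm (l' - c e) \<le> e" for l l'
  proof -
    have "dist l l' \<le> 0 + e" if "0 < e" for e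
    proof -
      have "norm (l - c (e / 2)) \<le> e / 2" "norm (l' - c (e / 2)) \<le> e / 2"
        using \<open>\<forall>e>0. norm (l - c e) \<le> e\<close>[rule_format, of "e / 2"]
          \<open>\<forall>e>0. norm (l' - c e) \<le> e\<close>[rule_format, of "e / 2"] that by simp_all
      then show ?thesis
        using dist_triangle2[of l l' "c (e / 2)"] by (simp add: dist_norm)
    qed
    then have "dist l l' \<le> 0" by (rule field_le_epsilon)
    then show ?thesis by simp
  qed
  show ?thesis
  proof (cases "I = {}")
    case False
    then obtain \<Lambda> where "\<Lambda> \<in> I" by blast
    from conv[OF this] obtain l where l: "\<forall>e>0. norm (l - c e) \<le> e" by blast
    have "(\<lambda>N. \<Lambda> N f) \<longlonglongrightarrow> l" if "\<Lambda> \<in> I" for \<Lambda>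
      using conv[OF that] unique[OF _ l] by metis
    then show ?thesis by blast
  qed simp
qed

lemma power_add_in_topspace: "power_add k x y \<in> topspace (power_space k)"
  by (simp add: power_add_def topspace_power_space)

lemma power_add_assoc: "power_add k x (power_add k y z) = power_add k (power_add k x y) (z :: nat \<Rightarrow> 'a::ab_group_add)"
  by (rule ext) (simp add: power_add_def add.assoc)

lemma power_add_zero:
  fixes x :: "nat \<Rightarrow> 'a::topological_ab_group_add"
  assumes "x \<in> topspace (power_space k)"
  shows "power_add k (\<lambda>i\<in>{1..k}. 0) x = x"
proof
  fix i show "power_add k (\<lambda>i\<in>{1..k}. 0) x i = x i"
    using PiE_arb[OF assms[unfolded topspace_power_space], of i] by (cases "i \<in> {1..k}") (auto simp: power_add_def)
qed

lemma continuous_map_power_add: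
  fixes g :: "nat \<Rightarrow> 'a::topological_ab_group_add"
  shows "continuous_map (power_space k) (power_space k) (power_add k g)"
proof -
  have "continuous_map (power_space k) euclidean (\<lambda>x. power_add k g x i)" if "i \<in> {1..k}" for i
    unfolding continuous_map_power_space power_add_def using that
    by (simp, intro continuous_on_add continuous_on_const continuous_on_subset[OF continuous_on_product_coordinates]) auto
  then have "continuous_map (power_space k) (product_topology (\<lambda>_. euclidean) {1..k}) (power_add k g)"
    unfolding continuous_map_componentwise by (auto simp: power_add_def)
  then show ?thesis by (simp add: power_space_def)
qed

lemma homeomorphic_maps_power_add:
  fixes g :: "nat \<Rightarrow> 'a::topological_ab_group_add"
  shows "homeomorphic_maps (power_space k) (power_space k) (power_add k g) (power_add k (\<lambda>i\<in>{1..k}. - g i))"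
proof -
  have "power_add k (power_add k (\<lambda>i\<in>{1..k}. - g i) g) x = x"
    "power_add k (power_add k g (\<lambda>i\<in>{1..k}. - g i)) x = x" if "x \<in> topspace (power_space k)" for x
    using power_add_zero[OF that] by (simp_all add: power_add_def restrict_def cong: if_cong)
  then show ?thesis
    by (simp add: homeomorphic_maps_def continuous_map_power_add power_add_assoc)
qed

lemma nontrivial_power_character:
  fixes \<psi> :: "nat \<Rightarrow> 'a::topological_ab_group_add \<Rightarrow> complex"
  assumes \<psi>: "\<And>i. i \<in> {1..k} \<Longrightarrow> \<psi> i \<in> carrier dual_group" and i: "i \<in> {1..k}" "\<psi> i \<noteq> (\<lambda>_. 1)"
  obtains g where "g \<in> topspace (power_space k)" "power_character k \<psi> g \<noteq> 1"
proof -
  obtain t where t: "\<psi> i t \<noteq> 1" using i(2) by auto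
  define g where "g = (\<lambda>j\<in>{1..k}. if j = i then t else 0)"
  have "power_character k \<psi> g = (\<Prod>j=1..k. if j = i then \<psi> i t else 1)"
    unfolding power_character_def by (rule prod.cong) (auto simp: g_def dual_groupD(4)[OF \<psi>])
  also have "\<dots> = \<psi> i t" using i(1) by (simp add: prod.delta)
  finally have "power_character k \<psi> g = \<psi> i t" .
  moreover have "g \<in> topspace (power_space k)"
    unfolding g_def topspace_power_space by (rule restrict_PiE_iff[THEN iffD2]) simp
  ultimately show thesis using that t by metis
qed

lemma milnes_means:
  fixes \<gamma> :: "'a::{topological_ab_group_add, t2_space}" and f :: "(nat \<Rightarrow> 'a) \<Rightarrow> complex"
  assumes \<gamma>: "compact_monothetic \<gamma>"
    and tf: "no_nontrivial_finite_order (dual_group :: ('a \<Rightarrow> complex) monoid)"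
    and f: "continuous_map (power_space k) euclidean f"
  obtains c where
    "\<And>g x. x \<in> topspace (power_space k) \<Longrightarrow> mean_tends (\<lambda>n. f (power_add k g ((milnes_map k \<gamma> ^^ n) x))) c"
    "\<And>\<nu>. normalized_haar (power_space k) (power_add k) \<nu> \<Longrightarrow> (\<integral>x. f x \<partial>\<nu>) = c"
proof -
  let ?X = "power_space k :: (nat \<Rightarrow> 'a) topology"
  let ?T = "milnes_map k \<gamma>"
  have cpt: "compact_space ?X"
    using \<gamma> by (simp add: compact_monothetic_def compact_space_power_space)
  define avg where "avg g x N f = (\<Sum>n<N. f (power_add k g ((?T ^^ n) x))) / of_nat N"
    for g x :: "nat \<Rightarrow> 'a" and N and f :: "(nat \<Rightarrow> 'a) \<Rightarrow> complex"
  \<comment> \<open>Haar integrals enter as constant sequences beside the translated orbit averages,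
    so that one density argument compares all of them. Existence of a Haar measure is not
    presupposed: the second set may be empty at this stage.\<close>
  define I where "I = {avg g x | g x. x \<in> topspace ?X}
    \<union> {\<lambda>N f. \<integral>x. f x \<partial>\<nu> | \<nu>. normalized_haar ?X (power_add k) \<nu>}"
  have regular: "regular_borel_prob ?X \<nu>" if "normalized_haar ?X (power_add k) \<nu>" for \<nu>
    using that by (simp add: normalized_haar_def)
  have int: "integrable \<nu> f"
    if "normalized_haar ?X (power_add k) \<nu>" "continuous_map ?X euclidean f" for \<nu> and f :: "_ \<Rightarrow> complex"
    by (rule regular_borel_prob_integrable[OF cpt regular[OF that(1)] that(2)])
  have trig: "\<exists>c. \<forall>\<Lambda>\<in>I. (\<lambda>N. \<Lambda> N p) \<longlonglongrightarrow> c" if "trig_poly k p" for p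
    using that
  proof induction
    case (character \<psi> c)
    have add: "power_character k \<psi> (power_add k g x) = power_character k \<psi> g * power_character k \<psi> x" for g x
      by (rule power_character_add) (rule character)
    have cont: "continuous_map ?X euclidean (power_character k \<psi>)"
      by (rule continuous_map_power_character) (rule character)
    show ?case
    proof (cases "\<exists>i\<in>{1..k}. \<psi> i \<noteq> (\<lambda>_. 1)")
      case True
      have "(\<lambda>N. \<Lambda> N (\<lambda>x. c * power_character k \<psi> x)) \<longlonglongrightarrow> 0" if "\<Lambda> \<in> I" for \<Lambda>
        using that unfolding I_def
      proof (elim UnE CollectE exE conjE)
        fix g x assume \<Lambda>: "\<Lambda> = avg g x"
        have "mean_tends (\<lambda>n. c * power_character k \<psi> g * power_character k \<psi> ((?T ^^ n) x)) (c * power_character k \<psi> g * 0)"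
          by (intro mean_tends_cmult milnes_character_mean[OF \<gamma> tf] character True)
        then show ?thesis
          by (simp add: mean_tends_def \<Lambda> avg_def add mult.assoc)
      next
        fix \<nu> assume \<Lambda>: "\<Lambda> = (\<lambda>N f. \<integral>x. f x \<partial>\<nu>)" and \<nu>: "normalized_haar ?X (power_add k) \<nu>"
        obtain g where g: "g \<in> topspace ?X" "power_character k \<psi> g \<noteq> 1"
          using True nontrivial_power_character[of k \<psi>] character by blast
        \<comment> \<open>Translation invariance reproduces the integral with a factor different
          from 1, so it is 0, the same value as the orbit means.\<close>
        have "(\<integral>x. power_character k \<psi> x \<partial>\<nu>) = (\<integral>x. power_character k \<psi> (power_add k g x) \<partial>\<nu>)"
          using \<nu> g(1) regular_borel_prob_measurable[OF regular[OF \<nu>] cont]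
          by (intro invariant_measure_integral[symmetric]) (auto simp: normalized_haar_def)
        also have "\<dots> = power_character k \<psi> g * (\<integral>x. power_character k \<psi> x \<partial>\<nu>)"
          by (simp add: add)
        finally have "(\<integral>x. power_character k \<psi> x \<partial>\<nu>) = 0"
          using g(2) by auto
        then show ?thesis by (simp add: \<Lambda>)
      qed
      then show ?thesis by blast
    next
      case False
      have "power_character k \<psi> x = 1" for x
        unfolding power_character_def by (rule prod.neutral) (use False in auto)
      moreover have "(\<lambda>N. \<Lambda> N (\<lambda>x. c)) \<longlonglongrightarrow> c" if "\<Lambda> \<in> I" for \<Lambda>
        using that unfolding I_def
      proof (elim UnE CollectE exE conjE)
        fix g x assume "\<Lambda> = avg g x"
        then show ?thesis
          using mean_tends_const[of c] by (simp only: avg_def mean_tends_def)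
      next
        fix \<nu> assume \<Lambda>: "\<Lambda> = (\<lambda>N f. \<integral>x. f x \<partial>\<nu>)" and \<nu>: "normalized_haar ?X (power_add k) \<nu>"
        interpret prob_space \<nu> using regular[OF \<nu>] by (simp add: regular_borel_prob_def)
        show ?thesis by (simp add: \<Lambda> prob_space)
      qed
      ultimately show ?thesis by auto
    qed
  next
    case (add p q)
    then obtain c d where cd: "\<And>\<Lambda>. \<Lambda> \<in> I \<Longrightarrow> (\<lambda>N. \<Lambda> N p) \<longlonglongrightarrow> c" "\<And>\<Lambda>. \<Lambda> \<in> I \<Longrightarrow> (\<lambda>N. \<Lambda> N q) \<longlonglongrightarrow> d"
      by blast
    have plus: "\<Lambda> N (\<lambda>x. p x + q x) = \<Lambda> N p + \<Lambda> N q" if "\<Lambda> \<in> I" for \<Lambda> N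
      using that int continuous_map_trig_poly[OF add.hyps(1)] continuous_map_trig_poly[OF add.hyps(2)]
      by (auto simp: I_def avg_def sum.distrib add_divide_distrib)
    have "(\<lambda>N. \<Lambda> N (\<lambda>x. p x + q x)) \<longlonglongrightarrow> c + d" if "\<Lambda> \<in> I" for \<Lambda>
      unfolding plus[OF that] by (intro tendsto_add cd that)
    then show ?case by blast
  qed
  have "\<exists>c. \<forall>\<Lambda>\<in>I. (\<lambda>N. \<Lambda> N f) \<longlonglongrightarrow> c"
  proof (rule common_limit_of_dense[where X = ?X])
    show "\<Lambda> N (\<lambda>x. f x - g x) = \<Lambda> N f - \<Lambda> N g"
      if "\<Lambda> \<in> I" "continuous_map ?X euclidean f" "continuous_map ?X euclidean g" for \<Lambda> N f g
      using that int by (auto simp: I_def avg_def sum_subtractf diff_divide_distrib)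
    show "norm (\<Lambda> N f) \<le> e"
      if \<Lambda>: "\<Lambda> \<in> I" and f: "continuous_map ?X euclidean f" and e: "\<And>x. x \<in> topspace ?X \<Longrightarrow> norm (f x) \<le> e" "0 \<le> e"
      for \<Lambda> N f e
      using \<Lambda> unfolding I_def
    proof (elim UnE CollectE exE conjE)
      fix g x assume \<Lambda>: "\<Lambda> = avg g x"
      have "norm (\<Sum>n<N. f (power_add k g ((?T ^^ n) x))) \<le> (\<Sum>n<N. e)"
        by (intro sum_norm_le e power_add_in_topspace)
      then show "norm (\<Lambda> N f) \<le> e"
        using e(2) by (cases "N = 0") (simp_all add: \<Lambda> avg_def norm_divide field_simps)
    next
      fix \<nu> assume \<Lambda>: "\<Lambda> = (\<lambda>N f. \<integral>x. f x \<partial>\<nu>)" and \<nu>: "normalized_haar ?X (power_add k) \<nu>"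
      interpret prob_space \<nu> using regular[OF \<nu>] by (simp add: regular_borel_prob_def)
      have "norm (\<integral>x. f x \<partial>\<nu>) \<le> (\<integral>x. norm (f x) \<partial>\<nu>)"
        by (rule integral_norm_bound)
      also have "\<dots> \<le> (\<integral>x. e \<partial>\<nu>)"
        using e(1) int[OF \<nu> f] regular[OF \<nu>] by (intro integral_mono) (auto simp: regular_borel_prob_def)
      also have "\<dots> = e" by (simp add: prob_space)
      finally show "norm (\<Lambda> N f) \<le> e" by (simp add: \<Lambda>)
    qed
    show "\<exists>p. continuous_map ?X euclidean p \<and> (\<forall>x\<in>topspace ?X. norm (f x - p x) < e)
      \<and> (\<exists>c. \<forall>\<Lambda>\<in>I. (\<lambda>N. \<Lambda> N p) \<longlonglongrightarrow> c)" if "0 < e" for e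
      using trig_poly_dense[OF \<gamma> f that] trig continuous_map_trig_poly by metis
  qed (rule f)
  then obtain c where c: "\<And>\<Lambda>. \<Lambda> \<in> I \<Longrightarrow> (\<lambda>N. \<Lambda> N f) \<longlonglongrightarrow> c" by blast
  show thesis
  proof (rule that)
    fix g x assume "x \<in> topspace ?X"
    then have "avg g x \<in> I" by (auto simp: I_def)
    from c[OF this] show "mean_tends (\<lambda>n. f (power_add k g ((?T ^^ n) x))) c"
      by (simp add: avg_def mean_tends_def)
  next
    fix \<nu> assume "normalized_haar ?X (power_add k) \<nu>"
    then have "(\<lambda>N f. \<integral>x. f x \<partial>\<nu>) \<in> I" by (auto simp: I_def)
    from c[OF this] show "(\<integral>x. f x \<partial>\<nu>) = c"
      using LIMSEQ_unique tendsto_const by blast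
  qed
qed

section \<open>Strict ergodicity\<close>

locale milnes =
  fixes k :: nat and \<gamma> :: "'a::{topological_ab_group_add, t2_space}"
  assumes \<gamma>: "compact_monothetic \<gamma>"
    and torsion_free: "no_nontrivial_finite_order (dual_group :: ('a \<Rightarrow> complex) monoid)"
begin

abbreviation X :: "(nat \<Rightarrow> 'a) topology" where "X \<equiv> power_space k"
abbreviation T :: "(nat \<Rightarrow> 'a) \<Rightarrow> (nat \<Rightarrow> 'a)" where "T \<equiv> milnes_map k \<gamma>"

definition origin :: "nat \<Rightarrow> 'a" where "origin = (\<lambda>i\<in>{1..k}. 0)"

text \<open>The starting point is arbitrary, since the limit is the same along every orbit; fixing
  \<open>origin\<close> makes \<open>L\<close> depend on \<open>f\<close> alone.\<close>

definition L :: "((nat \<Rightarrow> 'a) \<Rightarrow> real) \<Rightarrow> real" where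
  "L f = lim (\<lambda>N. (\<Sum>n<N. f ((T ^^ n) origin)) / N)"

lemma compact_X: "compact_space X" and Hausdorff_X: "Hausdorff_space X"
  using \<gamma> by (simp_all add: compact_monothetic_def compact_space_power_space Hausdorff_space_power_space)

lemma origin: "origin \<in> topspace X"
  unfolding origin_def topspace_power_space by (rule restrict_PiE_iff[THEN iffD2]) simp

lemma L_means:
  assumes f: "continuous_map X euclideanreal f"
  shows "x \<in> topspace X \<Longrightarrow> (\<lambda>N. (\<Sum>n<N. f (power_add k g ((T ^^ n) x))) / N) \<longlonglongrightarrow> L f"
    and "x \<in> topspace X \<Longrightarrow> (\<lambda>N. (\<Sum>n<N. f ((T ^^ n) x)) / N) \<longlonglongrightarrow> L f"
    and "normalized_haar X (power_add k) \<nu> \<Longrightarrow> (\<integral>x. f x \<partial>\<nu>) = L f"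
proof -
  let ?F = "\<lambda>x. complex_of_real (f x)"
  have F: "continuous_map X euclidean ?F"
    using f unfolding continuous_map_power_space by (rule continuous_on_of_real)
  obtain c where c: "\<And>g x. x \<in> topspace X \<Longrightarrow> mean_tends (\<lambda>n. ?F (power_add k g ((T ^^ n) x))) c"
    "\<And>\<nu>. normalized_haar X (power_add k) \<nu> \<Longrightarrow> (\<integral>x. ?F x \<partial>\<nu>) = c"
    using milnes_means[OF \<gamma> torsion_free F] by metis
  have g: "(\<lambda>N. (\<Sum>n<N. f (power_add k g ((T ^^ n) x))) / N) \<longlonglongrightarrow> Re c" if "x \<in> topspace X" for g x
    using tendsto_Re[OF c(1)[OF that, of g, unfolded mean_tends_def]] by (simp add: Re_divide_of_nat)
  have o: "(\<lambda>N. (\<Sum>n<N. f ((T ^^ n) x)) / N) \<longlonglongrightarrow> Re c" if "x \<in> topspace X" for x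
    using g[OF that, of "\<lambda>i\<in>{1..k}. 0"]
    by (simp only: power_add_zero[OF milnes_iterate_in_topspace[OF that]])
  have L: "L f = Re c"
    unfolding L_def by (rule limI[OF o[OF origin]])
  show "x \<in> topspace X \<Longrightarrow> (\<lambda>N. (\<Sum>n<N. f (power_add k g ((T ^^ n) x))) / N) \<longlonglongrightarrow> L f"
    unfolding L by (rule g)
  show "x \<in> topspace X \<Longrightarrow> (\<lambda>N. (\<Sum>n<N. f ((T ^^ n) x)) / N) \<longlonglongrightarrow> L f"
    unfolding L by (rule o)
  show "(\<integral>x. f x \<partial>\<nu>) = L f" if "normalized_haar X (power_add k) \<nu>"
  proof -
    have "complex_of_real (\<integral>x. f x \<partial>\<nu>) = c"
      using c(2)[OF that] by simp
    then show ?thesis unfolding L by (metis Re_complex_of_real)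
  qed
qed

sublocale L: positive_functional X L
proof
  show "L (\<lambda>x. f x + g x) = L f + L g"
    if f: "continuous_map X euclideanreal f" and g: "continuous_map X euclideanreal g" for f g
  proof (rule LIMSEQ_unique)
    show "(\<lambda>N. (\<Sum>n<N. f ((T ^^ n) origin) + g ((T ^^ n) origin)) / N) \<longlonglongrightarrow> L (\<lambda>x. f x + g x)"
      by (rule L_means(2)[OF _ origin]) (intro continuous_map_add f g)
    show "(\<lambda>N. (\<Sum>n<N. f ((T ^^ n) origin) + g ((T ^^ n) origin)) / N) \<longlonglongrightarrow> L f + L g"
      unfolding sum.distrib add_divide_distrib
      by (intro tendsto_add L_means(2)[OF f origin] L_means(2)[OF g origin])
  qed
  show "0 \<le> L f" if f: "continuous_map X euclideanreal f" and "\<And>x. x \<in> topspace X \<Longrightarrow> 0 \<le> f x" for f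
    by (rule LIMSEQ_le_const[OF L_means(2)[OF f origin]])
      (intro exI allI impI divide_nonneg_nonneg sum_nonneg that milnes_iterate_in_topspace origin; simp)
  show "L (\<lambda>_. c) = c" for c
  proof (rule LIMSEQ_unique[OF L_means(2)[OF _ origin]])
    show "(\<lambda>N. (\<Sum>n<N. c) / real N) \<longlonglongrightarrow> c"
      by (rule tendsto_eventually, rule eventually_sequentiallyI[of 1]) simp
  qed simp
qed (rule compact_X Hausdorff_X)+

lemma L_translate:
  assumes f: "continuous_map X euclideanreal f"
  shows "L (\<lambda>x. f (power_add k g x)) = L f"
proof (rule LIMSEQ_unique)
  have "continuous_map X euclideanreal (\<lambda>x. f (power_add k g x))"
    using continuous_map_compose[OF continuous_map_power_add f] by (simp add: o_def)
  from L_means(2)[OF this origin]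
  show "(\<lambda>N. (\<Sum>n<N. f (power_add k g ((T ^^ n) origin))) / N) \<longlonglongrightarrow> L (\<lambda>x. f (power_add k g x))" .
  show "(\<lambda>N. (\<Sum>n<N. f (power_add k g ((T ^^ n) origin))) / N) \<longlonglongrightarrow> L f"
    by (rule L_means(1)[OF f origin])
qed

abbreviation \<mu> :: "(nat \<Rightarrow> 'a) measure" where "\<mu> \<equiv> L.functional_measure"

lemma normalized_haar_\<mu>: "normalized_haar X (power_add k) \<mu>"
  unfolding normalized_haar_def
proof (intro conjI ballI)
  show "invariant_measure (power_add k g) \<mu>" for g
    by (rule L.invariant_functional_measure[OF homeomorphic_maps_power_add]) (rule L_translate)
qed (rule L.regular_borel_prob_functional_measure)

text \<open>\<open>THE\<close> is justified by uniqueness: every Haar measure integrates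
  \<open>f\<close> to \<open>L f\<close>, and regular measures with equal integrals agree.\<close>

lemma haar_power_eq: "haar_power k = \<mu>"
  unfolding haar_power_def
proof (rule the_equality)
  fix \<nu> :: "(nat \<Rightarrow> 'a) measure" assume \<nu>: "normalized_haar X (power_add k) \<nu>"
  show "\<nu> = \<mu>"
  proof (rule regular_borel_prob_eqI[OF compact_X Hausdorff_X])
    fix f :: "_ \<Rightarrow> real" assume f: "continuous_map X euclideanreal f"
    show "(\<integral>x. f x \<partial>\<nu>) = (\<integral>x. f x \<partial>\<mu>)"
      by (simp only: L_means(3)[OF f \<nu>] L_means(3)[OF f normalized_haar_\<mu>])
  qed (use \<nu> normalized_haar_\<mu> in \<open>unfold normalized_haar_def, blast\<close>)+
qed (rule normalized_haar_\<mu>)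

lemma uniformly_distributed_orbit:
  assumes x: "x \<in> topspace X"
  shows "uniformly_distributed X (haar_power k) (\<lambda>n. (T ^^ n) x)"
  unfolding uniformly_distributed_def
proof (intro allI impI)
  fix f :: "(nat \<Rightarrow> 'a) \<Rightarrow> complex" assume f: "continuous_map X euclidean f"
  obtain c where c: "\<And>g x. x \<in> topspace X \<Longrightarrow> mean_tends (\<lambda>n. f (power_add k g ((T ^^ n) x))) c"
    "\<And>\<nu>. normalized_haar X (power_add k) \<nu> \<Longrightarrow> (\<integral>x. f x \<partial>\<nu>) = c"
    using milnes_means[OF \<gamma> torsion_free f] by metis
  have "(\<lambda>N. (\<Sum>n<N. f ((T ^^ n) x)) / of_nat N) \<longlonglongrightarrow> c"
    using c(1)[OF x, of "\<lambda>i\<in>{1..k}. 0"]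
    by (simp only: mean_tends_def power_add_zero[OF milnes_iterate_in_topspace[OF x]])
  then show "(\<lambda>N. (\<Sum>n<N. f ((T ^^ n) x)) / of_nat N) \<longlonglongrightarrow> (\<integral>x. f x \<partial>haar_power k)"
    unfolding haar_power_eq c(2)[OF normalized_haar_\<mu>] .
qed

text \<open>Every point can be translated to \<open>z\<close>, so finitely many translates of the
  open set where \<open>f\<close> exceeds \<open>f z / 2\<close> cover the space, and a finite sum
  of translates of \<open>f\<close> is at least \<open>f z / 2\<close> everywhere. Each translate
  has the value \<open>L f\<close>, which thus cannot be 0.\<close>

lemma L_pos:
  assumes f: "continuous_map X euclideanreal f" and nonneg: "\<And>x. x \<in> topspace X \<Longrightarrow> 0 \<le> f x"
    and z: "z \<in> topspace X" "0 < f z"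
  shows "0 < L f"
proof -
  define h where "h g = (\<lambda>x. f (power_add k g x))" for g
  have h: "continuous_map X euclideanreal (h g)" for g
    using continuous_map_compose[OF continuous_map_power_add f] by (simp add: o_def h_def)
  have hsum: "continuous_map X euclideanreal (\<lambda>x. \<Sum>g\<in>D. h g x)" if "finite D" for D
    using h that by (intro continuous_map_sum) auto
  have L_sum: "L (\<lambda>x. \<Sum>g\<in>D. h g x) = card D * L f" if "finite D" for D
    using that
  proof induction
    case (insert g D)
    then have "L (\<lambda>x. \<Sum>g\<in>insert g D. h g x) = L (h g) + L (\<lambda>x. \<Sum>g\<in>D. h g x)"
      using L.add[OF h hsum] by simp
    also have "L (h g) = L f" unfolding h_def by (rule L_translate[OF f])
    finally show ?case using insert by (simp add: algebra_simps)
  qed (simp add: L.const)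
  define U where "U g = {x \<in> topspace X. h g x \<in> {f z / 2<..}}" for g
  have "openin X (U g)" for g
    unfolding U_def by (rule openin_continuous_map_preimage[OF h]) simp
  moreover have "topspace X \<subseteq> \<Union>(range U)"
  proof
    fix x assume x: "x \<in> topspace X"
    define g where "g = (\<lambda>i\<in>{1..k}. z i - x i)"
    have "power_add k g x = z"
    proof
      fix i show "power_add k g x i = z i"
        using PiE_arb[OF z(1)[unfolded topspace_power_space], of i]
        by (cases "i \<in> {1..k}") (auto simp: power_add_def g_def)
    qed
    then have "x \<in> U g" using x z(2) by (simp add: U_def h_def)
    then show "x \<in> \<Union>(range U)" by blast
  qed
  ultimately obtain F where F: "finite F" "F \<subseteq> range U" "topspace X \<subseteq> \<Union>F"
    using compact_X unfolding compact_space_alt by (metis (no_types, lifting) imageE)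
  then obtain D where D: "finite D" "F = U ` D"
    by (meson finite_subset_image)
  have "f z / 2 = L (\<lambda>_. f z / 2)" by (simp add: L.const)
  also have "\<dots> \<le> L (\<lambda>x. \<Sum>g\<in>D. h g x)"
  proof (rule L.mono)
    fix x assume x: "x \<in> topspace X"
    then obtain g where g: "g \<in> D" "x \<in> U g" using F(3) D by blast
    have "f z / 2 \<le> h g x" using g(2) by (simp add: U_def)
    also have "\<dots> \<le> (\<Sum>g\<in>D. h g x)"
      using g(1) D(1) nonneg by (intro member_le_sum) (auto simp: h_def power_add_in_topspace)
    finally show "f z / 2 \<le> (\<Sum>g\<in>D. h g x)" .
  qed (use hsum[OF D(1)] in simp_all)
  also have "\<dots> = card D * L f" by (rule L_sum[OF D(1)])
  finally have "0 < card D * L f" using z(2) by simp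
  then show ?thesis by (simp add: zero_less_mult_iff)
qed

text \<open>If \<open>C\<close> missed a point, a Urysohn function equal to 1 there and to 0 on
  \<open>C\<close> would have all orbit averages 0, against \<open>L_pos\<close>. Only the forward
  orbit enters, so the lemma is available before \<open>T\<close> is known to be invertible.\<close>

lemma orbit_dense:
  assumes x: "x \<in> topspace X" and C: "closedin X C" and orbit: "\<And>n. (T ^^ n) x \<in> C"
  shows "C = topspace X"
proof (rule ccontr)
  assume "C \<noteq> topspace X"
  then obtain z where z: "z \<in> topspace X" "z \<notin> C"
    using closedin_subset[OF C] by blast
  have "closedin X {z}"
    using z(1) Hausdorff_X by (simp add: closedin_Hausdorff_singleton)
  moreover have "openin X (topspace X - C)" "{z} \<subseteq> topspace X - C"
    using C z by auto
  ultimately obtain f :: "_ \<Rightarrow> real" where f: "continuous_map X euclideanreal f"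
    "\<And>x. x \<in> topspace X \<Longrightarrow> 0 \<le> f x \<and> f x \<le> 1"
    "\<And>x. x \<in> {z} \<Longrightarrow> f x = 1" "\<And>x. x \<in> topspace X - (topspace X - C) \<Longrightarrow> f x = 0"
    using Urysohn_function[OF compact_X Hausdorff_X] by metis
  have "f ((T ^^ n) x) = 0" for n
    using f(4)[of "(T ^^ n) x"] orbit[of n] closedin_subset[OF C] by blast
  then have "(\<lambda>N. 0) \<longlonglongrightarrow> L f"
    using L_means(2)[OF f(1) x] by simp
  then have "L f = 0" using LIMSEQ_unique tendsto_const by blast
  moreover have "0 < L f"
    by (rule L_pos[OF f(1) _ z(1)]) (use f in auto)
  ultimately show False by simp
qed

section \<open>The Milnes map as a minimal homeomorphism\<close>

lemma continuous_map_T: "continuous_map X X T"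
proof -
  have coord: "continuous_on (\<Pi>\<^sub>E i\<in>{1..k}. UNIV) (\<lambda>x :: nat \<Rightarrow> 'a. x j)" for j
    by (rule continuous_on_subset[OF continuous_on_product_coordinates]) simp
  have "continuous_map X euclidean (\<lambda>x. T x i)" if "i \<in> {1..k}" for i
    unfolding continuous_map_power_space milnes_map_def nat_multiple_def using that
    by (simp, intro continuous_on_add continuous_on_const continuous_on_sum coord[simplified])
  then have "continuous_map X (product_topology (\<lambda>_. euclidean) {1..k}) T"
    unfolding continuous_map_componentwise by (auto simp: milnes_map_def)
  then show ?thesis by (simp add: power_space_def)
qed

text \<open>The map is triangular with diagonal coefficient \<open>(k - i) choose 0\<close>, which
  is 1, so equal images determine the coordinates one after another.\<close>

lemma inj_on_T: "inj_on T (topspace X)"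
proof (rule inj_onI)
  fix x y assume xy: "x \<in> topspace X" "y \<in> topspace X" "T x = T y"
  have "i \<in> {1..k} \<Longrightarrow> x i = y i" for i
  proof (induction i rule: less_induct)
    case (less i)
    have eq: "(\<Sum>j=1..i. nat_multiple ((k - j) choose (i - j)) (z j))
        = z i + (\<Sum>j\<in>{1..<i}. nat_multiple ((k - j) choose (i - j)) (z j))" for z :: "nat \<Rightarrow> 'a"
    proof -
      have "{1..i} = insert i {1..<i}" using less.prems by auto
      then show ?thesis by simp
    qed
    have "(\<Sum>j\<in>{1..<i}. nat_multiple ((k - j) choose (i - j)) (x j))
        = (\<Sum>j\<in>{1..<i}. nat_multiple ((k - j) choose (i - j)) (y j))"
      using less by (intro sum.cong) auto
    moreover have "T z i = nat_multiple (k choose i) \<gamma>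
        + (z i + (\<Sum>j\<in>{1..<i}. nat_multiple ((k - j) choose (i - j)) (z j)))" for z
      unfolding milnes_map_def restrict_apply'[OF less.prems] eq ..
    moreover have "T x i = T y i" using xy(3) by simp
    ultimately show ?case by simp
  qed
  then show "x = y"
    using xy(1,2) unfolding topspace_power_space by (intro PiE_ext[of x "{1..k}" "\<lambda>_. UNIV" y]) auto
qed

text \<open>The image is compact, hence closed, and contains the forward orbit of
  \<open>T origin\<close>; by density it is the whole space.\<close>

lemma surj_T: "T ` topspace X = topspace X"
proof (rule orbit_dense)
  show "T origin \<in> topspace X" by (rule milnes_map_in_topspace)
  have "compactin X (T ` topspace X)"
    using image_compactin[OF _ continuous_map_T, of "topspace X"] compact_X by (simp add: compact_space_def)
  then show "closedin X (T ` topspace X)"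
    by (rule compactin_imp_closedin[OF Hausdorff_X])
  show "(T ^^ n) (T origin) \<in> T ` topspace X" for n
    using milnes_iterate_in_topspace[OF origin] by (metis funpow_swap1 imageI)
qed

lemma dynamical_system_T: "dynamical_system X T"
  using compact_X Hausdorff_X continuous_imp_homeomorphic_map[OF continuous_map_T compact_X Hausdorff_X surj_T inj_on_T]
  by (simp only: dynamical_system_def)

lemma minimal_system_T: "minimal_system X T"
  unfolding minimal_system_def
proof (intro conjI ballI dynamical_system_T)
  fix x assume x: "x \<in> topspace X"
  show "X closure_of orbit_Z X T x = topspace X"
  proof (rule orbit_dense[OF x closedin_closure_of])
    fix n
    have "(T ^^ n) x \<in> topspace X \<inter> orbit_Z X T x"
      using milnes_iterate_in_topspace[OF x] by (auto simp: orbit_Z_def)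
    then show "(T ^^ n) x \<in> X closure_of orbit_Z X T x"
      by (rule subsetD[OF closure_of_subset_Int])
  qed
qed

text \<open>The criterion for invariance concerns \<open>f\<close> composed with the inverse
  \<open>S\<close> of \<open>T\<close>. Averaging that function along the orbit of
  \<open>T origin\<close> gives the averages of \<open>f\<close> along the orbit of
  \<open>origin\<close>, and \<open>L\<close> does not depend on the starting point.\<close>

lemma invariant_measure_\<mu>: "invariant_measure T \<mu>"
proof -
  obtain S where S: "homeomorphic_maps X X T S"
    using dynamical_system_T by (auto simp: dynamical_system_def homeomorphic_map_maps)
  show ?thesis
  proof (rule L.invariant_functional_measure[OF S])
    fix f :: "_ \<Rightarrow> real" assume f: "continuous_map X euclideanreal f"
    have "continuous_map X X S" and ST: "\<And>x. x \<in> topspace X \<Longrightarrow> S (T x) = x"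
      using S by (auto simp: homeomorphic_maps_def)
    then have fS: "continuous_map X euclideanreal (\<lambda>x. f (S x))"
      using continuous_map_compose[of X X S euclideanreal f] f by (simp add: o_def)
    have eq: "S ((T ^^ n) (T origin)) = (T ^^ n) origin" for n
    proof -
      have "S (T ((T ^^ n) origin)) = (T ^^ n) origin"
        by (intro ST milnes_iterate_in_topspace origin)
      then show ?thesis by (simp add: funpow_swap1)
    qed
    show "L (\<lambda>x. f (S x)) = L f"
      using L_means(2)[OF fS milnes_map_in_topspace[of k \<gamma> origin]] L_means(2)[OF f origin]
      unfolding eq by (rule LIMSEQ_unique)
  qed
qed

text \<open>By invariance every non-empty orbit average of \<open>f\<close> has the same integral as
  \<open>f\<close>, while the averages are bounded and converge at every point to the constant
  \<open>L f\<close>; dominated convergence identifies the two.\<close>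

lemma invariant_measure_integral_eq_L:
  assumes \<nu>: "regular_borel_prob X \<nu>" "invariant_measure T \<nu>" and f: "continuous_map X euclideanreal f"
  shows "(\<integral>x. f x \<partial>\<nu>) = L f"
proof -
  interpret \<nu>: prob_space \<nu> using \<nu>(1) by (simp add: regular_borel_prob_def)
  have space: "space \<nu> = topspace X" using \<nu>(1) by (simp add: regular_borel_prob_def)
  have Tn: "continuous_map X X (T ^^ n)" for n
    by (induction n) (auto simp: o_def intro: continuous_map_compose[OF _ continuous_map_T, unfolded o_def])
  have fn: "continuous_map X euclideanreal (\<lambda>x. f ((T ^^ n) x))" for n
    using continuous_map_compose[OF Tn f] by (simp add: o_def)
  have int: "(\<integral>x. f ((T ^^ n) x) \<partial>\<nu>) = (\<integral>x. f x \<partial>\<nu>)" for n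
  proof (induction n)
    case (Suc n)
    have "(\<integral>x. f ((T ^^ Suc n) x) \<partial>\<nu>) = (\<integral>x. f ((T ^^ n) (T x)) \<partial>\<nu>)"
      by (simp add: funpow_swap1)
    also have "\<dots> = (\<integral>x. f ((T ^^ n) x) \<partial>\<nu>)"
      by (rule invariant_measure_integral[OF \<nu>(2) regular_borel_prob_measurable[OF \<nu>(1) fn]])
    finally show ?case using Suc by simp
  qed simp
  obtain B where B: "\<And>x. x \<in> topspace X \<Longrightarrow> norm (f x) \<le> B"
    using continuous_map_bounded[OF compact_X f] by blast
  have B0: "0 \<le> B" using B[OF origin] norm_ge_zero order.trans by blast
  define A where "A N x = (\<Sum>n<N. f ((T ^^ n) x)) / real N" for N x
  have "(\<lambda>N. \<integral>x. A N x \<partial>\<nu>) \<longlonglongrightarrow> (\<integral>x. L f \<partial>\<nu>)"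
  proof (rule integral_dominated_convergence[where w = "\<lambda>_. B"])
    show "A N \<in> borel_measurable \<nu>" for N
      unfolding A_def
      by (intro borel_measurable_divide borel_measurable_sum borel_measurable_const
          regular_borel_prob_measurable[OF \<nu>(1) fn])
    show "AE x in \<nu>. (\<lambda>N. A N x) \<longlonglongrightarrow> L f"
      unfolding A_def using L_means(2)[OF f] by (intro AE_I2) (simp add: space)
    show "AE x in \<nu>. norm (A N x) \<le> B" for N
    proof (rule AE_I2)
      fix x assume "x \<in> space \<nu>"
      then have "norm (\<Sum>n<N. f ((T ^^ n) x)) \<le> (\<Sum>n<N. B)"
        by (intro sum_norm_le B milnes_iterate_in_topspace) (simp add: space)
      then show "norm (A N x) \<le> B"
        using B0 by (cases "N = 0") (simp_all add: A_def field_simps)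
    qed
  qed simp_all
  \<comment> \<open>The empty average at \<open>N = 0\<close> is 0 by the convention for division,
    so the equality is claimed only from 1 on.\<close>
  moreover have "\<forall>\<^sub>F N in sequentially. (\<integral>x. A N x \<partial>\<nu>) = (\<integral>x. f x \<partial>\<nu>)"
  proof (rule eventually_sequentiallyI[of 1])
    fix N :: nat assume N: "1 \<le> N"
    have "(\<integral>x. A N x \<partial>\<nu>) = (\<Sum>n<N. \<integral>x. f ((T ^^ n) x) \<partial>\<nu>) / real N"
      unfolding A_def using regular_borel_prob_integrable[OF compact_X \<nu>(1) fn] by simp
    then show "(\<integral>x. A N x \<partial>\<nu>) = (\<integral>x. f x \<partial>\<nu>)"
      using N by (simp add: int)
  qed
  then have "(\<lambda>N. \<integral>x. A N x \<partial>\<nu>) \<longlonglongrightarrow> (\<integral>x. f x \<partial>\<nu>)"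
    by (rule tendsto_eventually)
  ultimately have "(\<integral>x. L f \<partial>\<nu>) = (\<integral>x. f x \<partial>\<nu>)"
    by (rule LIMSEQ_unique)
  then show ?thesis by (simp add: \<nu>.prob_space)
qed

lemma uniquely_ergodic_T: "uniquely_ergodic X T"
  unfolding uniquely_ergodic_def
proof (intro conjI dynamical_system_T ex1I[of _ \<mu>] L.regular_borel_prob_functional_measure invariant_measure_\<mu>)
  fix \<nu> :: "(nat \<Rightarrow> 'a) measure" assume \<nu>: "regular_borel_prob X \<nu> \<and> invariant_measure T \<nu>"
  show "\<nu> = \<mu>"
  proof (rule regular_borel_prob_eqI[OF compact_X Hausdorff_X])
    fix f :: "_ \<Rightarrow> real" assume f: "continuous_map X euclideanreal f"
    have "(\<integral>x. f x \<partial>\<nu>) = L f"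
      using \<nu> f by (intro invariant_measure_integral_eq_L) blast+
    also have "\<dots> = (\<integral>x. f x \<partial>\<mu>)"
      by (rule L_means(3)[OF f normalized_haar_\<mu>, symmetric])
    finally show "(\<integral>x. f x \<partial>\<nu>) = (\<integral>x. f x \<partial>\<mu>)" .
  qed (use \<nu> L.regular_borel_prob_functional_measure in blast)+
qed

end

theorem theorem4p1:
  fixes k :: nat and \<gamma>\<^sub>0 :: "'a::{topological_ab_group_add, t2_space}"
  assumes "compact_monothetic \<gamma>\<^sub>0"
    and "no_nontrivial_finite_order (dual_group :: ('a \<Rightarrow> complex) monoid)"
  shows "((\<forall>x\<in>topspace (power_space k).
             uniformly_distributed (power_space k) (haar_power k) (\<lambda>n. (milnes_map k \<gamma>\<^sub>0 ^^ n) x))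
           \<and> minimal_system (power_space k) (milnes_map k \<gamma>\<^sub>0))
         \<and> strictly_ergodic (power_space k) (milnes_map k \<gamma>\<^sub>0)"
proof -
  interpret milnes k \<gamma>\<^sub>0
    using assms by unfold_locales
  show ?thesis
    by (simp add: strictly_ergodic_def uniformly_distributed_orbit minimal_system_T uniquely_ergodic_T)
qed

end
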